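(* Let $(X,\|\cdot\|,\tau)$ be a sequentially complete C-sequential Saks space with mixed topology $\gamma$, $C\in\mathcal L(X,\gamma)$, $n\in\mathbb N_0$, and let $(C(t))_{t\ge0}$ be a non-degenerate $2n$-times integrated locally $\tau$-bi-continuous and exponentially bounded $C$-cosine family on $X$ with bi-generator $A$. Define $$S(t)x:=\frac{(2n)!}{2^{2n-1}\cdot n!\cdot\Gamma(n+\frac12)}\int_0^\infty e^{-s^2}C(2t^{1/2}s)x\,ds\quad(t\ge0,\ x\in X),$$ where the integral is an improper Riemann integral in $(X,\gamma)$. Then $(S(t))_{t\ge0}$ is a non-degenerate $n$-times integrated locally $\tau$-bi-continuous and exponentially bounded $C$-semigroup on $X$ generated by $A$.
   Context: Linear spaces are over $\mathbb R$ or $\mathbb C$; $\mathbb N_0=\{0,1,2,\dots\}$; $\Gamma$ is the Gamma function. For a normed space $(X,\|\cdot\|)$, $\tau_{\|\cdot\|}$ is the norm topology and $\mathcal L(X)$ the bounded linear operators with the operator norm; $\mathcal L(X,\gamma)$ is the space of $\gamma$-continuous linear maps $X\to X$. Saks space: a triple $(X,\|\cdot\|,\tau)$ where $(X,\|\cdot\|)$ is a normed space and $\tau\subseteq\tau_{\|\cdot\|}$ is a Hausdorff locally convex topology on $X$ such that some directed system of seminorms $\mathcal P_\tau$ generating $\tau$ satisfies $\|x\|=\sup_{p\in\mathcal P_\tau}p(x)$ for all $x\in X$. Its mixed topology $\gamma$ is the finest linear topology on $X$ that coincides with $\tau$ on $\|\cdot\|$-bounded sets and satisfies $\tau\subseteq\gamma\subseteq\tau_{\|\cdot\|}$;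 it is Hausdorff locally convex. The Saks space is sequentially complete if $(X,\gamma)$ is sequentially complete, and C-sequential if every convex sequentially open subset of $(X,\gamma)$ is open ($U$ is sequentially open if every sequence converging to a point of $U$ is eventually in $U$). A family $(T_j)_{j\in J}$ of linear maps $X\to X$ is bi-equicontinuous if for every $\|\cdot\|$-bounded sequence $(x_k)$ in $X$ and $x\in X$ with $x_k\to x$ w.r.t. $\tau$ one has $\tau$-$\lim_{k\to\infty}T_j(x_k-x)=0$ uniformly for $j\in J$. A family $(S(t))_{t\ge0}$ is locally $\tau$-bi-continuous if all $S(t)\in\mathcal L(X)$, $t\mapsto S(t)x$ is $\tau$-continuous for every $x\in X$, and for every compact $N\subseteq[0,\infty)$ one has $\sup_{t\in N}\|S(t)\|_{\mathcal L(X)}<\infty$ and $(S(t))_{t\in N}$ is bi-equicontinuous (then $t\mapsto S(t)x$ is also $\gamma$-continuous). It is exponentially bounded if $\sup_{t\ge0}\|e^{\alpha t}S(t)\|_{\mathcal L(X)}<\infty$ for some $\alpha\in\mathbb R$. It is non-degenerate if $S(t)x=0$ for all $t>0$ implies $x=0$. A family $(S(t))_{t\ge0}$ of linear maps on $X$ is a $0$-times integrated $C$-semigroup ($=C$-semigroup) if $S(0)=C$ and $S(t)S(s)=S(t+s)C$ for $t,s\ge0$; a $0$-times integrated $C$-cosine family ($=C$-cosine family) if $S(0)=C$ and $2S(t)S(s)=(S(t+s)+S(t-s))C$ for $t\ge s\ge0$. For $\alpha>0$ a $\gamma$-strongly continuous family is an $\alpha$-times integrated $C$-semigroup if $S(0)=0$,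 $CS(t)=S(t)C$ and $$S(t)S(s)x=\tfrac1{\Gamma(\alpha)}\Bigl[\int_0^{s+t}-\int_0^t-\int_0^s\Bigr](t+s-r)^{\alpha-1}S(r)Cx\,dr,$$ and an $\alpha$-times integrated $C$-cosine family if $S(0)=0$, $CS(t)=S(t)C$ and $$2S(t)S(s)x=\tfrac1{\Gamma(\alpha)}\Bigl(\Bigl[\int_0^{s+t}-\int_0^t-\int_0^s\Bigr](t+s-r)^{\alpha-1}S(r)Cx\,dr+\int_{|t-s|}^t(s-t+r)^{\alpha-1}S(r)Cx\,dr+\int_{|t-s|}^s(t-s+r)^{\alpha-1}S(r)Cx\,dr+\int_0^{|t-s|}(|t-s|+r)^{\alpha-1}S(r)Cx\,dr\Bigr)$$ for all $t,s\ge0$, $x\in X$ (integrals are (improper) Riemann integrals in $(X,\gamma)$). Generator: let $(S(t))_{t\ge0}$ be a non-degenerate $m$-times integrated ($m\in\mathbb N_0$) $C$-semigroup or $C$-cosine family that is locally $\tau$-bi-continuous and exponentially bounded; under the present hypotheses on $X$ it is $\gamma$-strongly continuous and there is $\omega\ge0$ such that $(e^{-\omega t}S(t))_{t\ge0}$ is $\gamma$-equicontinuous. For $\lambda>\omega$ put $R(\lambda)x:=\int_0^\infty\lambda^me^{-\lambda t}S(t)x\,dt$ (improper Riemann integral in $(X,\gamma)$); $R(\lambda)$ and $C$ are injective. The (bi-)generator is the operator $A$ with $D(A):=\{x\in X: Cx\in R(\lambda)(X)\}$ and $Ax:=(\lambda-R(\lambda)^{-1}C)x$ in the semigroup case, $Ax:=\lambda(\lambda-R(\lambda)^{-1}C)x$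 in the cosine case; it does not depend on $\lambda>\omega$. *)

theory Defs
  imports "HOL-Analysis.Analysis"
begin

text \<open>
  A linear space over \<open>\<real>\<close> or \<open>\<complex>\<close> is a real normed vector space \<open>'a\<close> together with an action
  \<open>scl\<close> of a field \<open>'k :: real_normed_field\<close> extending the real one. A field in this class carries
  a multiplicative norm extending the absolute value of the reals, so by the Gelfand--Mazur theorem
  it is isometrically isomorphic to \<open>\<real>\<close> or to \<open>\<complex>\<close>; both cases occur (\<open>scl = scaleR\<close> for the
  former).
\<close>

definition normed_space_over :: "('k::real_normed_field \<Rightarrow> 'a::real_normed_vector \<Rightarrow> 'a) \<Rightarrow> bool" where
  "normed_space_over scl \<longleftrightarrow>
     vector_space scl \<and>
     (\<forall>r x. scl (of_real r) x = r *\<^sub>R x) \<and>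
     (\<forall>k x. norm (scl k x) = norm k * norm x)"

definition linear_topology :: "('k::real_normed_field \<Rightarrow> 'a::real_normed_vector \<Rightarrow> 'a) \<Rightarrow> 'a topology \<Rightarrow> bool" where
  "linear_topology scl X \<longleftrightarrow>
     topspace X = UNIV \<and>
     continuous_map (prod_topology X X) X (\<lambda>(x, y). x + y) \<and>
     continuous_map (prod_topology euclidean X) X (\<lambda>(k, x). scl k x)"

definition seminorm_over :: "('k::real_normed_field \<Rightarrow> 'a::real_normed_vector \<Rightarrow> 'a) \<Rightarrow> ('a \<Rightarrow> real) \<Rightarrow> bool" where
  "seminorm_over scl p \<longleftrightarrow>
     (\<forall>x. 0 \<le> p x) \<and> (\<forall>x y. p (x + y) \<le> p x + p y) \<and> (\<forall>k x. p (scl k x) = norm k * p x)"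

definition directed_seminorms :: "('k::real_normed_field \<Rightarrow> 'a::real_normed_vector \<Rightarrow> 'a) \<Rightarrow> ('a \<Rightarrow> real) set \<Rightarrow> bool" where
  "directed_seminorms scl P \<longleftrightarrow>
     P \<noteq> {} \<and> (\<forall>p\<in>P. seminorm_over scl p) \<and>
     (\<forall>p\<in>P. \<forall>q\<in>P. \<exists>r\<in>P. \<forall>x. p x \<le> r x \<and> q x \<le> r x)"

text \<open>Since the system is directed, the balls of its single members form a neighbourhood base.\<close>

definition generates_topology :: "('a::real_normed_vector \<Rightarrow> real) set \<Rightarrow> 'a topology \<Rightarrow> bool" where
  "generates_topology P X \<longleftrightarrow>
     (\<forall>U. openin X U \<longleftrightarrow> (\<forall>x\<in>U. \<exists>p\<in>P. \<exists>e>0. {y. p (y - x) < e} \<subseteq> U))"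

definition Saks_space :: "('k::real_normed_field \<Rightarrow> 'a::real_normed_vector \<Rightarrow> 'a) \<Rightarrow> 'a topology \<Rightarrow> bool" where
  "Saks_space scl \<tau> \<longleftrightarrow>
     normed_space_over scl \<and>
     Hausdorff_space \<tau> \<and>
     (\<forall>U. openin \<tau> U \<longrightarrow> open U) \<and>
     (\<exists>P. directed_seminorms scl P \<and> generates_topology P \<tau> \<and>
          (\<forall>x. bdd_above ((\<lambda>p. p x) ` P) \<and> norm x = (SUP p\<in>P. p x)))"

definition mixed_candidate ::
  "('k::real_normed_field \<Rightarrow> 'a::real_normed_vector \<Rightarrow> 'a) \<Rightarrow> 'a topology \<Rightarrow> 'a topology \<Rightarrow> bool" where
  "mixed_candidate scl \<tau> \<gamma> \<longleftrightarrow>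
     linear_topology scl \<gamma> \<and>
     (\<forall>B. bounded B \<longrightarrow> subtopology \<gamma> B = subtopology \<tau> B) \<and>
     (\<forall>U. openin \<tau> U \<longrightarrow> openin \<gamma> U) \<and>
     (\<forall>U. openin \<gamma> U \<longrightarrow> open U)"

definition mixed_topology ::
  "('k::real_normed_field \<Rightarrow> 'a::real_normed_vector \<Rightarrow> 'a) \<Rightarrow> 'a topology \<Rightarrow> 'a topology \<Rightarrow> bool" where
  "mixed_topology scl \<tau> \<gamma> \<longleftrightarrow>
     mixed_candidate scl \<tau> \<gamma> \<and>
     (\<forall>\<sigma>. mixed_candidate scl \<tau> \<sigma> \<longrightarrow> (\<forall>U. openin \<sigma> U \<longrightarrow> openin \<gamma> U))"

definition Cauchy_seq_in :: "'a::real_normed_vector topology \<Rightarrow> (nat \<Rightarrow> 'a) \<Rightarrow> bool" where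
  "Cauchy_seq_in X x \<longleftrightarrow>
     (\<forall>U. openin X U \<and> 0 \<in> U \<longrightarrow> (\<exists>N. \<forall>i\<ge>N. \<forall>j\<ge>N. x i - x j \<in> U))"

definition seq_complete :: "'a::real_normed_vector topology \<Rightarrow> bool" where
  "seq_complete X \<longleftrightarrow> (\<forall>x. Cauchy_seq_in X x \<longrightarrow> (\<exists>l. limitin X x l sequentially))"

definition seq_open :: "'a topology \<Rightarrow> 'a set \<Rightarrow> bool" where
  "seq_open X U \<longleftrightarrow>
     (\<forall>x l. l \<in> U \<and> limitin X x l sequentially \<longrightarrow> (\<forall>\<^sub>F n in sequentially. x n \<in> U))"

definition C_sequential :: "'a::real_normed_vector topology \<Rightarrow> bool" where
  "C_sequential X \<longleftrightarrow> (\<forall>U. convex U \<and> seq_open X U \<longrightarrow> openin X U)"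

definition equicontinuous_family ::
  "'a::real_normed_vector topology \<Rightarrow> 'j set \<Rightarrow> ('j \<Rightarrow> 'a \<Rightarrow> 'a) \<Rightarrow> bool" where
  "equicontinuous_family X J T \<longleftrightarrow>
     (\<forall>U. openin X U \<and> 0 \<in> U \<longrightarrow>
        (\<exists>V. openin X V \<and> 0 \<in> V \<and> (\<forall>j\<in>J. \<forall>x\<in>V. T j x \<in> U)))"

definition bi_equicontinuous ::
  "'a::real_normed_vector topology \<Rightarrow> 'j set \<Rightarrow> ('j \<Rightarrow> 'a \<Rightarrow> 'a) \<Rightarrow> bool" where
  "bi_equicontinuous \<tau> J T \<longleftrightarrow>
     (\<forall>x l. bounded (range x) \<and> limitin \<tau> x l sequentially \<longrightarrow>
        (\<forall>U. openin \<tau> U \<and> 0 \<in> U \<longrightarrow>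
           (\<forall>\<^sub>F k in sequentially. \<forall>j\<in>J. T j (x k - l) \<in> U)))"

text \<open>Families indexed by \<open>t \<ge> 0\<close> are functions on all reals whose values at \<open>t < 0\<close> are never used.\<close>

definition strongly_continuous :: "'a topology \<Rightarrow> (real \<Rightarrow> 'a \<Rightarrow> 'a) \<Rightarrow> bool" where
  "strongly_continuous X S \<longleftrightarrow> (\<forall>x. continuous_map (top_of_set {0..}) X (\<lambda>t. S t x))"

definition locally_bi_continuous ::
  "('k::real_normed_field \<Rightarrow> 'a::real_normed_vector \<Rightarrow> 'a) \<Rightarrow> 'a topology \<Rightarrow> (real \<Rightarrow> 'a \<Rightarrow> 'a) \<Rightarrow> bool" where
  "locally_bi_continuous scl \<tau> S \<longleftrightarrow>
     (\<forall>t\<ge>0. Vector_Spaces.linear scl scl (S t) \<and> bounded_linear (S t)) \<and>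
     strongly_continuous \<tau> S \<and>
     (\<forall>N. compact N \<and> N \<subseteq> {0..} \<longrightarrow>
        bdd_above ((\<lambda>t. onorm (S t)) ` N) \<and> bi_equicontinuous \<tau> N S)"

definition exponentially_bounded :: "(real \<Rightarrow> 'a::real_normed_vector \<Rightarrow> 'a) \<Rightarrow> bool" where
  "exponentially_bounded S \<longleftrightarrow>
     (\<exists>\<alpha>::real. bdd_above ((\<lambda>t. onorm (\<lambda>x. exp (\<alpha> * t) *\<^sub>R S t x)) ` {0..}))"

definition non_degenerate :: "(real \<Rightarrow> 'a::real_normed_vector \<Rightarrow> 'a) \<Rightarrow> bool" where
  "non_degenerate S \<longleftrightarrow> (\<forall>x. (\<forall>t>0. S t x = 0) \<longrightarrow> x = 0)"

text \<open>
  Convergence of Riemann sums as the mesh tends to 0. In contrast to the library's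
  \<^const>\<open>division_filter\<close>, only gauges of constant radius are used, which gives the
  Riemann integral rather than the Henstock--Kurzweil integral.
\<close>

definition riemann_filter :: "real \<Rightarrow> real \<Rightarrow> (real \<times> real set) set filter" where
  "riemann_filter a b =
     (INF \<delta>\<in>{0<..}. principal {p. p tagged_division_of {a..b} \<and> (\<lambda>x. ball x \<delta>) fine p})"

definition has_riemann_integral ::
  "'a::real_normed_vector topology \<Rightarrow> (real \<Rightarrow> 'a) \<Rightarrow> 'a \<Rightarrow> real \<Rightarrow> real \<Rightarrow> bool" where
  "has_riemann_integral X f I a b \<longleftrightarrow>
     limitin X (\<lambda>p. \<Sum>(x, k)\<in>p. measure lborel k *\<^sub>R f x) I (riemann_filter a b)"

text \<open>Oriented: some of the integrals in the functional equation of integrated cosine families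
  have an upper limit below the lower one.\<close>

definition riemann_integral ::
  "'a::real_normed_vector topology \<Rightarrow> real \<Rightarrow> real \<Rightarrow> (real \<Rightarrow> 'a) \<Rightarrow> 'a" where
  "riemann_integral X a b f =
     (if a \<le> b then (THE I. has_riemann_integral X f I a b)
      else - (THE I. has_riemann_integral X f I b a))"

definition has_improper_integral ::
  "'a::real_normed_vector topology \<Rightarrow> (real \<Rightarrow> 'a) \<Rightarrow> 'a \<Rightarrow> bool" where
  "has_improper_integral X f I \<longleftrightarrow>
     (\<exists>F. (\<forall>b\<ge>0. has_riemann_integral X f (F b) 0 b) \<and> limitin X F I at_top)"

text \<open>The integral over \<open>[0,\<infinity>)\<close>.\<close>

definition improper_integral :: "'a::real_normed_vector topology \<Rightarrow> (real \<Rightarrow> 'a) \<Rightarrow> 'a" where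
  "improper_integral X f = (THE I. has_improper_integral X f I)"

text \<open>
  \<open>m\<close>-times integrated families for natural \<open>m\<close>. For \<open>m > 0\<close> the weights
  \<open>u\<^bsup>m-1\<^esup>\<close> are continuous on \<open>[0,\<infinity>)\<close>, so that all integrals are proper Riemann integrals.
\<close>

definition integrated_semigroup ::
  "('k::real_normed_field \<Rightarrow> 'a::real_normed_vector \<Rightarrow> 'a) \<Rightarrow> 'a topology \<Rightarrow> nat \<Rightarrow> ('a \<Rightarrow> 'a)
     \<Rightarrow> (real \<Rightarrow> 'a \<Rightarrow> 'a) \<Rightarrow> bool" where
  "integrated_semigroup scl \<gamma> m C S \<longleftrightarrow>
     (\<forall>t\<ge>0. Vector_Spaces.linear scl scl (S t)) \<and>
     (if m = 0 then
        (\<forall>x. S 0 x = C x) \<and>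
        (\<forall>t\<ge>0. \<forall>s\<ge>0. \<forall>x. S t (S s x) = S (t + s) (C x))
      else
        strongly_continuous \<gamma> S \<and>
        (\<forall>x. S 0 x = 0) \<and>
        (\<forall>t\<ge>0. \<forall>x. C (S t x) = S t (C x)) \<and>
        (\<forall>t\<ge>0. \<forall>s\<ge>0. \<forall>x.
           let g = (\<lambda>r. (t + s - r) ^ (m - 1) *\<^sub>R S r (C x)) in
           S t (S s x) = (1 / Gamma (real m)) *\<^sub>R
             (riemann_integral \<gamma> 0 (s + t) g - riemann_integral \<gamma> 0 t g - riemann_integral \<gamma> 0 s g)))"

definition integrated_cosine ::
  "('k::real_normed_field \<Rightarrow> 'a::real_normed_vector \<Rightarrow> 'a) \<Rightarrow> 'a topology \<Rightarrow> nat \<Rightarrow> ('a \<Rightarrow> 'a)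
     \<Rightarrow> (real \<Rightarrow> 'a \<Rightarrow> 'a) \<Rightarrow> bool" where
  "integrated_cosine scl \<gamma> m C S \<longleftrightarrow>
     (\<forall>t\<ge>0. Vector_Spaces.linear scl scl (S t)) \<and>
     (if m = 0 then
        (\<forall>x. S 0 x = C x) \<and>
        (\<forall>t s. t \<ge> s \<and> s \<ge> 0 \<longrightarrow>
           (\<forall>x. 2 *\<^sub>R S t (S s x) = S (t + s) (C x) + S (t - s) (C x)))
      else
        strongly_continuous \<gamma> S \<and>
        (\<forall>x. S 0 x = 0) \<and>
        (\<forall>t\<ge>0. \<forall>x. C (S t x) = S t (C x)) \<and>
        (\<forall>t\<ge>0. \<forall>s\<ge>0. \<forall>x.
           let g = (\<lambda>r. (t + s - r) ^ (m - 1) *\<^sub>R S r (C x)) in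
           2 *\<^sub>R S t (S s x) = (1 / Gamma (real m)) *\<^sub>R
             (riemann_integral \<gamma> 0 (s + t) g - riemann_integral \<gamma> 0 t g - riemann_integral \<gamma> 0 s g
              + riemann_integral \<gamma> \<bar>t - s\<bar> t (\<lambda>r. (s - t + r) ^ (m - 1) *\<^sub>R S r (C x))
              + riemann_integral \<gamma> \<bar>t - s\<bar> s (\<lambda>r. (t - s + r) ^ (m - 1) *\<^sub>R S r (C x))
              + riemann_integral \<gamma> 0 \<bar>t - s\<bar> (\<lambda>r. (\<bar>t - s\<bar> + r) ^ (m - 1) *\<^sub>R S r (C x)))))"

definition laplace_op ::
  "'a::real_normed_vector topology \<Rightarrow> nat \<Rightarrow> (real \<Rightarrow> 'a \<Rightarrow> 'a) \<Rightarrow> real \<Rightarrow> 'a \<Rightarrow> 'a" where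
  "laplace_op \<gamma> m S l x = improper_integral \<gamma> (\<lambda>t. (l ^ m * exp (- l * t)) *\<^sub>R S t x)"

text \<open>
  A partially defined operator is given by its domain \<open>D\<close> and a map \<open>A\<close>, of which only the
  restriction to \<open>D\<close> matters. In the situations considered, the operators \<open>laplace_op \<gamma> m S l\<close> with
  \<open>l > \<omega>\<close> are injective, and \<open>inv\<close>, applied to an element of the range, is the inverse. The operator
  is the same for all \<open>l > \<omega>\<close> and hence also does not depend on the choice of \<open>\<omega>\<close>.
\<close>

definition semigroup_generator ::
  "'a::real_normed_vector topology \<Rightarrow> nat \<Rightarrow> ('a \<Rightarrow> 'a) \<Rightarrow> (real \<Rightarrow> 'a \<Rightarrow> 'a)
     \<Rightarrow> 'a set \<Rightarrow> ('a \<Rightarrow> 'a) \<Rightarrow> bool" where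
  "semigroup_generator \<gamma> m C S D A \<longleftrightarrow>
     (\<exists>\<omega>\<ge>0. equicontinuous_family \<gamma> {0..} (\<lambda>t x. exp (- \<omega> * t) *\<^sub>R S t x) \<and>
       (\<forall>l>\<omega>. D = {x. C x \<in> range (laplace_op \<gamma> m S l)} \<and>
              (\<forall>x\<in>D. A x = l *\<^sub>R x - inv (laplace_op \<gamma> m S l) (C x))))"

definition cosine_generator ::
  "'a::real_normed_vector topology \<Rightarrow> nat \<Rightarrow> ('a \<Rightarrow> 'a) \<Rightarrow> (real \<Rightarrow> 'a \<Rightarrow> 'a)
     \<Rightarrow> 'a set \<Rightarrow> ('a \<Rightarrow> 'a) \<Rightarrow> bool" where
  "cosine_generator \<gamma> m C S D A \<longleftrightarrow>
     (\<exists>\<omega>\<ge>0. equicontinuous_family \<gamma> {0..} (\<lambda>t x. exp (- \<omega> * t) *\<^sub>R S t x) \<and>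
       (\<forall>l>\<omega>. D = {x. C x \<in> range (laplace_op \<gamma> m S l)} \<and>
              (\<forall>x\<in>D. A x = l *\<^sub>R (l *\<^sub>R x - inv (laplace_op \<gamma> m S l) (C x)))))"

end

theory Submission
  imports Defs "HOL-Probability.Sinc_Integral" "HOL-Real_Asymp.Real_Asymp"
begin

text \<open>
  Vectors are tested against the linear functionals that are sequentially \<open>\<tau>\<close>-continuous on
  norm-bounded sets. By the Hahn--Banach theorem these separate points; they commute with the
  integrals, and their compositions with \<open>Cos t\<close> and \<open>S t\<close> are of the same kind. So every identity
  between vectors reduces to one between real functions.

  The constant in the definition of \<open>S\<close> is \<open>2 / sqrt pi\<close> for every \<open>n\<close>, so \<open>S\<close> arises from \<open>Cos\<close> by
  subordination to the heat kernel: the Laplace transform of \<open>S\<close> at \<open>l\<close> is that of \<open>Cos\<close> at \<open>sqrt l\<close>,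
  divided by \<open>sqrt l\<close>. The double Laplace transform of the functional equation of \<open>Cos\<close> is a resolvent
  equation. It makes the transforms injective, whence the equality of the generators, and after
  the substitution \<open>l = \<mu>\<^sup>2\<close> it becomes the double Laplace transform of the functional equation
  of \<open>S\<close>, which Lerch's theorem, applied in each variable, recovers.
\<close>

section \<open>Laplace transforms\<close>

text \<open>Write L(l) for the transform \<open>L l\<close> of \<open>Cos\<close>. The resolvent
  equation is (l^2 - m^2) L(l) L(m) = l^(1-2n) L(m) C - m^(1-2n) L(l) C. Replacing L(l) by L(sqrt l)
  / sqrt l turns it into the same equation with l - m on the left and the powers l^(-n), m^(-n) on
  the right, which belongs to n-times integrated semigroups. The functional equation itself does not
  pass through the Gaussian average in any direct way, as it mixes two times under integrals with
  moving limits. Two obstacles shape the rest. For n = 0 the definition of a cosine family gives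
  d'Alembert's equation for t >= s only and says nothing about commuting with \<open>C\<close>; both
  gaps are closed by non-degeneracy and the injectivity of \<open>C\<close>, which in turn is
  extracted from the generator. Moreover, \<open>\<gamma>\<close> is given as the finest topology of
  its kind, whereas completeness and equicontinuity are stated with its neighbourhoods of 0; hence
  the description of these by seminorms that are \<open>\<tau>\<close>-continuous on balls.\<close>

definition exp_order :: "(real \<Rightarrow> real) \<Rightarrow> real \<Rightarrow> bool" where
  "exp_order f a \<longleftrightarrow>
     set_borel_measurable borel {0..} f \<and> (\<exists>M\<ge>0. \<forall>t\<ge>0. \<bar>f t\<bar> \<le> M * exp (a * t))"

definition laplace :: "(real \<Rightarrow> real) \<Rightarrow> real \<Rightarrow> real" where
  "laplace f l = (LBINT t:{0..}. exp (- l * t) * f t)"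

definition conv :: "(real \<Rightarrow> real) \<Rightarrow> (real \<Rightarrow> real) \<Rightarrow> real \<Rightarrow> real" where
  "conv f g t = (LBINT r:{0..t}. f (t - r) * g r)"

lemma laplace_cong:
  assumes "\<And>t. t \<ge> 0 \<Longrightarrow> f t = g t"
  shows "laplace f l = laplace g l"
  unfolding laplace_def by (intro set_lebesgue_integral_cong) (auto simp: assms)

lemma exp_orderI:
  assumes "continuous_on {0..} f" "\<And>t. t \<ge> 0 \<Longrightarrow> \<bar>f t\<bar> \<le> M * exp (a * t)"
  shows "exp_order f a"
proof -
  have "0 \<le> \<bar>f 0\<bar>" by simp
  also have "\<dots> \<le> M" using assms(2)[of 0] by simp
  finally have "0 \<le> M" .
  moreover have "set_borel_measurable borel {0..} f"
    unfolding set_borel_measurable_def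
    by (rule borel_measurable_continuous_on_indicator) (use assms in auto)
  ultimately show ?thesis unfolding exp_order_def using assms(2) by auto
qed

lemma exp_orderE:
  assumes "exp_order f a"
  obtains M where "M \<ge> 0" "\<And>t. t \<ge> 0 \<Longrightarrow> \<bar>f t\<bar> \<le> M * exp (a * t)"
  using assms unfolding exp_order_def by auto

lemma exp_order_mono:
  assumes "exp_order f a" "a \<le> b"
  shows "exp_order f b"
proof -
  obtain M where M: "M \<ge> 0" "\<And>t. t \<ge> 0 \<Longrightarrow> \<bar>f t\<bar> \<le> M * exp (a * t)"
    using exp_orderE[OF assms(1)] by blast
  have "\<bar>f t\<bar> \<le> M * exp (b * t)" if "t \<ge> 0" for t
  proof -
    have "M * exp (a * t) \<le> M * exp (b * t)"
      using M(1) assms(2) that by (intro mult_left_mono) (auto intro: mult_right_mono)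
    with M(2)[OF that] show ?thesis by linarith
  qed
  with M(1) show ?thesis using assms(1) unfolding exp_order_def by auto
qed

text \<open>One term of the exponential series of \<open>a * t\<close> already bounds the power,
  which gives the constant \<open>fact k / a ^ k\<close>.\<close>

lemma exp_order_power:
  assumes "a > 0"
  shows "exp_order (\<lambda>t. t ^ k) a"
proof (rule exp_orderI)
  show "continuous_on {0..} (\<lambda>t::real. t ^ k)" by (intro continuous_intros)
  fix t :: real assume t: "t \<ge> 0"
  have "(a * t) ^ k /\<^sub>R fact k \<le> exp (a * t)"
  proof -
    have "sum (\<lambda>i. (a * t) ^ i /\<^sub>R fact i) {k} \<le> exp (a * t)"
      unfolding exp_def using t assms
      by (intro sum_le_suminf summable_exp_generic) auto
    then show ?thesis by simp
  qed
  then show "\<bar>t ^ k\<bar> \<le> (fact k / a ^ k) * exp (a * t)"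
    using t assms by (simp add: field_simps power_mult_distrib)
qed

text \<open>Stated with \<open>has_bochner_integral\<close>, so that it yields integrability
  together with the value; the case \<open>k = 0\<close> is the integrable majorant in the estimates
  below.\<close>

lemma laplace_power_aux:
  fixes l :: real
  assumes "l > 0"
  shows "has_bochner_integral lborel (\<lambda>t. indicator {0..} t *\<^sub>R (exp (- l * t) * t ^ k)) (fact k / l ^ Suc k)"
proof -
  have "has_bochner_integral lborel (\<lambda>t. (l * t)^k * exp (-(l * t)) * indicator {0 ..} (l * t)) (fact k /\<^sub>R \<bar>l\<bar>)"
    using has_bochner_integral_I0i_power_exp_m'[of k] lborel_has_bochner_integral_real_affine_iff
      [of l "\<lambda>x. x^k * exp (-x) * indicator {0 ..} x::real" "fact k" 0] assms by simp
  then have "has_bochner_integral lborel (\<lambda>t. (1 / l^k) * ((l * t)^k * exp (-(l * t)) * indicator {0 ..} (l * t)))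
      ((1 / l ^ k) * (fact k /\<^sub>R \<bar>l\<bar>))"
    by (rule has_bochner_integral_mult_right)
  moreover have "(\<lambda>t. (1 / l^k) * ((l * t)^k * exp (-(l * t)) * indicator {0 ..} (l * t)))
      = (\<lambda>t. indicator {0..} t *\<^sub>R (exp (- l * t) * t ^ k))"
    using assms by (auto simp: indicator_def power_mult_distrib zero_le_mult_iff fun_eq_iff)
  ultimately show ?thesis using assms by (simp add: field_simps)
qed

lemma laplace_power:
  assumes "l > 0"
  shows "laplace (\<lambda>t. t ^ k) l = fact k / l ^ Suc k"
  using has_bochner_integral_integral_eq[OF laplace_power_aux[OF assms]]
  unfolding laplace_def set_lebesgue_integral_def .

lemma exp_order_integrable:
  assumes "exp_order f a" "a < l"
  shows "set_integrable lborel {0..} (\<lambda>t. exp (- l * t) * f t)"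
proof -
  obtain M where M: "M \<ge> 0" "\<And>t. t \<ge> 0 \<Longrightarrow> \<bar>f t\<bar> \<le> M * exp (a * t)"
    using exp_orderE[OF assms(1)] by blast
  have "integrable lborel (\<lambda>t. indicator {0..} t *\<^sub>R (exp (- (l - a) * t) * t ^ 0))"
    using laplace_power_aux[of "l - a" 0] assms(2) by (auto simp: has_bochner_integral_iff)
  then have i: "integrable lborel (\<lambda>t. M * (indicator {0..} t *\<^sub>R (exp (- (l - a) * t) * t ^ 0)))"
    by (rule integrable_mult_right)
  have m: "(\<lambda>x. indicator {0..} x *\<^sub>R f x) \<in> borel_measurable borel"
    using assms(1) unfolding exp_order_def set_borel_measurable_def by simp
  have "(\<lambda>x. exp (- l * x) * (indicator {0..} x *\<^sub>R f x)) \<in> borel_measurable borel"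
    using m by measurable
  then have m2: "(\<lambda>x. indicator {0..} x *\<^sub>R (exp (- l * x) * f x)) \<in> borel_measurable lborel"
    by (simp add: mult.left_commute)
  show ?thesis unfolding set_integrable_def
  proof (rule Bochner_Integration.integrable_bound[OF i m2], rule AE_I2)
    fix t :: real
    have "exp (- l * t) * \<bar>f t\<bar> \<le> M * exp (- (l - a) * t)" if "t \<ge> 0"
    proof -
      have "exp (- l * t) * \<bar>f t\<bar> \<le> exp (- l * t) * (M * exp (a * t))"
        using M(2)[OF that] by (intro mult_left_mono) auto
      also have "\<dots> = M * exp (- (l - a) * t)" by (simp add: exp_add[symmetric] algebra_simps)
      finally show ?thesis .
    qed
    then show "norm (indicator {0..} t *\<^sub>R (exp (- l * t) * f t)) \<le> norm (M * (indicator {0..} t *\<^sub>R (exp (- (l - a) * t) * t ^ 0)))"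
      using M(1) by (auto simp: indicator_def abs_mult)
  qed
qed

text \<open>The constant \<open>M\<close> is explicit, in contrast to \<open>exp_order\<close>: it
  depends on \<open>t\<close> when the bound is applied to the translates \<open>f (t + u)\<close>
  in \<open>exp_order_lshift\<close>.\<close>

lemma laplace_bound:
  assumes "set_borel_measurable borel {0..} f" "M \<ge> 0" "\<And>t. t \<ge> 0 \<Longrightarrow> \<bar>f t\<bar> \<le> M * exp (a * t)" "a < l"
  shows "\<bar>laplace f l\<bar> \<le> M / (l - a)"
proof -
  have eo: "exp_order f a" using assms unfolding exp_order_def by auto
  have i: "set_integrable lborel {0..} (\<lambda>t. exp (- l * t) * f t)"
    using exp_order_integrable[OF eo assms(4)] .
  have b: "has_bochner_integral lborel (\<lambda>t. M * (indicator {0..} t *\<^sub>R (exp (- (l - a) * t) * t ^ 0))) (M * (fact 0 / (l - a) ^ Suc 0))"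
    using laplace_power_aux[of "l - a" 0] assms(4) by (intro has_bochner_integral_mult_right) auto
  have "\<bar>laplace f l\<bar> \<le> (LINT t|lborel. norm (indicator {0..} t *\<^sub>R (exp (- l * t) * f t)))"
    unfolding laplace_def set_lebesgue_integral_def real_norm_def[symmetric] by (rule integral_norm_bound)
  also have "\<dots> \<le> (LINT t|lborel. M * (indicator {0..} t *\<^sub>R (exp (- (l - a) * t) * t ^ 0)))"
  proof (rule integral_mono)
    show "integrable lborel (\<lambda>t. norm (indicator {0..} t *\<^sub>R (exp (- l * t) * f t)))"
      using i unfolding set_integrable_def by (rule integrable_norm)
    show "integrable lborel (\<lambda>t. M * (indicator {0..} t *\<^sub>R (exp (- (l - a) * t) * t ^ 0)))"
      using b by (auto simp: has_bochner_integral_iff)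
    fix t :: real
    have "exp (- l * t) * \<bar>f t\<bar> \<le> M * exp (- (l - a) * t)" if "t \<ge> 0"
    proof -
      have "exp (- l * t) * \<bar>f t\<bar> \<le> exp (- l * t) * (M * exp (a * t))"
        using assms(3)[OF that] by (intro mult_left_mono) auto
      also have "\<dots> = M * exp (- (l - a) * t)" by (simp add: exp_add[symmetric] algebra_simps)
      finally show ?thesis .
    qed
    then show "norm (indicator {0..} t *\<^sub>R (exp (- l * t) * f t)) \<le> M * (indicator {0..} t *\<^sub>R (exp (- (l - a) * t) * t ^ 0))"
      by (auto simp: indicator_def abs_mult)
  qed
  also have "\<dots> = M / (l - a)" using b by (auto simp: has_bochner_integral_iff)
  finally show ?thesis .
qed

lemma laplace_add:
  assumes "exp_order f a" "exp_order g a" "a < l"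
  shows "laplace (\<lambda>t. f t + g t) l = laplace f l + laplace g l"
  using set_integral_add(2)[OF exp_order_integrable[OF assms(1,3)] exp_order_integrable[OF assms(2,3)]]
  unfolding laplace_def by (simp add: algebra_simps)

lemma laplace_diff:
  assumes "exp_order f a" "exp_order g a" "a < l"
  shows "laplace (\<lambda>t. f t - g t) l = laplace f l - laplace g l"
  using set_integral_diff(2)[OF exp_order_integrable[OF assms(1,3)] exp_order_integrable[OF assms(2,3)]]
  unfolding laplace_def by (simp add: algebra_simps)

lemma laplace_cmult: "laplace (\<lambda>t. c * f t) l = c * laplace f l"
proof -
  have "laplace (\<lambda>t. c * f t) l = (LBINT t:{0..}. c * (exp (- l * t) * f t))"
    unfolding laplace_def by (simp add: algebra_simps)
  then show ?thesis by (simp add: laplace_def)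
qed

lemma exp_order_add:
  assumes "exp_order f a" "exp_order g a"
  shows "exp_order (\<lambda>t. f t + g t) a"
proof -
  obtain M where M: "M \<ge> 0" "\<And>t. t \<ge> 0 \<Longrightarrow> \<bar>f t\<bar> \<le> M * exp (a * t)"
    using exp_orderE[OF assms(1)] by blast
  obtain N where N: "N \<ge> 0" "\<And>t. t \<ge> 0 \<Longrightarrow> \<bar>g t\<bar> \<le> N * exp (a * t)"
    using exp_orderE[OF assms(2)] by blast
  have "(\<lambda>x. indicator {0..} x *\<^sub>R f x + indicator {0..} x *\<^sub>R g x) \<in> borel_measurable borel"
    using assms unfolding exp_order_def set_borel_measurable_def by (intro borel_measurable_add) auto
  then have "set_borel_measurable borel {0..} (\<lambda>t. f t + g t)"
    unfolding set_borel_measurable_def by (simp add: algebra_simps)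
  moreover have "\<bar>f t + g t\<bar> \<le> (M + N) * exp (a * t)" if "t \<ge> 0" for t
    using M(2)[OF that] N(2)[OF that] by (simp add: algebra_simps)
  ultimately show ?thesis unfolding exp_order_def using M(1) N(1) by (auto intro!: exI[of _ "M+N"])
qed

lemma exp_order_cmult:
  assumes "exp_order f a"
  shows "exp_order (\<lambda>t. c * f t) a"
proof -
  obtain M where M: "M \<ge> 0" "\<And>t. t \<ge> 0 \<Longrightarrow> \<bar>f t\<bar> \<le> M * exp (a * t)"
    using exp_orderE[OF assms(1)] by blast
  have "(\<lambda>x. c * (indicator {0..} x *\<^sub>R f x)) \<in> borel_measurable borel"
    using assms unfolding exp_order_def set_borel_measurable_def by (intro borel_measurable_times) auto
  then have "set_borel_measurable borel {0..} (\<lambda>t. c * f t)"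
    unfolding set_borel_measurable_def by (simp add: algebra_simps)
  moreover have "\<bar>c * f t\<bar> \<le> (\<bar>c\<bar> * M) * exp (a * t)" if "t \<ge> 0" for t
    using mult_left_mono[OF M(2)[OF that], of "\<bar>c\<bar>"] by (simp add: abs_mult mult.assoc)
  ultimately show ?thesis unfolding exp_order_def using M(1) by (auto intro!: exI[of _ "\<bar>c\<bar>*M"])
qed

lemma exp_order_diff:
  assumes "exp_order f a" "exp_order g a"
  shows "exp_order (\<lambda>t. f t - g t) a"
  using exp_order_add[OF assms(1) exp_order_cmult[OF assms(2), of "-1"]] by simp

section \<open>Convolutions and their Laplace transforms\<close>

lemma integral_convolution:
  fixes u v :: "real \<Rightarrow> real"
  assumes u: "integrable lborel u" and v: "integrable lborel v"
  shows "(LINT t|lborel. LINT r|lborel. u (t - r) * v r) = (LINT t|lborel. u t) * (LINT t|lborel. v t)"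
proof -
  have mu[measurable]: "u \<in> borel_measurable borel" and mv[measurable]: "v \<in> borel_measurable borel"
    using borel_measurable_integrable[OF u] borel_measurable_integrable[OF v] by auto
  have shift: "integrable lborel (\<lambda>t. u (t - r))" "(LINT t|lborel. u (t - r)) = (LINT t|lborel. u t)" 
    "(LINT t|lborel. \<bar>u (t - r)\<bar>) = (LINT t|lborel. \<bar>u t\<bar>)" for r
    using lborel_integrable_real_affine[OF u, of 1 "-r"] lborel_integral_real_affine[of 1 u "-r"]
       lborel_integral_real_affine[of 1 "\<lambda>t. \<bar>u t\<bar>" "-r"] by (simp_all add: algebra_simps)
  have int: "integrable (lborel \<Otimes>\<^sub>M lborel) (\<lambda>(r, t). u (t - r) * v r)"
  proof (rule lborel_pair.Fubini_integrable)
    show "(\<lambda>(r, t). u (t - r) * v r) \<in> borel_measurable (lborel \<Otimes>\<^sub>M lborel)" by measurable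
    have "(\<lambda>r. LINT t|lborel. norm (case (r, t) of (r, t) \<Rightarrow> u (t - r) * v r)) = (\<lambda>r. (LINT t|lborel. \<bar>u t\<bar>) * \<bar>v r\<bar>)"
      by (simp add: abs_mult shift)
    moreover have "integrable lborel (\<lambda>r. (LINT t|lborel. \<bar>u t\<bar>) * \<bar>v r\<bar>)"
      using v by (intro integrable_mult_right integrable_abs)
    ultimately show "integrable lborel (\<lambda>r. LINT t|lborel. norm (case (r, t) of (r, t) \<Rightarrow> u (t - r) * v r))" by simp
    show "AE r in lborel. integrable lborel (\<lambda>t. case (r, t) of (r, t) \<Rightarrow> u (t - r) * v r)"
      using shift(1) by auto
  qed
  \<comment> \<open>After the exchange the inner integral does not depend on \<open>r\<close>, by
    translation invariance of Lebesgue measure.\<close>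
  have "(LINT t|lborel. LINT r|lborel. u (t - r) * v r) = (LINT r|lborel. LINT t|lborel. u (t - r) * v r)"
    using lborel_pair.Fubini_integral[OF int] by simp
  also have "\<dots> = (LINT r|lborel. (LINT t|lborel. u t) * v r)" by (simp add: shift)
  also have "\<dots> = (LINT t|lborel. u t) * (LINT t|lborel. v t)" by simp
  finally show ?thesis .
qed

text \<open>The factor exp (-l t) splits into exp (-l (t - r)) and exp (-l r), so that the damped
  functions, extended by 0 to the negative axis, convolve on the whole line.\<close>

theorem laplace_conv:
  assumes "exp_order f a" "exp_order g a" "a < l"
  shows "laplace (conv f g) l = laplace f l * laplace g l"
proof -
  define u where "u = (\<lambda>t. indicator {0..} t *\<^sub>R (exp (- l * t) * f t))"
  define v where "v = (\<lambda>t. indicator {0..} t *\<^sub>R (exp (- l * t) * g t))"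
  have uv: "integrable lborel u" "integrable lborel v"
    using exp_order_integrable[OF assms(1,3)] exp_order_integrable[OF assms(2,3)]
    unfolding set_integrable_def u_def v_def by auto
  have "(LINT r|lborel. u (t - r) * v r) = indicator {0..} t *\<^sub>R (exp (- l * t) * conv f g t)" for t
  proof -
    have "(LINT r|lborel. u (t - r) * v r) = (LINT r|lborel. (indicator {0..} t * exp (- l * t)) * (indicator {0..t} r *\<^sub>R (f (t - r) * g r)))"
    proof (rule Bochner_Integration.integral_cong[OF refl])
      fix r :: real
      have "exp (- l * (t - r)) * exp (- l * r) = exp (- l * t)" by (simp add: exp_add[symmetric] algebra_simps)
      then show "u (t - r) * v r = (indicator {0..} t * exp (- l * t)) * (indicator {0..t} r *\<^sub>R (f (t - r) * g r))"
        by (auto simp: u_def v_def indicator_def)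
    qed
    also have "\<dots> = indicator {0..} t *\<^sub>R (exp (- l * t) * conv f g t)"
      unfolding conv_def set_lebesgue_integral_def by simp
    finally show ?thesis .
  qed
  then show ?thesis
    using integral_convolution[OF uv] unfolding laplace_def set_lebesgue_integral_def u_def v_def by simp
qed

lemma exp_order_measurable:
  assumes "exp_order f a"
  shows "(\<lambda>x. indicator {0..} x * f x) \<in> borel_measurable borel"
  using assms unfolding exp_order_def set_borel_measurable_def by simp

text \<open>Moves the interval of integration, which depends on \<open>t\<close>, into the
  integrand; in this form measurability in \<open>t\<close> is that of a parameter integral.\<close>

lemma conv_eq_full:
  assumes "t \<ge> 0"
  shows "conv f g t = (LINT r|lborel. (indicator {0..} (t - r) * f (t - r)) * (indicator {0..} r * g r))"
  unfolding conv_def set_lebesgue_integral_def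
  by (intro Bochner_Integration.integral_cong) (auto simp: indicator_def)

text \<open>The integrand is bounded by \<open>M * N * exp (a * t)\<close> uniformly in
  \<open>r\<close>; the length \<open>t\<close> of the interval is absorbed by passing from the rate
  \<open>a\<close> to any larger \<open>b\<close>.\<close>

lemma exp_order_conv:
  assumes f: "exp_order f a" and g: "exp_order g a" and "a < b"
  shows "exp_order (conv f g) b"
proof -
  obtain M where M: "M \<ge> 0" "\<And>t. t \<ge> 0 \<Longrightarrow> \<bar>f t\<bar> \<le> M * exp (a * t)"
    using exp_orderE[OF f] by blast
  obtain N where N: "N \<ge> 0" "\<And>t. t \<ge> 0 \<Longrightarrow> \<bar>g t\<bar> \<le> N * exp (a * t)"
    using exp_orderE[OF g] by blast
  note [measurable] = exp_order_measurable[OF f] exp_order_measurable[OF g]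
  have "(\<lambda>t. LINT r|lborel. (indicator {0..} (t - r) * f (t - r)) * (indicator {0..} r * g r)) \<in> borel_measurable borel"
    by measurable
  then have "(\<lambda>t. indicator {0..} t * (LINT r|lborel. (indicator {0..} (t - r) * f (t - r)) * (indicator {0..} r * g r))) \<in> borel_measurable borel"
    by measurable
  moreover have "(\<lambda>t. indicator {0..} t * (LINT r|lborel. (indicator {0..} (t - r) * f (t - r)) * (indicator {0..} r * g r)))
      = (\<lambda>t. indicator {0..} t *\<^sub>R conv f g t)"
    by (auto simp: indicator_def conv_eq_full fun_eq_iff)
  ultimately have m: "set_borel_measurable borel {0..} (conv f g)"
    unfolding set_borel_measurable_def by simp
  have "\<bar>conv f g t\<bar> \<le> (M * N / (b - a)) * exp (b * t)" if t: "t \<ge> 0" for t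
  proof -
    have "\<bar>conv f g t\<bar> \<le> (LINT r|lborel. norm (indicator {0..t} r *\<^sub>R (f (t - r) * g r)))"
      unfolding conv_def set_lebesgue_integral_def real_norm_def[symmetric] by (rule integral_norm_bound)
    also have "\<dots> \<le> (LINT r|lborel. indicator {0..t} r *\<^sub>R (M * N * exp (a * t)))"
    proof (rule integral_mono')
      show "integrable lborel (\<lambda>r. indicator {0..t} r *\<^sub>R (M * N * exp (a * t)))"
        using borel_integrable_atLeastAtMost'[of 0 t "\<lambda>_. M * N * exp (a * t)"] unfolding set_integrable_def by auto
      fix r :: real
      have "\<bar>f (t - r)\<bar> * \<bar>g r\<bar> \<le> M * N * exp (a * t)" if "0 \<le> r" "r \<le> t"
      proof -
        have "\<bar>f (t - r)\<bar> * \<bar>g r\<bar> \<le> (M * exp (a * (t - r))) * (N * exp (a * r))"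
          using that M N by (intro mult_mono) auto
        also have "\<dots> = M * N * (exp (a * (t - r)) * exp (a * r))" by simp
        also have "\<dots> = M * N * exp (a * t)" by (simp add: exp_add[symmetric] algebra_simps)
        finally show ?thesis .
      qed
      then show "norm (indicator {0..t} r *\<^sub>R (f (t - r) * g r)) \<le> indicator {0..t} r *\<^sub>R (M * N * exp (a * t))"
        by (auto simp: indicator_def abs_mult)
    qed (auto simp: indicator_def M N)
    also have "\<dots> = t * (M * N * exp (a * t))" using t by simp
    also have "\<dots> \<le> (exp ((b - a) * t) / (b - a)) * (M * N * exp (a * t))"
    proof (rule mult_right_mono)
      have "(b - a) * t \<le> exp ((b - a) * t)" using exp_ge_add_one_self[of "(b-a)*t"] by linarith
      then show "t \<le> exp ((b - a) * t) / (b - a)" using \<open>a < b\<close> by (simp add: field_simps)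
    qed (use M N in auto)
    also have "\<dots> = (M * N / (b - a)) * (exp ((b - a) * t) * exp (a * t))" by simp
    also have "exp ((b - a) * t) * exp (a * t) = exp (b * t)" by (simp add: exp_add[symmetric] algebra_simps)
    finally show ?thesis .
  qed
  then show ?thesis unfolding exp_order_def using m M(1) N(1) \<open>a < b\<close>
    by (auto intro!: exI[of _ "M * N / (b - a)"])
qed

lemma conv_eq_integral:
  assumes "continuous_on {0..} f" "continuous_on {0..} g" "t \<ge> 0"
  shows "conv f g t = integral {0..t} (\<lambda>r. f (t - r) * g r)"
proof -
  have "continuous_on {0..t} (\<lambda>r. f (t - r) * g r)"
    by (intro continuous_intros continuous_on_compose2[OF assms(1)] continuous_on_subset[OF assms(2)]) auto
  then have "set_integrable lborel {0..t} (\<lambda>r. f (t - r) * g r)"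
    by (intro borel_integrable_atLeastAtMost') 
  then show ?thesis unfolding conv_def using set_borel_integral_eq_integral(2) by blast
qed

text \<open>Scaling the interval to [0, 1] frees the domain of integration from \<open>t\<close>, so
  that continuity of parameter integrals over a compact interval applies.\<close>

lemma continuous_on_conv:
  assumes f: "continuous_on {0..} f" and g: "continuous_on {0..} g"
  shows "continuous_on {0..} (conv f g)"
proof -
  have eq: "conv f g t = t * integral {0..1} (\<lambda>w. f (t * (1 - w)) * g (t * w))" if t: "t \<ge> 0" for t
  proof (cases "t = 0")
    case True
    then show ?thesis using conv_eq_integral[OF f g, of 0] by simp
  next
    case False
    with t have t: "t > 0" by simp
    have c: "continuous_on {0..1} (\<lambda>w. f (t * (1 - w)) * g (t * w))"
      by (intro continuous_intros continuous_on_compose2[OF f] continuous_on_compose2[OF g]) (use t in auto)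
    have "conv f g t = \<bar>t\<bar> *\<^sub>R (LINT w|lborel. indicator {0..t} (0 + t * w) *\<^sub>R (f (t - (0 + t * w)) * g (0 + t * w)))"
      unfolding conv_def set_lebesgue_integral_def using t
      by (intro lborel_integral_real_affine) auto
    also have "\<dots> = t * (LINT w|lborel. indicator {0..1} w *\<^sub>R (f (t * (1 - w)) * g (t * w)))"
    proof -
      have "indicator {0..t} (0 + t * w) = (indicator {0..1} w :: real)" for w
        using t by (auto simp: indicator_def zero_le_mult_iff)
      then show ?thesis using t by (simp add: algebra_simps)
    qed
    also have "(LINT w|lborel. indicator {0..1} w *\<^sub>R (f (t * (1 - w)) * g (t * w))) = integral {0..1} (\<lambda>w. f (t * (1 - w)) * g (t * w))"
      using set_borel_integral_eq_integral(2)[OF borel_integrable_atLeastAtMost'[OF c]]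
      unfolding set_lebesgue_integral_def .
    finally show ?thesis .
  qed
  have "continuous_on ({0..} \<times> cbox 0 1) (\<lambda>(t, w). f (t * (1 - w)) * g (t * w))"
    unfolding case_prod_beta
    by (intro continuous_intros continuous_on_compose2[OF f] continuous_on_compose2[OF g]) auto
  then have "continuous_on {0..} (\<lambda>t. t * integral (cbox 0 1) (\<lambda>w. f (t * (1 - w)) * g (t * w)))"
    by (intro continuous_intros integral_continuous_on_param) 
  then show ?thesis by (rule continuous_on_eq) (simp add: eq)
qed

section \<open>Laplace transforms of translates\<close>

definition lshift :: "(real \<Rightarrow> real) \<Rightarrow> real \<Rightarrow> real \<Rightarrow> real" where
  "lshift f m t = laplace (\<lambda>u. f (t + u)) m"

lemma laplace_exp_shift: "laplace (\<lambda>t. exp (m * t) * f t) l = laplace f (l - m)"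
proof -
  have "exp (- l * t) * (exp (m * t) * f t) = exp (- (l - m) * t) * f t" for t
  proof -
    have "exp (- l * t) * exp (m * t) = exp (- (l - m) * t)" by (simp add: exp_add[symmetric] algebra_simps)
    then show ?thesis by (simp add: mult.assoc[symmetric])
  qed
  then show ?thesis unfolding laplace_def by presburger
qed

lemma exp_order_exp_mult:
  assumes "exp_order f a"
  shows "exp_order (\<lambda>t. exp (m * t) * f t) (a + m)"
proof -
  obtain M where M: "M \<ge> 0" "\<And>t. t \<ge> 0 \<Longrightarrow> \<bar>f t\<bar> \<le> M * exp (a * t)"
    using exp_orderE[OF assms] by blast
  note [measurable] = exp_order_measurable[OF assms]
  have "(\<lambda>t. exp (m * t) * (indicator {0..} t * f t)) \<in> borel_measurable borel"
    by measurable
  then have "set_borel_measurable borel {0..} (\<lambda>t. exp (m * t) * f t)"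
    unfolding set_borel_measurable_def by (simp add: mult.left_commute)
  moreover have "\<bar>exp (m * t) * f t\<bar> \<le> M * exp ((a + m) * t)" if "t \<ge> 0" for t
  proof -
    have "\<bar>exp (m * t) * f t\<bar> \<le> exp (m * t) * (M * exp (a * t))"
      using M(2)[OF that] by (simp add: abs_mult)
    also have "\<dots> = M * exp ((a + m) * t)" by (simp add: exp_add[symmetric] algebra_simps)
    finally show ?thesis .
  qed
  ultimately show ?thesis unfolding exp_order_def using M(1) by auto
qed

lemma exp_order_const:
  assumes "a \<ge> 0"
  shows "exp_order (\<lambda>_. c) a"
proof (rule exp_orderI)
  fix t :: real assume "t \<ge> 0"
  then show "\<bar>c\<bar> \<le> \<bar>c\<bar> * exp (a * t)"
    using assms mult_left_mono[of 1 "exp (a * t)" "\<bar>c\<bar>"] by simp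
qed simp

text \<open>Up to the factor \<open>exp (m * t)\<close>, \<open>lshift f m t\<close> is the tail
  from \<open>t\<close> on of the integral for \<open>laplace f m\<close>. The initial piece is a
  convolution with 1, which makes both continuity in \<open>t\<close> and a further Laplace
  transform accessible.\<close>

lemma lshift_eq:
  assumes f: "exp_order f a" and "a < m" and t: "t \<ge> 0"
  shows "lshift f m t = exp (m * t) * (laplace f m - conv (\<lambda>_. 1) (\<lambda>w. exp (- m * w) * f w) t)"
proof -
  define k where "k = (\<lambda>w. exp (- m * w) * f w)"
  have i: "set_integrable lborel {0..} k" using exp_order_integrable[OF assms(1,2)] unfolding k_def .
  have i2: "set_integrable lborel {0..t} k" "set_integrable lborel {t<..} k"
    using i t by (auto intro: set_integrable_subset)
  have "laplace f m = (LBINT w:{0..t}. k w) + (LBINT w:{t<..}. k w)"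
  proof -
    have "{0..} = {0..t} \<union> {t<..}" using t by auto
    then show ?thesis unfolding laplace_def k_def[symmetric]
      using set_integral_Un[OF _ i2] by (metis Int_emptyI atLeastAtMost_iff greaterThan_iff leD k_def)
  qed
  moreover have "(LBINT w:{0..t}. k w) = conv (\<lambda>_. 1) k t" unfolding conv_def by simp
  moreover have "(LBINT w:{t<..}. k w) = exp (- m * t) * lshift f m t"
  proof -
    have "(LBINT w:{t<..}. k w) = (LBINT w:{t..}. k w)"
    proof -
      have "set_integrable lborel {t..} k" using i t by (auto intro: set_integrable_subset)
      then have m: "(\<lambda>w. indicator {t..} w *\<^sub>R k w) \<in> borel_measurable lborel"
        "(\<lambda>w. indicator {t<..} w *\<^sub>R k w) \<in> borel_measurable lborel"
        using i2(2) unfolding set_integrable_def by (blast intro: borel_measurable_integrable)+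
      have "AE w in lborel. indicator {t<..} w *\<^sub>R k w = indicator {t..} w *\<^sub>R k w"
        using AE_lborel_singleton[of t] by eventually_elim (auto simp: indicator_def)
      then show ?thesis
        unfolding set_lebesgue_integral_def by (rule integral_cong_AE[OF m(2,1)])
    qed
    also have "\<dots> = (LINT u|lborel. indicator {t..} (t + 1 * u) *\<^sub>R k (t + 1 * u))"
      unfolding set_lebesgue_integral_def by (subst lborel_integral_real_affine[of 1 _ t]) auto
    also have "\<dots> = (LINT u|lborel. exp (- m * t) * (indicator {0..} u *\<^sub>R (exp (- m * u) * f (t + u))))"
    proof (rule Bochner_Integration.integral_cong[OF refl])
      fix u
      have "exp (- m * (t + u)) = exp (- m * t) * exp (- m * u)" by (simp add: exp_add[symmetric] algebra_simps)
      then show "indicator {t..} (t + 1 * u) *\<^sub>R k (t + 1 * u) = exp (- m * t) * (indicator {0..} u *\<^sub>R (exp (- m * u) * f (t + u)))"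
        by (auto simp: indicator_def k_def)
    qed
    also have "\<dots> = exp (- m * t) * lshift f m t"
      unfolding lshift_def laplace_def set_lebesgue_integral_def by simp
    finally show ?thesis .
  qed
  ultimately have "exp (- m * t) * lshift f m t = laplace f m - conv (\<lambda>_. 1) k t" by simp
  then have "exp (m * t) * (exp (- m * t) * lshift f m t) = exp (m * t) * (laplace f m - conv (\<lambda>_. 1) k t)" by simp
  then show ?thesis unfolding k_def by (simp add: mult.assoc[symmetric] exp_add[symmetric])
qed

lemma continuous_on_lshift:
  assumes "continuous_on {0..} f" "exp_order f a" "a < m"
  shows "continuous_on {0..} (lshift f m)"
proof -
  have "continuous_on {0..} (\<lambda>t. exp (m * t) * (laplace f m - conv (\<lambda>_. 1) (\<lambda>w. exp (- m * w) * f w) t))"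
    by (intro continuous_intros continuous_on_conv assms(1))
  then show ?thesis by (rule continuous_on_eq) (simp add: lshift_eq[OF assms(2,3)])
qed

lemma exp_order_shift:
  assumes "exp_order f a" "t \<ge> 0"
  shows "exp_order (\<lambda>u. f (t + u)) a"
proof -
  obtain M where M: "M \<ge> 0" "\<And>t. t \<ge> 0 \<Longrightarrow> \<bar>f t\<bar> \<le> M * exp (a * t)"
    using exp_orderE[OF assms(1)] by blast
  note [measurable] = exp_order_measurable[OF assms(1)]
  have "(\<lambda>u. indicator {0..} u * (indicator {0..} (t + u) * f (t + u))) \<in> borel_measurable borel"
    by measurable
  moreover have "(\<lambda>u. indicator {0..} u * (indicator {0..} (t + u) * f (t + u))) = (\<lambda>u. indicator {0..} u *\<^sub>R f (t + u))"
    using assms(2) by (auto simp: indicator_def)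
  ultimately have "set_borel_measurable borel {0..} (\<lambda>u. f (t + u))"
    unfolding set_borel_measurable_def by simp
  moreover have "\<bar>f (t + u)\<bar> \<le> (M * exp (a * t)) * exp (a * u)" if "u \<ge> 0" for u
    using M(2)[of "t + u"] assms(2) that by (simp add: exp_add[symmetric] algebra_simps)
  ultimately show ?thesis unfolding exp_order_def using M(1) by (auto intro!: exI[of _ "M * exp (a * t)"])
qed

lemma exp_order_lshift:
  assumes f: "continuous_on {0..} f" "exp_order f a" "a < m"
  shows "exp_order (lshift f m) a"
proof -
  obtain M where M: "M \<ge> 0" "\<And>t. t \<ge> 0 \<Longrightarrow> \<bar>f t\<bar> \<le> M * exp (a * t)"
    using exp_orderE[OF assms(2)] by blast
  show ?thesis
  proof (rule exp_orderI[OF continuous_on_lshift[OF f], of "M / (m - a)"])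
    fix t :: real assume t: "t \<ge> 0"
    have "\<bar>lshift f m t\<bar> \<le> (M * exp (a * t)) / (m - a)"
      unfolding lshift_def
    proof (rule laplace_bound[OF _ _ _ assms(3)])
      show "set_borel_measurable borel {0..} (\<lambda>u. f (t + u))"
        using exp_order_shift[OF f(2) t] unfolding exp_order_def by blast
      show "\<bar>f (t + u)\<bar> \<le> (M * exp (a * t)) * exp (a * u)" if "u \<ge> 0" for u
        using M(2)[of "t + u"] t that by (simp add: exp_add[symmetric] algebra_simps)
    qed (use M in auto)
    then show "\<bar>lshift f m t\<bar> \<le> M / (m - a) * exp (a * t)" by simp
  qed
qed

text \<open>Multiplication by \<open>exp (m * t)\<close> moves the transform from \<open>l\<close>
  to \<open>l - m\<close>, where the convolution theorem applies to the constant 1 and the damped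
  function \<open>k\<close>; their transforms are 1 / (l - m) and
  \<open>laplace f l\<close>.\<close>

theorem laplace_lshift:
  assumes f: "exp_order f a" and "a < m" "m < l"
  shows "laplace (lshift f m) l = (laplace f m - laplace f l) / (l - m)"
proof -
  define k where "k = (\<lambda>w. exp (- m * w) * f w)"
  \<comment> \<open>Any rate strictly between 0 and \<open>l - m\<close> would do: a convolution of
    two functions of order 0 is only known to be of every positive order.\<close>
  define c where "c = (l - m) / 2"
  have c: "0 < c" "c < l - m" unfolding c_def using assms by auto
  have k0: "exp_order k 0"
    unfolding k_def by (rule exp_order_mono[OF exp_order_exp_mult[OF f]]) (use assms in auto)
  have one: "exp_order (\<lambda>_. 1) 0" by (rule exp_order_const) auto
  have lk: "laplace k (l - m) = laplace f l"
    unfolding k_def by (subst laplace_exp_shift) auto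
  have "laplace (lshift f m) l = laplace (\<lambda>t. exp (m * t) * (laplace f m - conv (\<lambda>_. 1) k t)) l"
    unfolding k_def by (rule laplace_cong) (rule lshift_eq[OF f assms(2)])
  also have "\<dots> = laplace (\<lambda>t. laplace f m - conv (\<lambda>_. 1) k t) (l - m)" by (rule laplace_exp_shift)
  also have "\<dots> = laplace (\<lambda>t. laplace f m) (l - m) - laplace (conv (\<lambda>_. 1) k) (l - m)"
    by (rule laplace_diff[OF exp_order_const exp_order_conv[OF one k0 c(1)] c(2)]) (use c in auto)
  also have "laplace (conv (\<lambda>_. 1) k) (l - m) = laplace (\<lambda>_. 1) (l - m) * laplace k (l - m)"
    by (rule laplace_conv[OF one k0]) (use assms in auto)
  also have "laplace (\<lambda>_. 1) (l - m) = 1 / (l - m)" using laplace_power[of "l - m" 0] assms by simp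
  also have "laplace (\<lambda>t. laplace f m) (l - m) = laplace f m / (l - m)"
    using laplace_cmult[of "laplace f m" "\<lambda>_. 1" "l - m"] laplace_power[of "l - m" 0] assms by simp
  finally show ?thesis using lk by (simp add: diff_divide_distrib)
qed

lemma exp_order_exp: "exp_order (\<lambda>t. exp (m * t)) m"
  by (rule exp_orderI[of _ 1]) (auto intro!: continuous_intros)

lemma laplace_exp: "m < l \<Longrightarrow> laplace (\<lambda>t. exp (m * t)) l = 1 / (l - m)"
  using laplace_exp_shift[of m "\<lambda>_. 1" l] laplace_power[of "l - m" 0] by simp

text \<open>Lerch's theorem: with \<open>x = exp (-t)\<close> the hypothesis says that all moments of a continuous
  function on the unit interval vanish.\<close>

theorem laplace_eq_0_imp_eq_0:
  assumes f: "continuous_on {0..} f" "exp_order f a" and z: "\<And>l. l > b \<Longrightarrow> laplace f l = 0" and "t \<ge> 0"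
  shows "f t = 0"
proof -
  \<comment> \<open>The surplus 1 over \<open>a\<close> makes \<open>g\<close> decay like exp (-t);
    thus \<open>G x\<close> is at most \<open>M * x\<close> in modulus, and \<open>G\<close> is
    continuous at 0 with value 0.\<close>
  define c where "c = max a b + 1"
  have c: "c > a" "c > b" "c - a \<ge> 1" unfolding c_def by auto
  obtain M where M: "M \<ge> 0" "\<And>t. t \<ge> 0 \<Longrightarrow> \<bar>f t\<bar> \<le> M * exp (a * t)"
    using exp_orderE[OF f(2)] by blast
  define g where "g = (\<lambda>t. exp (- c * t) * f t)"
  have gcont: "continuous_on {0..} g" unfolding g_def by (intro continuous_intros f)
  have gb: "\<bar>g t\<bar> \<le> M * exp (- t)" if "t \<ge> 0" for t
  proof -
    have "\<bar>g t\<bar> \<le> exp (- c * t) * (M * exp (a * t))"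
      unfolding g_def using M(2)[OF that] by (simp add: abs_mult)
    also have "\<dots> = M * exp (- (c - a) * t)" by (simp add: exp_add[symmetric] algebra_simps)
    also have "\<dots> \<le> M * exp (- t)"
      using c(3) that M(1) mult_right_mono[of 1 "c - a" t] by (intro mult_left_mono) (auto simp: algebra_simps)
    finally show ?thesis .
  qed
  have gi: "set_integrable lborel {0..} g" unfolding g_def by (rule exp_order_integrable[OF f(2) c(1)])
  define G where "G = (\<lambda>x. if x \<le> 0 then 0 else g (- ln x))"
  have Gb: "\<bar>G x\<bar> \<le> M * x" if "x \<in> {0..1}" for x
    using that gb[of "- ln x"] by (auto simp: G_def)
  have Gc: "continuous_on {0..1} G"
    unfolding continuous_on_eq_continuous_within
  proof
    fix x :: real assume x: "x \<in> {0..1}"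
    show "continuous (at x within {0..1}) G"
    proof (cases "x = 0")
      case True
      have "(G \<longlongrightarrow> 0) (at 0 within {0..1})"
      proof (rule Lim_null_comparison)
        show "\<forall>\<^sub>F x in at 0 within {0..1}. norm (G x) \<le> M * x"
          unfolding eventually_at_filter using Gb by auto
        have "((\<lambda>x. M * x) \<longlongrightarrow> M * 0) (at 0 within {0..1})" by (intro tendsto_intros)
        then show "((\<lambda>x. M * x) \<longlongrightarrow> 0) (at 0 within {0..1})" by simp
      qed
      then show ?thesis using True by (simp add: continuous_within G_def)
    next
      case False
      with x have x: "0 < x" "x \<le> 1" by auto
      have "continuous_on {x/2..1} (\<lambda>x. g (- ln x))"
        by (intro continuous_on_compose2[OF gcont] continuous_intros) (use x in auto)
      then have "continuous_on {x/2..1} G"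
        by (rule continuous_on_eq) (use x in \<open>auto simp: G_def\<close>)
      then have "continuous (at x within {x/2..1}) G" using x by (auto simp: continuous_on_eq_continuous_within)
      moreover have "at x within {x/2..1} = at x within {0..1}"
        by (rule at_within_nhd[of _ "{x/2<..}"]) (use x in auto)
      ultimately show ?thesis by simp
    qed
  qed
  have gg_eq: "G (exp (- t)) = g t" for t by (simp add: G_def)
  have gg: "set_integrable lborel {0..} (\<lambda>t. g t * G (exp (- t)))"
    proof -
      have [measurable]: "(\<lambda>x. indicator {0..} x * g x) \<in> borel_measurable borel"
        using gi unfolding set_integrable_def by auto
      have "integrable lborel (\<lambda>t. (indicator {0..} t * g t) * (indicator {0..} t * g t))"
      proof (rule Bochner_Integration.integrable_bound[of _ "\<lambda>t. M * (indicator {0..} t * g t)"])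
        show "integrable lborel (\<lambda>t. M * (indicator {0..} t * g t))"
          using gi unfolding set_integrable_def by (intro integrable_mult_right) auto
        have gM: "\<bar>g t\<bar> \<le> M" if "t \<ge> 0" for t
        proof -
          have "M * exp (- t) \<le> M" using M(1) that by (simp add: mult_left_le)
          then show ?thesis using gb[OF that] by linarith
        qed
        have "norm ((indicator {0..} t * g t) * (indicator {0..} t * g t)) \<le> norm (M * (indicator {0..} t * g t))" for t
        proof (cases "t \<ge> 0")
          case True
          then show ?thesis using mult_right_mono[OF gM[OF True], of "\<bar>g t\<bar>"] M(1) by (simp add: abs_mult)
        qed simp
        then show "AE t in lborel. norm ((indicator {0..} t * g t) * (indicator {0..} t * g t)) \<le> norm (M * (indicator {0..} t * g t))"
          by simp
        show "(\<lambda>t. indicator {0..} t * g t * (indicator {0..} t * g t)) \<in> borel_measurable lborel"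
          by measurable
      qed
      moreover have "(\<lambda>t. (indicator {0..} t * g t) * (indicator {0..} t * g t)) = (\<lambda>t. indicator {0..} t *\<^sub>R (g t * G (exp (- t))))"
        unfolding gg_eq by (auto simp: indicator_def)
      ultimately show ?thesis unfolding set_integrable_def by simp
    qed
  \<comment> \<open>\<open>g\<close> is orthogonal to all polynomials in exp (-t), and these
    approximate \<open>G (exp (- t))\<close>, which is \<open>g t\<close> itself. So the integral of
    the square of \<open>g\<close> vanishes.\<close>
  have "(LBINT t:{0..}. g t * G (exp (- t))) = 0"
  proof (rule ccontr)
    assume nz: "(LBINT t:{0..}. g t * G (exp (- t))) \<noteq> 0"
    define K where "K = (LBINT t:{0..}. \<bar>g t\<bar>)"
    have K: "K \<ge> 0" unfolding K_def set_lebesgue_integral_def by (rule Bochner_Integration.integral_nonneg) auto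
    \<comment> \<open>The error of the approximation is at most \<open>e * K\<close>; this
      \<open>e\<close> makes it smaller than the integral itself, and the summand 1 admits
      \<open>K = 0\<close>.\<close>
    define e where "e = \<bar>LBINT t:{0..}. g t * G (exp (- t))\<bar> / (2 * (K + 1))"
    have e: "e > 0" unfolding e_def using nz K by auto
    obtain P where P: "real_polynomial_function P" "\<And>x. x \<in> {0..1} \<Longrightarrow> \<bar>G x - P x\<bar> < e"
      using Stone_Weierstrass_real_polynomial_function[OF compact_Icc Gc e] by blast
    obtain cf N where cf: "P = (\<lambda>x. \<Sum>i\<le>N. cf i * x ^ i)"
      using P(1) unfolding real_polynomial_function_iff_sum by blast
    have Pi: "set_integrable lborel {0..} (\<lambda>t. g t * P (exp (- t)))" 
      and P0: "(LBINT t:{0..}. g t * P (exp (- t))) = 0"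
    proof -
      have e1: "g t * P (exp (- t)) = (\<Sum>i\<le>N. cf i * (exp (- (c + real i) * t) * f t))" for t
      proof -
        \<comment> \<open>Each further factor exp (-t) moves the argument of the transform up by 1,
          so it stays in the range where the transform vanishes.\<close>
        have *: "exp (- c * t) * exp (- t) ^ i = exp (- (c + real i) * t)" for i
          by (simp add: exp_of_nat_mult[symmetric] exp_add[symmetric] algebra_simps)
        have "g t * P (exp (- t)) = (\<Sum>i\<le>N. cf i * ((exp (- c * t) * exp (- t) ^ i) * f t))"
          unfolding cf g_def sum_distrib_left by (intro sum.cong) (simp_all add: algebra_simps)
        then show ?thesis unfolding * .
      qed
      have i: "set_integrable lborel {0..} (\<lambda>t. cf i * (exp (- (c + real i) * t) * f t))" for i
        using exp_order_integrable[OF f(2), of "c + real i"] c(1) by (intro set_integrable_mult_right) auto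
      show "set_integrable lborel {0..} (\<lambda>t. g t * P (exp (- t)))"
        unfolding e1 set_integrable_def scaleR_sum_right
        using i unfolding set_integrable_def by (intro Bochner_Integration.integrable_sum)
      have "(LBINT t:{0..}. cf i * (exp (- (c + real i) * t) * f t)) = 0" for i
        using z[of "c + real i"] c(2) unfolding laplace_def by simp
      then have z0: "(LINT t|lborel. indicator {0..} t *\<^sub>R (cf i * (exp (- (c + real i) * t) * f t))) = 0" for i
        unfolding set_lebesgue_integral_def .
      have "(LBINT t:{0..}. g t * P (exp (- t)))
          = (\<Sum>i\<le>N. LINT t|lborel. indicator {0..} t *\<^sub>R (cf i * (exp (- (c + real i) * t) * f t)))"
        unfolding e1 set_lebesgue_integral_def scaleR_sum_right
        using i unfolding set_integrable_def by (intro Bochner_Integration.integral_sum)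
      then show "(LBINT t:{0..}. g t * P (exp (- t))) = 0" unfolding z0 by simp
    qed
    have "\<bar>LBINT t:{0..}. g t * G (exp (- t))\<bar> = \<bar>LBINT t:{0..}. g t * G (exp (- t)) - g t * P (exp (- t))\<bar>"
      using set_integral_diff(2)[OF gg Pi] P0 by simp
    also have "\<dots> \<le> (LINT t|lborel. norm (indicator {0..} t *\<^sub>R (g t * G (exp (- t)) - g t * P (exp (- t)))))"
      unfolding set_lebesgue_integral_def real_norm_def[symmetric] by (rule integral_norm_bound)
    also have "\<dots> \<le> (LINT t|lborel. e * (indicator {0..} t *\<^sub>R \<bar>g t\<bar>))"
    proof (rule integral_mono)
      show "integrable lborel (\<lambda>t. norm (indicator {0..} t *\<^sub>R (g t * G (exp (- t)) - g t * P (exp (- t)))))"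
        using set_integral_diff(1)[OF gg Pi] unfolding set_integrable_def by (rule integrable_norm)
      show "integrable lborel (\<lambda>t. e * (indicator {0..} t *\<^sub>R \<bar>g t\<bar>))"
        using set_integrable_abs[OF gi] unfolding set_integrable_def by (rule integrable_mult_right)
      fix t :: real
      have "\<bar>g t * G (exp (- t)) - g t * P (exp (- t))\<bar> \<le> e * \<bar>g t\<bar>" if "t \<ge> 0"
      proof -
        have "\<bar>g t * G (exp (- t)) - g t * P (exp (- t))\<bar> = \<bar>G (exp (-t)) - P (exp (- t))\<bar> * \<bar>g t\<bar>"
          by (simp add: abs_mult[symmetric] algebra_simps)
        also have "\<dots> \<le> e * \<bar>g t\<bar>" using P(2)[of "exp (- t)"] that by (intro mult_right_mono) auto
        finally show ?thesis .
      qed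
      then show "norm (indicator {0..} t *\<^sub>R (g t * G (exp (- t)) - g t * P (exp (- t)))) \<le> e * (indicator {0..} t *\<^sub>R \<bar>g t\<bar>)"
        by (auto simp: indicator_def)
    qed
    also have "\<dots> = e * K" unfolding K_def set_lebesgue_integral_def by simp
    also have "\<dots> < \<bar>LBINT t:{0..}. g t * G (exp (- t))\<bar>"
    proof -
      have "e * (2 * (K + 1)) = \<bar>LBINT t:{0..}. g t * G (exp (- t))\<bar>" unfolding e_def using K by simp
      moreover have "e * K < e * (2 * (K + 1))" using e K by (intro mult_strict_left_mono) auto
      ultimately show ?thesis by simp
    qed
    finally show False by simp
  qed
  then have s0: "(LBINT t:{0..}. g t * g t) = 0" unfolding gg_eq .
  have si: "set_integrable lborel {0..} (\<lambda>t. g t * g t)" using gg unfolding gg_eq .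
  \<comment> \<open>An endpoint beyond \<open>t\<close> keeps the interval nondegenerate when
    \<open>t = 0\<close>.\<close>
  have c2: "continuous_on {0..t+1} (\<lambda>t. g t * g t)"
    by (intro continuous_intros continuous_on_subset[OF gcont]) auto
  have "integral {0..t+1} (\<lambda>t. g t * g t) = (LBINT t:{0..t+1}. g t * g t)"
    using set_borel_integral_eq_integral(2)[OF borel_integrable_atLeastAtMost'[OF c2]] by simp
  also have "\<dots> \<le> (LBINT t:{0..}. g t * g t)"
    unfolding set_lebesgue_integral_def
    using si borel_integrable_atLeastAtMost'[OF c2] unfolding set_integrable_def
    by (intro integral_mono) (auto simp: indicator_def)
  finally have "integral {0..t+1} (\<lambda>t. g t * g t) \<le> 0" using s0 by simp
  moreover have "integral {0..t+1} (\<lambda>t. g t * g t) \<ge> 0"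
    by (rule Henstock_Kurzweil_Integration.integral_nonneg) (use integrable_continuous_real[OF c2] in auto)
  ultimately have "integral {0..t+1} (\<lambda>t. g t * g t) = 0" by simp
  then have "g t * g t = 0"
    using integral_eq_0_iff[OF c2] \<open>t \<ge> 0\<close> by auto
  then show ?thesis by (simp add: g_def)
qed

section \<open>Subordination to the heat kernel\<close>

text \<open>\<open>E\<close> is the error function up to a factor; it provides an explicit antiderivative of the
  Laplace integrand of the heat kernel.\<close>

lemma ex_gauss_antiderivative:
  obtains E :: "real \<Rightarrow> real" where
    "\<And>x. (E has_real_derivative exp (- x\<^sup>2)) (at x)"
    "(E \<longlongrightarrow> sqrt pi / 2) at_top" "(E \<longlongrightarrow> - sqrt pi / 2) at_bot"
proof -
  obtain F :: "real \<Rightarrow> real" where F: "\<And>x. (F has_vector_derivative exp (- x\<^sup>2)) (at x)"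
    using einterval_antiderivative[of "-\<infinity>" \<infinity> "\<lambda>x::real. exp (- x\<^sup>2)"] by (auto intro!: continuous_intros)
  define E where "E = (\<lambda>x. F x - F 0)"
  have d: "(E has_real_derivative exp (- x\<^sup>2)) (at x)" for x
    unfolding E_def using F[of x] by (auto simp: has_real_derivative_iff_has_vector_derivative intro!: derivative_eq_intros)
  have eq: "(LBINT v:{0..x}. exp (- v\<^sup>2)) = E x" if "x \<ge> 0" for x
  proof -
    have "((\<lambda>v. exp (- v\<^sup>2)) has_integral (E x - E 0)) {0..x}"
      by (rule fundamental_theorem_of_calculus[OF that])
         (use d in \<open>auto simp: has_real_derivative_iff_has_vector_derivative[symmetric] intro: has_field_derivative_at_within\<close>)
    moreover have "set_integrable lborel {0..x} (\<lambda>v. exp (- v\<^sup>2))"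
      by (intro borel_integrable_atLeastAtMost' continuous_intros)
    ultimately show ?thesis
      using set_borel_integral_eq_integral(2)[of "{0..x}" "\<lambda>v. exp (- v\<^sup>2)"]
      by (simp add: integral_unique E_def)
  qed
  have "((\<lambda>x::real. LBINT v:{0..x}. exp (- v\<^sup>2)) \<longlongrightarrow> (LBINT v:{0..}. exp (- v\<^sup>2))) at_top"
    by (rule tendsto_set_lebesgue_integral_at_top)
       (use gaussian_moment_0 in \<open>auto simp: set_integrable_def has_bochner_integral_iff\<close>)
  moreover have "(LBINT v:{0::real..}. exp (- v\<^sup>2)) = sqrt pi / 2"
    using gaussian_moment_0 unfolding set_lebesgue_integral_def by (simp add: has_bochner_integral_iff)
  ultimately have lim: "((\<lambda>x::real. LBINT v:{0..x}. exp (- v\<^sup>2)) \<longlongrightarrow> sqrt pi / 2) at_top" by simp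
  have top: "(E \<longlongrightarrow> sqrt pi / 2) at_top"
    by (rule Lim_transform_eventually[OF lim]) (use eq in \<open>auto intro: eventually_mono[OF eventually_ge_at_top[of 0]]\<close>)
  \<comment> \<open>The derivative is even and \<open>E 0 = 0\<close>; the limit at minus infinity
    is thus obtained from the one at infinity.\<close>
  have odd: "E (- x) = - E x" for x
  proof -
    have "((\<lambda>x. E x + E (- x)) has_real_derivative 0) (at x)" for x
    proof -
      have "((\<lambda>x. E (- x)) has_real_derivative exp (- (- x)\<^sup>2) * (- 1)) (at x)"
        by (rule DERIV_chain2[OF d]) (auto intro!: derivative_eq_intros)
      from DERIV_add[OF d this] show ?thesis by simp
    qed
    then have "E x + E (- x) = E 0 + E (- 0)"
      using DERIV_isconst_all[of "\<lambda>x. E x + E (- x)" x 0] by blast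
    then show ?thesis by (simp add: E_def)
  qed
  have "((\<lambda>x. - E (- x)) \<longlongrightarrow> - (sqrt pi / 2)) at_bot"
    by (intro tendsto_minus filterlim_compose[OF top] filterlim_uminus_at_top_at_bot)
  then have "(E \<longlongrightarrow> - sqrt pi / 2) at_bot" by (simp add: odd)
  with d top show ?thesis using that by blast
qed

text \<open>Twice the kernel of the heat equation on the line, so that for \<open>t > 0\<close> its
  mass on the half-line r >= 0 is 1.\<close>

definition heat :: "real \<Rightarrow> real \<Rightarrow> real" where
  "heat t r = exp (- r\<^sup>2 / (4 * t)) / sqrt (pi * t)"

lemma laplace_heat:
  assumes r: "r > 0" and l: "l > 0"
  shows "set_integrable lborel {0<..} (\<lambda>t. exp (- l * t) * heat t r)"
    and "(LBINT t:{0<..}. exp (- l * t) * heat t r) = exp (- sqrt l * r) / sqrt l"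
proof -
  obtain E :: "real \<Rightarrow> real" where
    E: "\<And>x. (E has_real_derivative exp (- x\<^sup>2)) (at x)"
      "(E \<longlongrightarrow> sqrt pi / 2) at_top" "(E \<longlongrightarrow> - sqrt pi / 2) at_bot"
    using ex_gauss_antiderivative by blast
  define q where "q = sqrt l"
  have q: "q > 0" "l = q\<^sup>2" using l unfolding q_def by auto
  \<comment> \<open>Completing the square, q^2 t + r^2 / (4 t) is the square of q sqrt t + r / (2
    sqrt t) minus q r, and also the square of q sqrt t - r / (2 sqrt t) plus q r. Each square is the
    exponent of one term in the derivative of \<open>\<Phi>\<close>.\<close>
  define \<Phi> where "\<Phi> = (\<lambda>t. (exp (q * r) * E (q * sqrt t + r / (2 * sqrt t)) + exp (- (q * r)) * E (q * sqrt t - r / (2 * sqrt t))) / (sqrt pi * q))"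
  have d: "(\<Phi> has_real_derivative exp (- l * t) * heat t r) (at t)" if t: "t > 0" for t
  proof -
    define s where "s = sqrt t"
    have s: "s > 0" "t = s\<^sup>2" using t unfolding s_def by auto
    have ds: "(sqrt has_real_derivative 1 / (2 * s)) (at t)"
      using DERIV_real_sqrt[OF t] unfolding s_def by (simp add: field_simps)
    have dp: "((\<lambda>t. q * sqrt t + r / (2 * sqrt t)) has_real_derivative (q / (2 * s) - r / (4 * s ^ 3))) (at t)"
      using s(1) t by (auto intro!: derivative_eq_intros ds simp: s_def[symmetric] field_simps power2_eq_square power3_eq_cube)
    have dm: "((\<lambda>t. q * sqrt t - r / (2 * sqrt t)) has_real_derivative (q / (2 * s) + r / (4 * s ^ 3))) (at t)"
      using s(1) t by (auto intro!: derivative_eq_intros ds simp: s_def[symmetric] field_simps power2_eq_square power3_eq_cube)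
    have e1: "exp (q * r) * exp (- (q * s + r / (2 * s))\<^sup>2) = exp (- l * t - r\<^sup>2 / (4 * t))"
      using s(1) by (simp add: exp_add[symmetric] q s(2)) (simp add: field_simps power2_eq_square)
    have e2: "exp (- (q * r)) * exp (- (q * s - r / (2 * s))\<^sup>2) = exp (- l * t - r\<^sup>2 / (4 * t))"
      using s(1) by (simp add: exp_add[symmetric] q s(2)) (simp add: field_simps power2_eq_square)
    have D: "(\<Phi> has_real_derivative (exp (q * r) * (exp (- (q * s + r / (2 * s))\<^sup>2) * (q / (2 * s) - r / (4 * s ^ 3)))
        + exp (- (q * r)) * (exp (- (q * s - r / (2 * s))\<^sup>2) * (q / (2 * s) + r / (4 * s ^ 3)))) / (sqrt pi * q)) (at t)"
      unfolding \<Phi>_def s_def using dp dm unfolding s_def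
      by (intro DERIV_cdivide DERIV_add DERIV_cmult DERIV_chain2[where f=E] E(1))
    \<comment> \<open>Both exponential factors coincide, so the parts with
      \<open>r / (4 * s ^ 3)\<close> cancel.\<close>
    have "(exp (q * r) * (exp (- (q * s + r / (2 * s))\<^sup>2) * (q / (2 * s) - r / (4 * s ^ 3)))
        + exp (- (q * r)) * (exp (- (q * s - r / (2 * s))\<^sup>2) * (q / (2 * s) + r / (4 * s ^ 3)))) / (sqrt pi * q)
        = (exp (- l * t - r\<^sup>2 / (4 * t)) * (q / (2 * s) - r / (4 * s ^ 3)) + exp (- l * t - r\<^sup>2 / (4 * t)) * (q / (2 * s) + r / (4 * s ^ 3))) / (sqrt pi * q)"
      unfolding mult.assoc[symmetric] e1 e2 ..
    also have "\<dots> = exp (- l * t - r\<^sup>2 / (4 * t)) / (sqrt pi * s)"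
      using q(1) s(1) by (simp add: field_simps)
    also have "\<dots> = exp (- l * t) * heat t r"
      unfolding heat_def s_def by (simp add: real_sqrt_mult exp_diff exp_minus field_simps)
    finally show ?thesis using D by simp
  qed
  \<comment> \<open>As t tends to 0 the two arguments of \<open>E\<close> go to opposite infinities
    because \<open>r > 0\<close>; as t tends to infinity both go to plus infinity. The difference of
    the two limits leaves only the term with exp (-q r).\<close>
  have A: "(\<Phi> \<longlongrightarrow> (exp (q * r) * (sqrt pi / 2) + exp (- (q * r)) * (- sqrt pi / 2)) / (sqrt pi * q)) (at_right 0)"
    unfolding \<Phi>_def
  proof (intro tendsto_divide tendsto_add tendsto_mult tendsto_const)
    show "((\<lambda>t. E (q * sqrt t + r / (2 * sqrt t))) \<longlongrightarrow> sqrt pi / 2) (at_right 0)"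
      by (rule filterlim_compose[OF E(2)]) (use q r in real_asymp)
    show "((\<lambda>t. E (q * sqrt t - r / (2 * sqrt t))) \<longlongrightarrow> - sqrt pi / 2) (at_right 0)"
      by (rule filterlim_compose[OF E(3)]) (use q r in real_asymp)
  qed (use q in auto)
  have B: "(\<Phi> \<longlongrightarrow> (exp (q * r) * (sqrt pi / 2) + exp (- (q * r)) * (sqrt pi / 2)) / (sqrt pi * q)) at_top"
    unfolding \<Phi>_def
  proof (intro tendsto_divide tendsto_add tendsto_mult tendsto_const)
    show "((\<lambda>t. E (q * sqrt t + r / (2 * sqrt t))) \<longlongrightarrow> sqrt pi / 2) at_top"
      by (rule filterlim_compose[OF E(2)]) (use q r in real_asymp)
    show "((\<lambda>t. E (q * sqrt t - r / (2 * sqrt t))) \<longlongrightarrow> sqrt pi / 2) at_top"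
      by (rule filterlim_compose[OF E(2)]) (use q r in real_asymp)
  qed (use q in auto)
  have ei: "einterval 0 \<infinity> = {0<..}" by (auto simp: einterval_def)
  have *: "set_integrable lborel (einterval 0 \<infinity>) (\<lambda>t. exp (- l * t) * heat t r)"
    "(LBINT t=0..\<infinity>. exp (- l * t) * heat t r) = (exp (q * r) * (sqrt pi / 2) + exp (- (q * r)) * (sqrt pi / 2)) / (sqrt pi * q)
       - (exp (q * r) * (sqrt pi / 2) + exp (- (q * r)) * (- sqrt pi / 2)) / (sqrt pi * q)"
  proof -
    have 1: "\<And>x. 0 < ereal x \<Longrightarrow> ereal x < \<infinity> \<Longrightarrow> (\<Phi> has_real_derivative exp (- l * x) * heat x r) (at x)"
      using d by simp
    have 2: "\<And>x. 0 < ereal x \<Longrightarrow> ereal x < \<infinity> \<Longrightarrow> isCont (\<lambda>t. exp (- l * t) * heat t r) x"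
      unfolding heat_def by (auto intro!: continuous_intros)
    have 3: "AE x in lborel. 0 < ereal x \<longrightarrow> ereal x < \<infinity> \<longrightarrow> 0 \<le> exp (- l * x) * heat x r"
      unfolding heat_def by auto
    have 4: "((\<Phi> \<circ> real_of_ereal) \<longlongrightarrow> (exp (q * r) * (sqrt pi / 2) + exp (- (q * r)) * (- sqrt pi / 2)) / (sqrt pi * q)) (at_right 0)"
      using A by (simp add: zero_ereal_def ereal_tendsto_simps)
    have 5: "((\<Phi> \<circ> real_of_ereal) \<longlongrightarrow> (exp (q * r) * (sqrt pi / 2) + exp (- (q * r)) * (sqrt pi / 2)) / (sqrt pi * q)) (at_left \<infinity>)"
      using B by (simp add: ereal_tendsto_simps)
    show "set_integrable lborel (einterval 0 \<infinity>) (\<lambda>t. exp (- l * t) * heat t r)"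
      "(LBINT t=0..\<infinity>. exp (- l * t) * heat t r) = (exp (q * r) * (sqrt pi / 2) + exp (- (q * r)) * (sqrt pi / 2)) / (sqrt pi * q)
       - (exp (q * r) * (sqrt pi / 2) + exp (- (q * r)) * (- sqrt pi / 2)) / (sqrt pi * q)"
      using interval_integral_FTC_nonneg[OF _ 1 2 3 4 5] by auto
  qed
  show "set_integrable lborel {0<..} (\<lambda>t. exp (- l * t) * heat t r)" using *(1) unfolding ei .
  have "(LBINT t:{0<..}. exp (- l * t) * heat t r) = (LBINT t=0..\<infinity>. exp (- l * t) * heat t r)"
    by (simp add: interval_lebesgue_integral_def ei)
  also have "\<dots> = exp (- (q * r)) / q" unfolding *(2) using q by (simp add: field_simps)
  finally show "(LBINT t:{0<..}. exp (- l * t) * heat t r) = exp (- sqrt l * r) / sqrt l"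
    unfolding q_def by simp
qed

text \<open>The scalar shape of \<open>S\<close>. The Gaussian form is taken instead of the integral
  against \<open>heat t\<close> because it also makes sense at \<open>t = 0\<close>.\<close>

definition subord :: "(real \<Rightarrow> real) \<Rightarrow> real \<Rightarrow> real" where
  "subord h t = (2 / sqrt pi) * (LBINT v:{0..}. exp (- v\<^sup>2) * h (2 * sqrt t * v))"

lemma subord_eq_heat:
  assumes "t > 0"
  shows "subord h t = (LBINT r:{0..}. heat t r * h r)"
proof -
  define c where "c = 2 * sqrt t"
  have c: "c > 0" "c\<^sup>2 = 4 * t" using assms unfolding c_def by (auto simp: power_mult_distrib)
  have "(LBINT r:{0..}. heat t r * h r) = \<bar>c\<bar> *\<^sub>R (LINT v|lborel. indicator {0..} (0 + c * v) *\<^sub>R (heat t (0 + c * v) * h (0 + c * v)))"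
    unfolding set_lebesgue_integral_def using c by (intro lborel_integral_real_affine) auto
  also have "\<dots> = c *\<^sub>R (LINT v|lborel. (1 / sqrt (pi * t)) * (indicator {0..} v *\<^sub>R (exp (- v\<^sup>2) * h (2 * sqrt t * v))))"
  proof -
    have "indicator {0..} (0 + c * v) *\<^sub>R (heat t (0 + c * v) * h (0 + c * v))
      = (1 / sqrt (pi * t)) * (indicator {0..} v *\<^sub>R (exp (- v\<^sup>2) * h (2 * sqrt t * v)))" for v
    proof -
      have "indicator {0..} (0 + c * v) = (indicator {0..} v :: real)"
        using c(1) by (auto simp: indicator_def zero_le_mult_iff)
      moreover have "heat t (0 + c * v) = exp (- v\<^sup>2) / sqrt (pi * t)"
        using assms unfolding heat_def by (simp add: power_mult_distrib c(2))
      ultimately show ?thesis by (simp add: c_def)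
    qed
    then show ?thesis using c(1) by simp
  qed
  also have "\<dots> = (c / sqrt (pi * t)) * (LBINT v:{0..}. exp (- v\<^sup>2) * h (2 * sqrt t * v))"
    unfolding set_lebesgue_integral_def by simp
  also have "c / sqrt (pi * t) = 2 / sqrt pi"
    unfolding c_def using assms by (simp add: real_sqrt_mult field_simps)
  finally show ?thesis unfolding subord_def by simp
qed

text \<open>Completing the square gives the factor \<open>exp (b\<^sup>2)\<close> times a translated
  Gaussian; the bound is the integral over the whole line.\<close>

lemma gauss_exp_integrable:
  fixes b :: real
  shows "set_integrable lborel {0..} (\<lambda>v. exp (- v\<^sup>2) * exp (2 * b * v))"
    and "(LBINT v:{0..}. exp (- v\<^sup>2) * exp (2 * b * v)) \<le> sqrt pi * exp (b\<^sup>2)"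
proof -
  have "has_bochner_integral lborel (\<lambda>x::real. exp (- x\<^sup>2) * x ^ (2 * 0)) (sqrt pi * (fact (2 * 0) / (2 ^ (2 * 0) * fact 0)))"
    by (rule gaussian_moment_even_pos[of 0, THEN has_bochner_integral_even_function, THEN has_bochner_integral_cong[THEN iffD1, rotated 3]] | simp)+
  then have g: "has_bochner_integral lborel (\<lambda>x::real. exp (- x\<^sup>2)) (sqrt pi)" by simp
  have "has_bochner_integral lborel (\<lambda>v. exp (- (- b + 1 * v)\<^sup>2)) (sqrt pi /\<^sub>R \<bar>1\<bar>)"
    using lborel_has_bochner_integral_real_affine_iff[of 1 "\<lambda>x::real. exp (- x\<^sup>2)" "sqrt pi" "-b"] g by simp
  then have "has_bochner_integral lborel (\<lambda>v. exp (b\<^sup>2) * exp (- (- b + 1 * v)\<^sup>2)) (exp (b\<^sup>2) * (sqrt pi /\<^sub>R \<bar>1\<bar>))"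
    by (rule has_bochner_integral_mult_right)
  moreover have "(\<lambda>v. exp (b\<^sup>2) * exp (- (- b + 1 * v)\<^sup>2)) = (\<lambda>v. exp (- v\<^sup>2) * exp (2 * b * v))"
    by (auto simp: exp_add[symmetric] power2_eq_square algebra_simps)
  ultimately have h: "has_bochner_integral lborel (\<lambda>v. exp (- v\<^sup>2) * exp (2 * b * v)) (sqrt pi * exp (b\<^sup>2))"
    by (simp add: mult.commute)
  then have i: "integrable lborel (\<lambda>v. exp (- v\<^sup>2) * exp (2 * b * v))" by (simp add: has_bochner_integral_iff)
  show s: "set_integrable lborel {0..} (\<lambda>v. exp (- v\<^sup>2) * exp (2 * b * v))"
    unfolding set_integrable_def by (rule integrable_mult_indicator[OF _ i]) simp
  have "(LBINT v:{0..}. exp (- v\<^sup>2) * exp (2 * b * v)) \<le> (LINT v|lborel. exp (- v\<^sup>2) * exp (2 * b * v))"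
    unfolding set_lebesgue_integral_def using s i unfolding set_integrable_def
    by (intro integral_mono) (auto simp: indicator_def)
  also have "\<dots> = sqrt pi * exp (b\<^sup>2)" using h by (simp add: has_bochner_integral_iff)
  finally show "(LBINT v:{0..}. exp (- v\<^sup>2) * exp (2 * b * v)) \<le> sqrt pi * exp (b\<^sup>2)" .
qed

text \<open>The square in the new rate comes from completing the square with
  \<open>b = a * sqrt t\<close>. The factor 2 is the loss from integrating the Gaussian over the
  whole line.\<close>

lemma subord_bound:
  assumes "\<And>r. r \<ge> 0 \<Longrightarrow> \<bar>h r\<bar> \<le> M * exp (a * r)" "t \<ge> 0"
  shows "\<bar>subord h t\<bar> \<le> 2 * M * exp (a\<^sup>2 * t)"
proof -
  have M: "M \<ge> 0" using assms(1)[of 0] by simp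
  have i: "integrable lborel (\<lambda>v. M * (indicator {0..} v *\<^sub>R (exp (- v\<^sup>2) * exp (2 * (a * sqrt t) * v))))"
    using gauss_exp_integrable(1)[of "a * sqrt t"] unfolding set_integrable_def by (rule integrable_mult_right)
  have "\<bar>LBINT v:{0..}. exp (- v\<^sup>2) * h (2 * sqrt t * v)\<bar>
      \<le> (LINT v|lborel. norm (indicator {0..} v *\<^sub>R (exp (- v\<^sup>2) * h (2 * sqrt t * v))))"
    unfolding set_lebesgue_integral_def real_norm_def[symmetric] by (rule integral_norm_bound)
  also have "\<dots> \<le> (LINT v|lborel. M * (indicator {0..} v *\<^sub>R (exp (- v\<^sup>2) * exp (2 * (a * sqrt t) * v))))"
  proof (rule integral_mono'[OF i])
    fix v :: real
    have "\<bar>h (2 * sqrt t * v)\<bar> \<le> M * exp (2 * (a * sqrt t) * v)" if "v \<ge> 0"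
      using assms(1)[of "2 * sqrt t * v"] assms(2) that by (simp add: algebra_simps)
    then show "norm (indicator {0..} v *\<^sub>R (exp (- v\<^sup>2) * h (2 * sqrt t * v))) \<le> M * (indicator {0..} v *\<^sub>R (exp (- v\<^sup>2) * exp (2 * (a * sqrt t) * v)))"
      by (auto simp: indicator_def abs_mult)
  qed (use M in \<open>auto simp: indicator_def\<close>)
  also have "\<dots> = M * (LBINT v:{0..}. exp (- v\<^sup>2) * exp (2 * (a * sqrt t) * v))"
    unfolding set_lebesgue_integral_def by simp
  also have "\<dots> \<le> M * (sqrt pi * exp ((a * sqrt t)\<^sup>2))"
    by (intro mult_left_mono gauss_exp_integrable(2) M)
  also have "(a * sqrt t)\<^sup>2 = a\<^sup>2 * t" using assms(2) by (simp add: power_mult_distrib)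
  finally have "\<bar>LBINT v:{0..}. exp (- v\<^sup>2) * h (2 * sqrt t * v)\<bar> \<le> M * (sqrt pi * exp (a\<^sup>2 * t))" .
  then have "(2 / sqrt pi) * \<bar>LBINT v:{0..}. exp (- v\<^sup>2) * h (2 * sqrt t * v)\<bar> \<le> (2 / sqrt pi) * (M * (sqrt pi * exp (a\<^sup>2 * t)))"
    by (intro mult_left_mono) auto
  also have "\<dots> = 2 * M * exp (a\<^sup>2 * t)" by simp
  finally show ?thesis unfolding subord_def by (simp add: abs_mult)
qed

theorem laplace_subord:
  assumes h: "exp_order h a" and a: "a \<ge> 0" and l: "l > a\<^sup>2"
  shows "laplace (subord h) l = laplace h (sqrt l) / sqrt l"
proof -
  have l0: "l > 0" using l a by (smt (verit) zero_le_power2)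
  have al: "a < sqrt l" using l a by (metis real_less_rsqrt)
  note [measurable] = exp_order_measurable[OF h]
  \<comment> \<open>The null sets \<open>r = 0\<close> and \<open>t = 0\<close> are cut out because
    \<open>laplace_heat\<close> and \<open>subord_eq_heat\<close> need positive arguments. The inner
    indicator is kept because \<open>h\<close> is only known to be measurable on the
    half-line.\<close>
  define F where "F = (\<lambda>(r, t). (indicator {0<..} t * exp (- l * t) * heat t r) * (indicator {0<..} r * (indicator {0..} r * h r)))"
  have hi: "integrable lborel (\<lambda>t. (indicator {0<..} t * exp (- l * t) * heat t r))"
    and hv: "(LINT t|lborel. (indicator {0<..} t * exp (- l * t) * heat t r)) = exp (- sqrt l * r) / sqrt l" if "r > 0" for r
    using laplace_heat[OF that l0] unfolding set_integrable_def set_lebesgue_integral_def by (simp_all add: mult.assoc)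
  have h0: "heat t r \<ge> 0" if "t > 0" for t r using that unfolding heat_def by simp
  have inner: "(LINT t|lborel. norm (F (r, t))) = indicator {0<..} r * (exp (- sqrt l * r) * \<bar>h r\<bar>) / sqrt l" for r
  proof (cases "r > 0")
    case True
    have "(LINT t|lborel. norm (F (r, t))) = (LINT t|lborel. (indicator {0<..} t * exp (- l * t) * heat t r) * \<bar>h r\<bar>)"
      using True h0 by (intro Bochner_Integration.integral_cong refl) (auto simp: F_def indicator_def abs_mult)
    also have "\<dots> = exp (- sqrt l * r) / sqrt l * \<bar>h r\<bar>" using hv[OF True] by simp
    finally show ?thesis using True by simp
  qed (simp add: F_def)
  have inner': "(LINT t|lborel. F (r, t)) = indicator {0<..} r * (exp (- sqrt l * r) * h r) / sqrt l" for r
  proof (cases "r > 0")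
    case True
    have "(LINT t|lborel. F (r, t)) = (LINT t|lborel. (indicator {0<..} t * exp (- l * t) * heat t r) * h r)"
      using True by (intro Bochner_Integration.integral_cong refl) (auto simp: F_def indicator_def abs_mult)
    also have "\<dots> = exp (- sqrt l * r) / sqrt l * h r" using hv[OF True] by simp
    finally show ?thesis using True by simp
  qed (simp add: F_def)
  have iL: "set_integrable lborel {0..} (\<lambda>t. exp (- sqrt l * t) * h t)" by (rule exp_order_integrable[OF h al])
  have int: "integrable (lborel \<Otimes>\<^sub>M lborel) F"
  proof (rule lborel_pair.Fubini_integrable)
    show "F \<in> borel_measurable (lborel \<Otimes>\<^sub>M lborel)" unfolding F_def heat_def by measurable
    have "set_integrable lborel {0<..} (\<lambda>t. \<bar>exp (- sqrt l * t) * h t\<bar>)"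
      by (rule set_integrable_subset[OF set_integrable_abs[OF iL]]) auto
    then have "integrable lborel (\<lambda>r. indicator {0<..} r * (exp (- sqrt l * r) * \<bar>h r\<bar>) / sqrt l)"
      unfolding set_integrable_def by (simp add: abs_mult)
    then show "integrable lborel (\<lambda>r. LINT t|lborel. norm (F (r, t)))" unfolding inner .
    have "integrable lborel (\<lambda>t. F (r, t))" for r
    proof (cases "r > 0")
      case True
      show ?thesis unfolding F_def using hi[OF True] by simp
    qed (simp add: F_def)
    then show "AE r in lborel. integrable lborel (\<lambda>t. F (r, t))" by simp
  qed
  have "laplace (subord h) l = (LINT t|lborel. LINT r|lborel. F (r, t))"
    unfolding laplace_def set_lebesgue_integral_def
  proof (rule integral_cong_AE)
    have sub: "indicator {0..} t *\<^sub>R (exp (- l * t) * subord h t) = (LINT r|lborel. F (r, t))" if "t \<noteq> 0" for t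
    proof (cases "t > 0")
      case True
      have "subord h t = (LINT r|lborel. heat t r * (indicator {0<..} r * (indicator {0..} r * h r)))"
        unfolding subord_eq_heat[OF True] set_lebesgue_integral_def
      proof (rule integral_cong_AE)
        show "AE r in lborel. indicat_real {0..} r *\<^sub>R (heat t r * h r) = heat t r * (indicat_real {0<..} r * (indicat_real {0..} r * h r))"
          using AE_lborel_singleton[of 0] by eventually_elim (auto simp: indicator_def)
        have "(\<lambda>r. heat t r * (indicator {0..} r * h r)) \<in> borel_measurable lborel" unfolding heat_def by measurable
        then show "(\<lambda>r. indicat_real {0..} r *\<^sub>R (heat t r * h r)) \<in> borel_measurable lborel"
          by (simp add: mult.left_commute)
        show "(\<lambda>r. heat t r * (indicat_real {0<..} r * (indicat_real {0..} r * h r))) \<in> borel_measurable lborel"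
          unfolding heat_def by measurable
      qed
      then show ?thesis using True unfolding F_def by (simp add: mult.assoc)
    next
      case False
      then show ?thesis using that by (simp add: F_def)
    qed
    then show "AE t in lborel. indicator {0..} t *\<^sub>R (exp (- l * t) * subord h t) = (LINT r|lborel. F (r, t))"
      using AE_lborel_singleton[of 0] by (auto elim!: eventually_mono)
    show m: "(\<lambda>t. LINT r|lborel. F (r, t)) \<in> borel_measurable lborel"
      unfolding F_def heat_def by measurable
    \<comment> \<open>Measurability of \<open>subord h\<close> is not known beforehand; off
      \<open>t = 0\<close> the function agrees with a parameter integral of a measurable
      integrand.\<close>
    have "(\<lambda>t. indicator {0..} t *\<^sub>R (exp (- l * t) * subord h t)) = (\<lambda>t. if t = 0 then subord h 0 else (LINT r|lborel. F (r, t)))"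
      using sub by (auto simp: fun_eq_iff)
    also have "\<dots> \<in> borel_measurable lborel" using m by measurable
    finally show "(\<lambda>t. indicator {0..} t *\<^sub>R (exp (- l * t) * subord h t)) \<in> borel_measurable lborel" .
  qed
  also have "\<dots> = (LINT r|lborel. LINT t|lborel. F (r, t))"
    using lborel_pair.Fubini_integral[of "\<lambda>r t. F (r, t)"] int by simp
  also have "\<dots> = (LINT r|lborel. indicator {0..} r *\<^sub>R (exp (- sqrt l * r) * h r)) / sqrt l"
    unfolding inner'
  proof (simp, rule disjI2, rule integral_cong_AE)
    have i0: "set_integrable lborel {0<..} (\<lambda>t. exp (- sqrt l * t) * h t)"
      by (rule set_integrable_subset[OF iL]) auto
    show "(\<lambda>r. indicat_real {0<..} r * (exp (- (sqrt l * r)) * h r)) \<in> borel_measurable lborel"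
      "(\<lambda>r. indicat_real {0..} r * (exp (- (sqrt l * r)) * h r)) \<in> borel_measurable lborel"
      using iL i0 unfolding set_integrable_def by (auto dest: borel_measurable_integrable)
    show "AE r in lborel. indicat_real {0<..} r * (exp (- (sqrt l * r)) * h r) = indicat_real {0..} r * (exp (- (sqrt l * r)) * h r)"
      using AE_lborel_singleton[of 0] by eventually_elim (auto simp: indicator_def)
  qed
  also have "\<dots> = laplace h (sqrt l) / sqrt l" unfolding laplace_def set_lebesgue_integral_def ..
  finally show ?thesis .
qed

section \<open>The kernels of the functional equations\<close>

lemma integral_reflect_shift:
  fixes F :: "real \<Rightarrow> real"
  assumes "continuous_on {t-w..t} F" "0 \<le> w"
  shows "(LBINT r:{0..w}. F (t - r)) = integral {t-w..t} F"
proof -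
  have "integral {t-w..t} F = (LBINT r:{t-w..t}. F r)"
    using set_borel_integral_eq_integral(2)[OF borel_integrable_atLeastAtMost'[OF assms(1)]] by simp
  also have "\<dots> = (LINT r|lborel. indicator {t-w..t} (t + (-1) * r) *\<^sub>R F (t + (-1) * r))"
    unfolding set_lebesgue_integral_def
    using lborel_integral_real_affine[of "-1" "\<lambda>r. indicator {t-w..t} r *\<^sub>R F r" t] by simp
  also have "\<dots> = (LBINT r:{0..w}. F (t - r))"
    unfolding set_lebesgue_integral_def by (intro Bochner_Integration.integral_cong refl) (auto simp: indicator_def)
  finally show ?thesis by simp
qed

lemma continuous_on_shift:
  fixes f :: "real \<Rightarrow> real"
  assumes "continuous_on {0..} f" "t \<ge> 0"
  shows "continuous_on {0..} (\<lambda>u. f (t + u))"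
  by (intro continuous_on_compose2[OF assms(1)] continuous_intros) (use assms(2) in auto)

lemma lborel_eq_integral:
  fixes f :: "real \<Rightarrow> real"
  assumes "continuous_on {a..b} f"
  shows "(LBINT r:{a..b}. f r) = integral {a..b} f"
  using set_borel_integral_eq_integral(2)[OF borel_integrable_atLeastAtMost'[OF assms]] .

text \<open>The three integrals of the functional equation of a (k + 1)-times integrated semigroup,
  rearranged as convolutions in \<open>s\<close>: the first two combine to an integral over
  [t, s + t], which becomes the first convolution. In this form the transform in \<open>s\<close>
  follows from \<open>laplace_conv\<close>.\<close>

definition semigroup_kernel :: "nat \<Rightarrow> (real \<Rightarrow> real) \<Rightarrow> real \<Rightarrow> real \<Rightarrow> real" where
  "semigroup_kernel k h t s = conv (\<lambda>x. x ^ k) (\<lambda>u. h (t + u)) s - conv (\<lambda>u. (t + u) ^ k) h s"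

text \<open>The three further integrals of the cosine equation collapse to two convolutions in
  \<open>s\<close>, whichever of \<open>t\<close> and \<open>s\<close> is larger. The power of the
  positive part cuts off at \<open>u = t\<close> only for \<open>k > 0\<close>, as
  \<open>0 ^ 0\<close> is 1; in the application \<open>k\<close> is \<open>2 * n - 1\<close> with
  \<open>n > 0\<close>.\<close>

definition cosine_kernel :: "nat \<Rightarrow> (real \<Rightarrow> real) \<Rightarrow> real \<Rightarrow> real \<Rightarrow> real" where
  "cosine_kernel k h t s = semigroup_kernel k h t s
     + conv (\<lambda>u. (max 0 (t - u)) ^ k) h s + conv (\<lambda>x. x ^ k) (\<lambda>v. if v \<le> t then h (t - v) else 0) s"

lemma conv_power_shift:
  assumes h: "continuous_on {0..} h" and "t \<ge> 0" "s \<ge> 0"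
  shows "conv (\<lambda>x. x ^ k) (\<lambda>u. h (t + u)) s = integral {t..s+t} (\<lambda>r. (t + s - r) ^ k * h r)"
proof -
  have c: "continuous_on {t..s+t} (\<lambda>r. (t + s - r) ^ k * h r)"
    by (intro continuous_intros continuous_on_subset[OF h]) (use assms in auto)
  have "integral {t..s+t} (\<lambda>r. (t + s - r) ^ k * h r) = (LBINT r:{t..s+t}. (t + s - r) ^ k * h r)"
    using lborel_eq_integral[OF c] by simp
  also have "\<dots> = (LINT r|lborel. indicator {t..s+t} (t + 1 * r) *\<^sub>R ((t + s - (t + 1 * r)) ^ k * h (t + 1 * r)))"
    unfolding set_lebesgue_integral_def
    using lborel_integral_real_affine[of 1 "\<lambda>r. indicator {t..s+t} r *\<^sub>R ((t + s - r) ^ k * h r)" t] by simp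
  also have "\<dots> = conv (\<lambda>x. x ^ k) (\<lambda>u. h (t + u)) s"
    unfolding conv_def set_lebesgue_integral_def
    by (intro Bochner_Integration.integral_cong refl) (auto simp: indicator_def)
  finally show ?thesis by simp
qed

lemma conv_shift_power:
  assumes h: "continuous_on {0..} h" and "s \<ge> 0"
  shows "conv (\<lambda>u. (t + u) ^ k) h s = integral {0..s} (\<lambda>r. (t + s - r) ^ k * h r)"
proof -
  have "continuous_on {0..s} (\<lambda>r. (t + s - r) ^ k * h r)"
    by (intro continuous_intros continuous_on_subset[OF h]) auto
  from lborel_eq_integral[OF this] show ?thesis unfolding conv_def by (simp add: algebra_simps)
qed

lemma semigroup_kernel_eq:
  fixes k :: nat
  assumes h: "continuous_on {0..} h" and t: "t \<ge> 0" "s \<ge> 0"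
  defines "g \<equiv> \<lambda>r. (t + s - r) ^ k * h r"
  shows "integral {0..s+t} g - integral {0..t} g - integral {0..s} g = semigroup_kernel k h t s"
proof -
  have "continuous_on {0..s+t} g" unfolding g_def
    by (intro continuous_intros continuous_on_subset[OF h]) auto
  then have "integral {0..t} g + integral {t..s+t} g = integral {0..s+t} g"
    using t by (intro Henstock_Kurzweil_Integration.integral_combine integrable_continuous_real) auto
  then show ?thesis unfolding semigroup_kernel_def conv_power_shift[OF h t] conv_shift_power[OF h t(2)] g_def by simp
qed

text \<open>Scalar counterpart of \<open>riemann_integral\<close>. Reversed limits do occur: |t - s|
  exceeds t when s > 2 t.\<close>

definition oriented_integral :: "real \<Rightarrow> real \<Rightarrow> (real \<Rightarrow> real) \<Rightarrow> real" where
  "oriented_integral a b f = (if a \<le> b then integral {a..b} f else - integral {b..a} f)"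

lemma oriented_integral_combine:
  assumes "continuous_on {0..} f" "0 \<le> a" "0 \<le> b"
  shows "oriented_integral a b f + integral {0..a} f = integral {0..b} f"
proof (cases "a \<le> b")
  case True
  have "integral {0..a} f + integral {a..b} f = integral {0..b} f"
    by (intro Henstock_Kurzweil_Integration.integral_combine integrable_continuous_real continuous_on_subset[OF assms(1)])
       (use True assms in auto)
  then show ?thesis using True by (simp add: oriented_integral_def)
next
  case False
  have "integral {0..b} f + integral {b..a} f = integral {0..a} f"
    by (intro Henstock_Kurzweil_Integration.integral_combine integrable_continuous_real continuous_on_subset[OF assms(1)])
       (use False assms in auto)
  then show ?thesis using False by (simp add: oriented_integral_def)
qed

lemma conv_pos_part:
  assumes h: "continuous_on {0..} h" and t: "t \<ge> 0" "s \<ge> 0" and k: "k > 0"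
  shows "conv (\<lambda>u. (max 0 (t - u)) ^ k) h s = integral {max 0 (s - t)..s} (\<lambda>r. (t - s + r) ^ k * h r)"
proof -
  have c: "continuous_on {0..s} (\<lambda>r. (max 0 (t - (s - r))) ^ k * h r)"
    by (intro continuous_intros continuous_on_subset[OF h]) auto
  \<comment> \<open>Left of \<open>d\<close> the positive part vanishes, and so does its power
    because \<open>k > 0\<close>.\<close>
  define d where "d = max 0 (s - t)"
  have d: "0 \<le> d" "d \<le> s" using t unfolding d_def by auto
  have "conv (\<lambda>u. (max 0 (t - u)) ^ k) h s = integral {0..s} (\<lambda>r. (max 0 (t - (s - r))) ^ k * h r)"
    using lborel_eq_integral[OF c] unfolding conv_def by simp
  also have "\<dots> = integral {0..d} (\<lambda>r. (max 0 (t - (s - r))) ^ k * h r) + integral {d..s} (\<lambda>r. (max 0 (t - (s - r))) ^ k * h r)"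
    by (rule Henstock_Kurzweil_Integration.integral_combine[symmetric]) (use d c in \<open>auto intro: integrable_continuous_real\<close>)
  also have "integral {0..d} (\<lambda>r. (max 0 (t - (s - r))) ^ k * h r) = integral {0..d} (\<lambda>r. 0)"
  proof (cases "s \<ge> t")
    case True
    then show ?thesis using k d_def by (intro Henstock_Kurzweil_Integration.integral_cong) auto
  qed (simp add: d_def)
  also have "integral {d..s} (\<lambda>r. (max 0 (t - (s - r))) ^ k * h r) = integral {d..s} (\<lambda>r. (t - s + r) ^ k * h r)"
  proof (rule Henstock_Kurzweil_Integration.integral_cong)
    fix r assume "r \<in> {d..s}"
    then have "max 0 (t - (s - r)) = t - s + r" by (auto simp: d_def)
    then show "max 0 (t - (s - r)) ^ k * h r = (t - s + r) ^ k * h r" by simp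
  qed
  finally show ?thesis unfolding d_def by simp
qed

text \<open>Only v <= min s t contributes; the reflection r = t - v produces the limits on the
  right.\<close>

lemma conv_truncated:
  assumes h: "continuous_on {0..} h" and t: "t \<ge> 0" "s \<ge> 0"
  shows "conv (\<lambda>x. x ^ k) (\<lambda>v. if v \<le> t then h (t - v) else 0) s = integral {max 0 (t - s)..t} (\<lambda>r. (s - t + r) ^ k * h r)"
proof -
  define w where "w = min s t"
  have w: "0 \<le> w" "t - w = max 0 (t - s)" using t unfolding w_def by auto
  have "conv (\<lambda>x. x ^ k) (\<lambda>v. if v \<le> t then h (t - v) else 0) s = (LBINT r:{0..w}. (s - t + (t - r)) ^ k * h (t - r))"
    unfolding conv_def set_lebesgue_integral_def
    by (intro Bochner_Integration.integral_cong refl) (auto simp: indicator_def w_def)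
  also have "\<dots> = integral {t-w..t} (\<lambda>r. (s - t + r) ^ k * h r)"
    by (rule integral_reflect_shift[where F="\<lambda>r. (s - t + r) ^ k * h r"])
      (use w(1) in \<open>auto intro!: continuous_intros continuous_on_subset[OF h] simp: w_def\<close>)
  finally show ?thesis unfolding w .
qed

text \<open>For s <= t the last integral has the same integrand as the one from |t - s| to s, and
  the two join to an integral over [0, s]. For s > t it joins the one from |t - s| to t
  instead.\<close>

lemma cosine_kernel_eq:
  assumes h: "continuous_on {0..} h" and t: "t \<ge> 0" "s \<ge> 0" and k: "k > 0"
  defines "g \<equiv> \<lambda>r. (t + s - r) ^ k * h r"
  shows "integral {0..s+t} g - integral {0..t} g - integral {0..s} g
      + oriented_integral \<bar>t - s\<bar> t (\<lambda>r. (s - t + r) ^ k * h r)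
      + oriented_integral \<bar>t - s\<bar> s (\<lambda>r. (t - s + r) ^ k * h r)
      + integral {0..\<bar>t - s\<bar>} (\<lambda>r. (\<bar>t - s\<bar> + r) ^ k * h r) = cosine_kernel k h t s"
proof -
  have cc: "continuous_on {0..} (\<lambda>r. (z + r) ^ k * h r)" for z
    by (intro continuous_intros continuous_on_subset[OF h]) auto
  have "oriented_integral \<bar>t - s\<bar> t (\<lambda>r. (s - t + r) ^ k * h r)
      + oriented_integral \<bar>t - s\<bar> s (\<lambda>r. (t - s + r) ^ k * h r)
      + integral {0..\<bar>t - s\<bar>} (\<lambda>r. (\<bar>t - s\<bar> + r) ^ k * h r)
      = integral {max 0 (s - t)..s} (\<lambda>r. (t - s + r) ^ k * h r) + integral {max 0 (t - s)..t} (\<lambda>r. (s - t + r) ^ k * h r)"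
  proof (cases "s \<le> t")
    case True
    then show ?thesis
      using oriented_integral_combine[OF cc[of "t - s"], of "t - s" s] t
      by (simp add: oriented_integral_def)
  next
    case False
    then show ?thesis
      using oriented_integral_combine[OF cc[of "s - t"], of "s - t" t] t
      by (simp add: oriented_integral_def)
  qed
  then show ?thesis
    unfolding cosine_kernel_def g_def semigroup_kernel_eq[OF h t, of k, symmetric]
      conv_pos_part[OF h t k] conv_truncated[OF h t] by simp
qed

lemma exp_order_shift_power:
  assumes "a > 0" "t \<ge> 0"
  shows "exp_order (\<lambda>u. (t + u) ^ k) a"
  using exp_order_shift[OF exp_order_power[OF assms(1)] assms(2)] by simp

lemma continuous_on_semigroup_kernel:
  assumes h: "continuous_on {0..} h" and "t \<ge> 0"
  shows "continuous_on {0..} (semigroup_kernel k h t)"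
  unfolding semigroup_kernel_def
  by (intro continuous_intros continuous_on_conv continuous_on_shift h assms)

lemma exp_order_semigroup_kernel:
  assumes "exp_order h a" "0 < a" "a < b" "t \<ge> 0"
  shows "exp_order (semigroup_kernel k h t) b"
  unfolding semigroup_kernel_def
  by (intro exp_order_diff exp_order_conv[where a=a] exp_order_power exp_order_shift exp_order_shift_power assms)

lemma laplace_semigroup_kernel:
  assumes h: "exp_order h a" and a: "0 < a" "a < m" and t: "t \<ge> 0"
  shows "laplace (semigroup_kernel k h t) m = fact k / m ^ Suc k * lshift h m t - laplace h m * lshift (\<lambda>x. x ^ k) m t"
proof -
  \<comment> \<open>Convolutions of functions of order \<open>a\<close> are only known to be of
    every order above \<open>a\<close>, so an order between \<open>a\<close> and \<open>m\<close> is
    needed.\<close>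
  obtain b where b: "a < b" "b < m" using dense[OF a(2)] by blast
  have "laplace (semigroup_kernel k h t) m = laplace (conv (\<lambda>x. x ^ k) (\<lambda>u. h (t + u))) m - laplace (conv (\<lambda>u. (t + u) ^ k) h) m"
    unfolding semigroup_kernel_def
    by (rule laplace_diff[OF _ _ b(2)])
       (intro exp_order_conv[OF _ _ b(1)] exp_order_power exp_order_shift exp_order_shift_power h t a(1))+
  also have "laplace (conv (\<lambda>x. x ^ k) (\<lambda>u. h (t + u))) m = laplace (\<lambda>x. x ^ k) m * laplace (\<lambda>u. h (t + u)) m"
    by (rule laplace_conv[OF exp_order_power[OF a(1)] exp_order_shift[OF h t] a(2)])
  also have "laplace (\<lambda>x. x ^ k) m = fact k / m ^ Suc k" using a by (intro laplace_power) auto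
  also have "laplace (conv (\<lambda>u. (t + u) ^ k) h) m = laplace (\<lambda>u. (t + u) ^ k) m * laplace h m"
    by (rule laplace_conv[OF exp_order_shift_power[OF a(1) t] h a(2)])
  finally show ?thesis unfolding lshift_def by simp
qed

text \<open>Both halves contain the product of \<open>laplace h m\<close> with
  \<open>fact k / m ^ Suc k\<close>, with opposite signs. What survives is the right-hand side of
  the resolvent equation.\<close>

lemma laplace_laplace_semigroup_kernel:
  assumes hc: "continuous_on {0..} h" and h: "exp_order h a" and a: "0 < a" "a < m" "m < l"
  shows "laplace (\<lambda>t. fact k / m ^ Suc k * lshift h m t - laplace h m * lshift (\<lambda>x. x ^ k) m t) l
      = fact k * (laplace h m / l ^ Suc k - laplace h l / m ^ Suc k) / (l - m)"
proof -
  have al: "a < l" using a by simp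
  have p: "exp_order (\<lambda>x. x ^ k) a" by (rule exp_order_power[OF a(1)])
  have pc: "continuous_on {0..} (\<lambda>x::real. x ^ k)" by (intro continuous_intros)
  have "laplace (\<lambda>t. fact k / m ^ Suc k * lshift h m t - laplace h m * lshift (\<lambda>x. x ^ k) m t) l
     = fact k / m ^ Suc k * laplace (lshift h m) l - laplace h m * laplace (lshift (\<lambda>x. x ^ k) m) l"
    using laplace_diff[OF exp_order_cmult[OF exp_order_lshift[OF hc h a(2)]] exp_order_cmult[OF exp_order_lshift[OF pc p a(2)]] al]
    by (simp only: laplace_cmult)
  also have "laplace (lshift h m) l = (laplace h m - laplace h l) / (l - m)" by (rule laplace_lshift[OF h a(2,3)])
  also have "laplace (lshift (\<lambda>x. x ^ k) m) l = (fact k / m ^ Suc k - fact k / l ^ Suc k) / (l - m)"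
    using laplace_lshift[OF p a(2,3)] laplace_power[of m k] laplace_power[of l k] a by simp
  finally have "laplace (\<lambda>t. fact k / m ^ Suc k * lshift h m t - laplace h m * lshift (\<lambda>x. x ^ k) m t) l
     = fact k / m ^ Suc k * ((laplace h m - laplace h l) / (l - m)) - laplace h m * ((fact k / m ^ Suc k - fact k / l ^ Suc k) / (l - m))" .
  moreover have "f / x * ((A - B) / d) - A * ((f / x - f / y) / d) = f * (A / y - B / x) / d" for f x y A B d :: real
    by (simp add: algebra_simps diff_divide_distrib)
  ultimately show ?thesis by simp
qed

lemma exp_order_pos_part:
  assumes "a > 0" "t \<ge> 0"
  shows "exp_order (\<lambda>u. (max 0 (t - u)) ^ k) a"
proof (rule exp_orderI)
  show "continuous_on {0..} (\<lambda>u::real. (max 0 (t - u)) ^ k)" by (intro continuous_intros)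
  fix u :: real assume u: "u \<ge> 0"
  have "\<bar>(max 0 (t - u)) ^ k\<bar> = (max 0 (t - u)) ^ k" by simp
  also have "\<dots> \<le> t ^ k" using u assms by (intro power_mono) auto
  also have "\<dots> \<le> t ^ k * exp (a * u)" using u assms mult_left_mono[of 1 "exp (a * u)" "t ^ k"] by simp
  finally show "\<bar>(max 0 (t - u)) ^ k\<bar> \<le> t ^ k * exp (a * u)" .
qed

text \<open>The function may jump at \<open>v = t\<close>; this is why \<open>exp_order\<close> asks
  for measurability and not for continuity.\<close>

lemma exp_order_truncated:
  assumes hc: "continuous_on {0..} h" and h: "exp_order h a" and a: "a > 0" "t \<ge> 0"
  shows "exp_order (\<lambda>v. if v \<le> t then h (t - v) else 0) a"
proof -
  obtain M where M: "M \<ge> 0" "\<And>t. t \<ge> 0 \<Longrightarrow> \<bar>h t\<bar> \<le> M * exp (a * t)"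
    using exp_orderE[OF h] by blast
  have "(\<lambda>v. indicator {0..t} v *\<^sub>R h (t - v)) \<in> borel_measurable borel"
    by (rule borel_measurable_continuous_on_indicator)
       (auto intro!: continuous_on_compose2[OF hc] continuous_intros)
  moreover have "(\<lambda>v. indicator {0..t} v *\<^sub>R h (t - v)) = (\<lambda>v. indicator {0..} v *\<^sub>R (if v \<le> t then h (t - v) else 0))"
    by (auto simp: indicator_def)
  ultimately have m: "set_borel_measurable borel {0..} (\<lambda>v. if v \<le> t then h (t - v) else 0)"
    unfolding set_borel_measurable_def by simp
  have "\<bar>if v \<le> t then h (t - v) else 0\<bar> \<le> (M * exp (a * t)) * exp (a * v)" if v: "v \<ge> 0" for v
  proof (cases "v \<le> t")
    case True
    have "\<bar>h (t - v)\<bar> \<le> M * exp (a * (t - v))" using M(2)[of "t - v"] True by simp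
    also have "\<dots> \<le> M * exp (a * (t + v))"
      using M(1) a(1) v by (intro mult_left_mono) auto
    finally show ?thesis using True by (simp add: exp_add[symmetric] algebra_simps)
  qed (use M in auto)
  then show ?thesis unfolding exp_order_def using m M(1) by (intro conjI exI[of _ "M * exp (a * t)"] allI impI) simp_all
qed

text \<open>The transforms in \<open>s\<close> of the two functions cut off at \<open>t\<close> are
  integrals over [0, t], hence convolutions with exp (-m v) in the variable \<open>t\<close>. So
  \<open>laplace_conv\<close> can be used once more for the transform in \<open>t\<close>.\<close>

lemma laplace_cosine_kernel:
  assumes hc: "continuous_on {0..} h" and h: "exp_order h a" and a: "0 < a" "a < m" and t: "t \<ge> 0" and k: "k > 0"
  shows "laplace (cosine_kernel k h t) m
    = (fact k / m ^ Suc k * lshift h m t - laplace h m * lshift (\<lambda>x. x ^ k) m t)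
      + laplace h m * conv (\<lambda>x. x ^ k) (\<lambda>v. exp (- m * v)) t + fact k / m ^ Suc k * conv h (\<lambda>v. exp (- m * v)) t"
proof -
  obtain b where b: "a < b" "b < m" using dense[OF a(2)] by blast
  note e1 = exp_order_semigroup_kernel[OF h a(1) b(1) t, of k]
  have e2: "exp_order (conv (\<lambda>u. (max 0 (t - u)) ^ k) h) b"
    by (intro exp_order_conv[OF _ _ b(1)] exp_order_pos_part h t a(1))
  have e3: "exp_order (conv (\<lambda>x. x ^ k) (\<lambda>v. if v \<le> t then h (t - v) else 0)) b"
    by (intro exp_order_conv[OF _ _ b(1)] exp_order_truncated exp_order_power h hc t a(1))
  have p1: "laplace (\<lambda>u. (max 0 (t - u)) ^ k) m = conv (\<lambda>x. x ^ k) (\<lambda>v. exp (- m * v)) t"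
    unfolding laplace_def conv_def set_lebesgue_integral_def
    by (intro Bochner_Integration.integral_cong refl) (use k in \<open>auto simp: indicator_def max_def zero_power\<close>)
  have p2: "laplace (\<lambda>v. if v \<le> t then h (t - v) else 0) m = conv h (\<lambda>v. exp (- m * v)) t"
    unfolding laplace_def conv_def set_lebesgue_integral_def
    by (intro Bochner_Integration.integral_cong refl) (auto simp: indicator_def)
  have "laplace (cosine_kernel k h t) m
    = laplace (semigroup_kernel k h t) m + laplace (conv (\<lambda>u. (max 0 (t - u)) ^ k) h) m
      + laplace (conv (\<lambda>x. x ^ k) (\<lambda>v. if v \<le> t then h (t - v) else 0)) m"
    unfolding cosine_kernel_def
    using laplace_add[OF exp_order_add[OF e1 e2] e3 b(2)] laplace_add[OF e1 e2 b(2)] by simp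
  also have "laplace (conv (\<lambda>u. (max 0 (t - u)) ^ k) h) m = laplace (\<lambda>u. (max 0 (t - u)) ^ k) m * laplace h m"
    by (rule laplace_conv[OF exp_order_pos_part[OF a(1) t] h a(2)])
  also have "laplace (conv (\<lambda>x. x ^ k) (\<lambda>v. if v \<le> t then h (t - v) else 0)) m
     = laplace (\<lambda>x. x ^ k) m * laplace (\<lambda>v. if v \<le> t then h (t - v) else 0) m"
    by (rule laplace_conv[OF exp_order_power[OF a(1)] exp_order_truncated[OF hc h a(1) t] a(2)])
  also have "laplace (\<lambda>x. x ^ k) m = fact k / m ^ Suc k" using a by (intro laplace_power) auto
  finally show ?thesis unfolding p1 p2 laplace_semigroup_kernel[OF h a t] by simp
qed

text \<open>The semigroup part carries 1 / (l - m), and the two cut-off parts carry 1 / (l + m), the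
  transform of exp (-m v). Partial fractions merge them into the denominator
  \<open>l\<^sup>2 - m\<^sup>2\<close>.\<close>

lemma laplace_laplace_cosine_kernel:
  assumes hc: "continuous_on {0..} h" and h: "exp_order h a" and a: "0 < a" "a < m" "m < l"
  shows "laplace (\<lambda>t. (fact k / m ^ Suc k * lshift h m t - laplace h m * lshift (\<lambda>x. x ^ k) m t)
      + laplace h m * conv (\<lambda>x. x ^ k) (\<lambda>v. exp (- m * v)) t + fact k / m ^ Suc k * conv h (\<lambda>v. exp (- m * v)) t) l
      = 2 * fact k * (l * laplace h m / l ^ Suc k - m * laplace h l / m ^ Suc k) / (l\<^sup>2 - m\<^sup>2)"
proof -
  have al: "a < l" using a by simp
  obtain b where b: "a < b" "b < l" using dense[OF al] by blast
  have p: "exp_order (\<lambda>x. x ^ k) a" by (rule exp_order_power[OF a(1)])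
  have pc: "continuous_on {0..} (\<lambda>x::real. x ^ k)" by (intro continuous_intros)
  have e: "exp_order (\<lambda>v. exp (- m * v)) a" by (rule exp_order_mono[OF exp_order_exp]) (use a in auto)
  have le: "laplace (\<lambda>v. exp (- m * v)) l = 1 / (l + m)" using laplace_exp[of "-m" l] a by simp
  have e1: "exp_order (\<lambda>t. fact k / m ^ Suc k * lshift h m t - laplace h m * lshift (\<lambda>x. x ^ k) m t) b"
    using a by (intro exp_order_mono[OF _ less_imp_le[OF b(1)]] exp_order_diff exp_order_cmult exp_order_lshift hc h pc p) auto
  have e2: "exp_order (\<lambda>t. laplace h m * conv (\<lambda>x. x ^ k) (\<lambda>v. exp (- m * v)) t) b"
    "exp_order (\<lambda>t. fact k / m ^ Suc k * conv h (\<lambda>v. exp (- m * v)) t) b"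
    by (intro exp_order_cmult exp_order_conv[OF _ _ b(1)] p e h)+
  have c1: "laplace (conv (\<lambda>x. x ^ k) (\<lambda>v. exp (- m * v))) l = fact k / l ^ Suc k * (1 / (l + m))"
    using laplace_conv[OF p e al] laplace_power[of l k] le a by simp
  have c2: "laplace (conv h (\<lambda>v. exp (- m * v))) l = laplace h l * (1 / (l + m))"
    using laplace_conv[OF h e al] le by simp
  define A where "A = laplace h m"
  define B where "B = laplace h l"
  define P where "P = 1 / l ^ Suc k"
  define Q where "Q = 1 / m ^ Suc k"
  have lm: "l - m \<noteq> 0" "l + m \<noteq> 0" using a by auto
  have sq: "l\<^sup>2 - m\<^sup>2 = (l - m) * (l + m)" by (simp add: power2_eq_square algebra_simps)
  have "laplace (\<lambda>t. (fact k / m ^ Suc k * lshift h m t - laplace h m * lshift (\<lambda>x. x ^ k) m t)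
      + laplace h m * conv (\<lambda>x. x ^ k) (\<lambda>v. exp (- m * v)) t + fact k / m ^ Suc k * conv h (\<lambda>v. exp (- m * v)) t) l
      = fact k * (A / l ^ Suc k - B / m ^ Suc k) / (l - m) + A * (fact k / l ^ Suc k * (1 / (l + m)))
        + fact k / m ^ Suc k * (B * (1 / (l + m)))"
    unfolding A_def B_def
    by (simp only: laplace_add[OF exp_order_add[OF e1 e2(1)] e2(2) b(2)] laplace_add[OF e1 e2(1) b(2)]
      laplace_laplace_semigroup_kernel[OF hc h a, of k] c1 c2 laplace_cmult)
  also have "\<dots> = fact k * ((A * P - B * Q) / (l - m) + (A * P + B * Q) / (l + m))"
    unfolding P_def Q_def by (simp add: field_simps add_divide_distrib diff_divide_distrib)
  also have "(A * P - B * Q) / (l - m) + (A * P + B * Q) / (l + m) = 2 * (l * (A * P) - m * (B * Q)) / (l\<^sup>2 - m\<^sup>2)"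
    unfolding sq using lm by (simp add: divide_simps) (simp add: algebra_simps)
  finally show ?thesis unfolding A_def B_def P_def Q_def by (simp add: mult.assoc)
qed

section \<open>D'Alembert's functional equation, the case without integration\<close>

lemma continuous_on_abs_shift:
  fixes h :: "real \<Rightarrow> real"
  assumes "continuous_on {0..} h"
  shows "continuous_on {0..} (\<lambda>s. h \<bar>t - s\<bar>)"
  by (rule continuous_on_compose2[OF assms]) (auto intro!: continuous_intros)

lemma exp_order_abs_shift:
  assumes hc: "continuous_on {0..} h" and h: "exp_order h a" and a: "0 < a" and t: "t \<ge> 0"
  shows "exp_order (\<lambda>s. h \<bar>t - s\<bar>) a"
proof -
  obtain M where M: "M \<ge> 0" "\<And>t. t \<ge> 0 \<Longrightarrow> \<bar>h t\<bar> \<le> M * exp (a * t)"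
    using exp_orderE[OF h] by blast
  show ?thesis
  proof (rule exp_orderI[OF continuous_on_abs_shift[OF hc]])
    fix s :: real assume s: "s \<ge> 0"
    have "\<bar>h \<bar>t - s\<bar>\<bar> \<le> M * exp (a * \<bar>t - s\<bar>)" by (rule M(2)) simp
    also have "\<dots> \<le> M * exp (a * (t + s))"
      using M(1) a s t by (intro mult_left_mono) auto
    finally show "\<bar>h \<bar>t - s\<bar>\<bar> \<le> (M * exp (a * t)) * exp (a * s)" by (simp add: exp_add[symmetric] algebra_simps)
  qed
qed

text \<open>Beyond \<open>t\<close> the reflected function is a translate of \<open>h\<close>, so
  its \<open>lshift\<close> at \<open>t\<close> is simply \<open>laplace h m\<close>; solving
  \<open>lshift_eq\<close> for the full transform gives the formula.\<close>

lemma laplace_abs_shift: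
  assumes hc: "continuous_on {0..} h" and h: "exp_order h a" and a: "0 < a" "a < m" and t: "t \<ge> 0"
  shows "laplace (\<lambda>s. h \<bar>t - s\<bar>) m = conv h (\<lambda>v. exp (- m * v)) t + laplace h m * exp (- m * t)"
proof -
  let ?g = "\<lambda>s. h \<bar>t - s\<bar>"
  have "lshift ?g m t = laplace h m"
    unfolding lshift_def by (rule laplace_cong) simp
  moreover have "conv (\<lambda>_. 1) (\<lambda>w. exp (- m * w) * ?g w) t = conv h (\<lambda>v. exp (- m * v)) t"
    unfolding conv_def set_lebesgue_integral_def
    by (intro Bochner_Integration.integral_cong refl) (auto simp: indicator_def)
  ultimately have "laplace h m = exp (m * t) * (laplace ?g m - conv h (\<lambda>v. exp (- m * v)) t)"
    using lshift_eq[OF exp_order_abs_shift[OF hc h a(1) t] a(2) t] by simp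
  then have "exp (- m * t) * laplace h m = (exp (- m * t) * exp (m * t)) * (laplace ?g m - conv h (\<lambda>v. exp (- m * v)) t)"
    by (simp only: mult.assoc)
  also have "exp (- m * t) * exp (m * t) = 1" by (simp add: exp_add[symmetric])
  finally show ?thesis by (simp add: mult.commute)
qed

text \<open>The result is that of \<open>laplace_laplace_cosine_kernel\<close> with the powers and
  the factorial replaced by 1, so that one resolvent equation covers all \<open>n\<close>.\<close>

lemma laplace_laplace_dalembert:
  assumes hc: "continuous_on {0..} h" and h: "exp_order h a" and a: "0 < a" "a < m" "m < l"
  shows "laplace (\<lambda>t. lshift h m t + (conv h (\<lambda>v. exp (- m * v)) t + laplace h m * exp (- m * t))) l
      = 2 * (l * laplace h m - m * laplace h l) / (l\<^sup>2 - m\<^sup>2)"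
proof -
  have al: "a < l" using a by simp
  obtain b where b: "a < b" "b < l" using dense[OF al] by blast
  have e: "exp_order (\<lambda>v. exp (- m * v)) a" by (rule exp_order_mono[OF exp_order_exp]) (use a in auto)
  have le: "laplace (\<lambda>v. exp (- m * v)) l = 1 / (l + m)" using laplace_exp[of "-m" l] a by simp
  have e1: "exp_order (lshift h m) b" by (rule exp_order_mono[OF exp_order_lshift[OF hc h a(2)]]) (use b in auto)
  have e2: "exp_order (conv h (\<lambda>v. exp (- m * v))) b" by (rule exp_order_conv[OF h e b(1)])
  have e3: "exp_order (\<lambda>t. laplace h m * exp (- m * t)) b"
    by (rule exp_order_mono[OF exp_order_cmult[OF e]]) (use b in auto)
  have lm: "l - m \<noteq> 0" "l + m \<noteq> 0" using a by auto
  have sq: "l\<^sup>2 - m\<^sup>2 = (l - m) * (l + m)" by (simp add: power2_eq_square algebra_simps)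
  have "laplace (\<lambda>t. lshift h m t + (conv h (\<lambda>v. exp (- m * v)) t + laplace h m * exp (- m * t))) l
     = (laplace h m - laplace h l) / (l - m) + (laplace h l * (1 / (l + m)) + laplace h m * (1 / (l + m)))"
    using laplace_add[OF e1 exp_order_add[OF e2 e3] b(2)] laplace_add[OF e2 e3 b(2)] laplace_lshift[OF h a(2,3)]
      laplace_conv[OF h e al] le by (simp add: laplace_cmult)
  also have "\<dots> = 2 * (l * laplace h m - m * laplace h l) / (l\<^sup>2 - m\<^sup>2)"
    unfolding sq using lm by (simp add: divide_simps) (simp add: algebra_simps)
  finally show ?thesis .
qed

section \<open>The Hahn--Banach theorem\<close>

definition sublinear :: "('a::real_vector \<Rightarrow> real) \<Rightarrow> bool" where
  "sublinear q \<longleftrightarrow> (\<forall>x y. q (x + y) \<le> q x + q y) \<and> (\<forall>r\<ge>0. \<forall>x. q (r *\<^sub>R x) = r * q x)"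

lemma sublinearD:
  assumes "sublinear q"
  shows "q (x + y) \<le> q x + q y" "r \<ge> 0 \<Longrightarrow> q (r *\<^sub>R x) = r * q x" "q 0 = 0" "0 \<le> q x + q (- x)"
proof -
  show s: "q (x + y) \<le> q x + q y" for x y using assms unfolding sublinear_def by auto
  show "r \<ge> 0 \<Longrightarrow> q (r *\<^sub>R x) = r * q x" for r x using assms unfolding sublinear_def by auto
  from this[of 0 0] show z: "q 0 = 0" by simp
  show "0 \<le> q x + q (- x)" using s[of x "-x"] z by simp
qed

text \<open>The parameter \<open>t = 1\<close> gives the estimate at \<open>- y\<close>. If no
  sublinear functional lies strictly below \<open>q\<close>, then \<open>q'\<close> is
  \<open>q\<close>, whence \<open>q (- y) = - q y\<close>: this is how minimality forces
  linearity.\<close>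

lemma sublinear_shrink:
  assumes q: "sublinear q"
  obtains q' where "sublinear q'" "\<And>x. q' x \<le> q x" "q' (- y) \<le> - q y"
proof -
  note Q = sublinearD[OF q]
  define f where "f = (\<lambda>x t. q (x + t *\<^sub>R y) - t * q y)"
  define q' where "q' = (\<lambda>x. INF t\<in>{0..}. f x t)"
  \<comment> \<open>The infimum is finite, by subadditivity for t y = (x + t y) + (- x).\<close>
  have bd: "- q (- x) \<le> f x t" if "t \<ge> 0" for x t
    using Q(1)[of "x + t *\<^sub>R y" "- x"] Q(2)[of t y] that unfolding f_def by simp
  have bdd: "bdd_below (f x ` {0..})" for x
    using bd by (intro bdd_belowI[of _ "- q (- x)"]) auto
  have le: "q' x \<le> f x t" if "t \<ge> 0" for x t
    unfolding q'_def by (rule cINF_lower[OF bdd]) (use that in auto)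
  have ge: "c \<le> q' x" if "\<And>t. t \<ge> 0 \<Longrightarrow> c \<le> f x t" for x c
    unfolding q'_def by (rule cINF_greatest) (use that in auto)
  have f_add: "f (x + z) (t + s) \<le> f x t + f z s" for x z t s
    using Q(1)[of "x + t *\<^sub>R y" "z + s *\<^sub>R y"] unfolding f_def by (simp add: algebra_simps)
  have f_scale: "f (r *\<^sub>R x) (r * t) = r * f x t" if "r \<ge> 0" for r x t
    using Q(2)[OF that, of "x + t *\<^sub>R y"] unfolding f_def by (simp add: algebra_simps)
  have add: "q' (x + z) \<le> q' x + q' z" for x z
  proof -
    have "q' (x + z) - f x t \<le> q' z" if t: "t \<ge> 0" for t
    proof (rule ge)
      fix s :: real assume "s \<ge> 0"
      then show "q' (x + z) - f x t \<le> f z s" using le[of "t + s" "x + z"] f_add[of x z t s] t by simp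
    qed
    then have "q' (x + z) - q' z \<le> q' x" by (intro ge) (simp add: algebra_simps)
    then show ?thesis by simp
  qed
  have sc_le: "q' (r *\<^sub>R x) \<le> r * q' x" if r: "r > 0" for r x
  proof -
    have "q' (r *\<^sub>R x) / r \<le> q' x"
    proof (rule ge)
      fix t :: real assume "t \<ge> 0"
      then have "q' (r *\<^sub>R x) \<le> r * f x t" using le[of "r * t" "r *\<^sub>R x"] f_scale[of r x t] r by simp
      then show "q' (r *\<^sub>R x) / r \<le> f x t" using r by (simp add: field_simps)
    qed
    then show ?thesis using r by (simp add: field_simps)
  qed
  have q'0: "q' 0 = 0"
  proof (rule antisym)
    show "q' 0 \<le> 0" using le[of 0 0] Q(3) by (simp add: f_def)
    show "0 \<le> q' 0" by (rule ge) (use bd[of _ 0] Q(3) in auto)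
  qed
  have sc: "q' (r *\<^sub>R x) = r * q' x" if r: "r \<ge> 0" for r x
  proof (cases "r = 0")
    case False
    with r have r: "r > 0" by simp
    have "q' ((1 / r) *\<^sub>R (r *\<^sub>R x)) \<le> (1 / r) * q' (r *\<^sub>R x)" by (rule sc_le) (use r in simp)
    then have "r * q' x \<le> q' (r *\<^sub>R x)" using r by (simp add: field_simps)
    with sc_le[OF r, of x] show ?thesis by simp
  qed (simp add: q'0)
  have "sublinear q'" unfolding sublinear_def using add sc by auto
  moreover have "q' x \<le> q x" for x using le[of 0 x] by (simp add: f_def)
  moreover have "q' (- y) \<le> - q y" using le[of 1 "- y"] Q(3) by (simp add: f_def)
  ultimately show ?thesis using that by blast
qed

text \<open>Subadditivity is where the chain matters: of two members the smaller one can be used in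
  both summands. The lower bound \<open>B\<close> keeps the real infimum meaningful.\<close>

lemma sublinear_Inf_chain:
  assumes C: "C \<noteq> {}" "\<And>q. q \<in> C \<Longrightarrow> sublinear q" and bd: "\<And>q x. q \<in> C \<Longrightarrow> B x \<le> q x"
    and ch: "\<And>q r. q \<in> C \<Longrightarrow> r \<in> C \<Longrightarrow> (\<forall>x. q x \<le> r x) \<or> (\<forall>x. r x \<le> q x)"
  shows "sublinear (\<lambda>x. INF q\<in>C. q x :: real)" "\<And>q x. q \<in> C \<Longrightarrow> (INF q\<in>C. q x) \<le> q x"
proof -
  show le: "(INF q\<in>C. q x) \<le> q x" if "q \<in> C" for q x
    by (rule cINF_lower[OF bdd_belowI[of _ "B x"] that]) (use bd in auto)
  have add: "(INF q\<in>C. q (x + y)) \<le> (INF q\<in>C. q x) + (INF q\<in>C. q y)" for x y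
  proof -
    have *: "(INF q\<in>C. q (x + y)) \<le> q x + r y" if qr: "q \<in> C" "r \<in> C" for q r
      using ch[OF qr]
    proof
      assume a: "\<forall>x. q x \<le> r x"
      have "(INF q\<in>C. q (x + y)) \<le> q (x + y)" by (rule le[OF qr(1)])
      also have "\<dots> \<le> q x + q y" by (rule sublinearD(1)[OF C(2)[OF qr(1)]])
      finally show ?thesis using a[rule_format, of y] by simp
    next
      assume a: "\<forall>x. r x \<le> q x"
      have "(INF q\<in>C. q (x + y)) \<le> r (x + y)" by (rule le[OF qr(2)])
      also have "\<dots> \<le> r x + r y" by (rule sublinearD(1)[OF C(2)[OF qr(2)]])
      finally show ?thesis using a[rule_format, of x] by simp
    qed
    have "(INF q\<in>C. q (x + y)) - q x \<le> (INF q\<in>C. q y)" if "q \<in> C" for q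
      by (rule cINF_greatest[OF C(1)]) (use *[OF that] in \<open>simp add: algebra_simps\<close>)
    then have "(INF q\<in>C. q (x + y)) - (INF q\<in>C. q y) \<le> (INF q\<in>C. q x)"
      by (intro cINF_greatest[OF C(1)]) (simp add: algebra_simps)
    then show ?thesis by simp
  qed
  have sc_le: "(INF q\<in>C. q (r *\<^sub>R x)) \<le> r * (INF q\<in>C. q x)" if r: "r > 0" for r x
  proof -
    have "(INF q\<in>C. q (r *\<^sub>R x)) / r \<le> (INF q\<in>C. q x)"
    proof (rule cINF_greatest[OF C(1)])
      fix q assume q: "q \<in> C"
      have "(INF q\<in>C. q (r *\<^sub>R x)) \<le> r * q x" using le[OF q, of "r *\<^sub>R x"] sublinearD(2)[OF C(2)[OF q], of r x] r by simp
      then show "(INF q\<in>C. q (r *\<^sub>R x)) / r \<le> q x" using r by (simp add: field_simps)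
    qed
    then show ?thesis using r by (simp add: field_simps)
  qed
  have sc: "(INF q\<in>C. q (r *\<^sub>R x)) = r * (INF q\<in>C. q x)" if r: "r \<ge> 0" for r x
  proof (cases "r = 0")
    case True
    have "(INF q\<in>C. q 0) = (INF q\<in>C. (0::real))"
      by (rule INF_cong) (use sublinearD(3)[OF C(2)] in auto)
    then show ?thesis using True C(1) by simp
  next
    case False
    with r have r: "r > 0" by simp
    have "(INF q\<in>C. q ((1 / r) *\<^sub>R (r *\<^sub>R x))) \<le> (1 / r) * (INF q\<in>C. q (r *\<^sub>R x))" by (rule sc_le) (use r in simp)
    then have "r * (INF q\<in>C. q x) \<le> (INF q\<in>C. q (r *\<^sub>R x))" using r by (simp add: field_simps)
    with sc_le[OF r, of x] show ?thesis by simp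
  qed
  show "sublinear (\<lambda>x. INF q\<in>C. q x)" unfolding sublinear_def using add sc by auto
qed

text \<open>Minimal sublinear functionals are linear.\<close>

theorem Hahn_Banach_sublinear:
  assumes p: "sublinear p"
  obtains \<phi> where "linear \<phi>" "\<And>x. \<phi> x \<le> p x" "\<phi> x0 = p x0"
proof -
  \<comment> \<open>Lowering \<open>p\<close> at \<open>- x0\<close> beforehand bounds every
    functional below \<open>p0\<close> at \<open>- x0\<close> by \<open>- p x0\<close>; for a linear
    one this means that its value at \<open>x0\<close> is at least \<open>p x0\<close>.\<close>
  obtain p0 where p0: "sublinear p0" "\<And>x. p0 x \<le> p x" "p0 (- x0) \<le> - p x0"
    using sublinear_shrink[OF p] by blast
  define A where "A = {q. sublinear q \<and> (\<forall>x. q x \<le> p0 x)}"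
  \<comment> \<open>The order is reversed, so that Zorn's lemma yields a minimal functional.\<close>
  define R where "R = (\<lambda>f g :: 'a \<Rightarrow> real. \<forall>x. g x \<le> f x)"
  have po: "partial_order_on A (relation_of R A)"
    by (rule partial_order_on_relation_ofI) (auto simp: R_def fun_eq_iff intro: order.trans antisym)
  have "\<exists>m\<in>A. \<forall>a\<in>A. R m a \<longrightarrow> a = m"
  proof (rule predicate_Zorn[OF po])
    fix C assume "C \<in> Chains (relation_of R A)"
    then have C: "\<And>q. q \<in> C \<Longrightarrow> q \<in> A" "\<And>q r. q \<in> C \<Longrightarrow> r \<in> C \<Longrightarrow> R q r \<or> R r q"
      unfolding Chains_def relation_of_def by auto
    show "\<exists>u\<in>A. \<forall>a\<in>C. R a u"
    proof (cases "C = {}")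
      case True
      then show ?thesis using p0 by (auto simp: A_def)
    next
      case False
      have bd: "- p0 (- x) \<le> q x" if "q \<in> C" for q x
      proof -
        have "sublinear q" "q (- x) \<le> p0 (- x)" using C(1)[OF that] by (auto simp: A_def)
        then show ?thesis using sublinearD(4)[of q x] by simp
      qed
      have *: "sublinear (\<lambda>x. INF q\<in>C. q x)" "\<And>q x. q \<in> C \<Longrightarrow> (INF q\<in>C. q x) \<le> q x"
        using sublinear_Inf_chain[of C "\<lambda>x. - p0 (- x)"] False C bd by (auto simp: A_def R_def)
      obtain q where q: "q \<in> C" using False by blast
      have "(INF q\<in>C. q x) \<le> p0 x" for x
        using *(2)[OF q, of x] C(1)[OF q] by (auto simp: A_def intro: order.trans)
      with * show ?thesis by (intro bexI[of _ "\<lambda>x. INF q\<in>C. q x"]) (auto simp: A_def R_def)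
    qed
  qed
  then obtain m where m: "m \<in> A" "\<And>a. a \<in> A \<Longrightarrow> R m a \<Longrightarrow> a = m" by blast
  have sm: "sublinear m" and mp: "\<And>x. m x \<le> p0 x" using m(1) by (auto simp: A_def)
  note M = sublinearD[OF sm]
  have neg: "m (- y) = - m y" for y
  proof -
    obtain q where q: "sublinear q" "\<And>x. q x \<le> m x" "q (- y) \<le> - m y"
      using sublinear_shrink[OF sm] by blast
    have "q \<in> A" using q mp by (auto simp: A_def intro: order.trans)
    then have "q = m" using m(2) q(2) by (simp add: R_def)
    then show ?thesis using q(3) M(4)[of y] by simp
  qed
  have "linear m"
  proof (rule linearI)
    fix x y
    have "- m (x + y) \<le> - m x - m y" using M(1)[of "- x" "- y"] neg[of "x + y"] neg[of x] neg[of y] by simp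
    then show "m (x + y) = m x + m y" using M(1)[of x y] by simp
    fix r
    show "m (r *\<^sub>R x) = r *\<^sub>R m x"
    proof (cases "r \<ge> 0")
      case False
      then show ?thesis using M(2)[of "- r" x] neg[of "r *\<^sub>R x"] by simp
    qed (simp add: M(2))
  qed
  moreover have "m x \<le> p x" for x using mp p0(2) order.trans by blast
  moreover have "m x0 = p x0"
    using mp[of "- x0"] p0(3) neg[of x0] \<open>\<And>x. m x \<le> p x\<close>[of x0] by simp
  ultimately show ?thesis using that by blast
qed

text \<open>Forgets the scalar field: Hahn-Banach is applied over the reals, also for complex
  scalars. Nonnegativity follows from the two conditions.\<close>

definition real_seminorm :: "('a::real_vector \<Rightarrow> real) \<Rightarrow> bool" where
  "real_seminorm q \<longleftrightarrow> (\<forall>x y. q (x + y) \<le> q x + q y) \<and> (\<forall>r x. q (r *\<^sub>R x) = \<bar>r\<bar> * q x)"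

lemma real_seminormD:
  assumes "real_seminorm q"
  shows "q (x + y) \<le> q x + q y" "q (r *\<^sub>R x) = \<bar>r\<bar> * q x" "q 0 = 0" "q (- x) = q x" "q x \<ge> 0"
    "q (x - y) \<le> q x + q y" "q (x - y) = q (y - x)" "\<bar>q x - q y\<bar> \<le> q (x - y)"
proof -
  show s: "q (x + y) \<le> q x + q y" for x y using assms unfolding real_seminorm_def by auto
  show sc: "q (r *\<^sub>R x) = \<bar>r\<bar> * q x" for r x using assms unfolding real_seminorm_def by auto
  from sc[of 0 0] show z: "q 0 = 0" by simp
  show n: "q (- x) = q x" for x using sc[of "-1" x] by simp
  show "q x \<ge> 0" using s[of x "-x"] n[of x] z by simp
  show "q (x - y) \<le> q x + q y" using s[of x "-y"] n[of y] by simp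
  show d: "q (x - y) = q (y - x)" for x y using n[of "y - x"] by simp
  show "\<bar>q x - q y\<bar> \<le> q (x - y)" using s[of "x - y" y] s[of "y - x" x] d[of x y] by simp
qed

lemma Hahn_Banach_seminorm:
  assumes p: "real_seminorm p"
  obtains \<phi> where "linear \<phi>" "\<And>x. \<bar>\<phi> x\<bar> \<le> p x" "\<phi> x0 = p x0"
proof -
  have "sublinear p" using p unfolding sublinear_def real_seminorm_def by auto
  then obtain \<phi> where \<phi>: "linear \<phi>" "\<And>x. \<phi> x \<le> p x" "\<phi> x0 = p x0"
    using Hahn_Banach_sublinear by blast
  have "\<bar>\<phi> x\<bar> \<le> p x" for x
    using \<phi>(2)[of x] \<phi>(2)[of "- x"] linear_neg[OF \<phi>(1), of x] real_seminormD(4)[OF p, of x] by simp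
  with \<phi> show ?thesis using that by blast
qed

section \<open>The mixed topology\<close>

lemma atin_top_of_set:
  fixes T :: "'b::topological_space set"
  assumes "t \<in> T"
  shows "atin (top_of_set T) t = at t within T"
  using assms by (auto simp: filter_eq_iff atin_subtopology_within eventually_atin_within eventually_at_topological)

lemma continuous_map_iff_limitin:
  fixes T :: "'b::topological_space set"
  shows "continuous_map (top_of_set T) X f \<longleftrightarrow> (\<forall>t\<in>T. limitin X f (f t) (at t within T))"
  by (simp add: continuous_map_atin atin_top_of_set)

lemma seminorm_overI:
  assumes "\<And>x y. p (x + y) \<le> p x + p y" "\<And>k x. p (scl k x) = norm k * p x" "\<And>x. 0 \<le> p x"
  shows "seminorm_over scl p"
  using assms unfolding seminorm_over_def by auto

text \<open>Zero entries from \<open>N\<close> on let two decompositions be brought to a common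
  length, as the triangle inequality requires.\<close>

definition inf_conv :: "(nat \<Rightarrow> 'a::real_normed_vector \<Rightarrow> real) \<Rightarrow> 'a \<Rightarrow> real" where
  "inf_conv r x = (INF (N, y) \<in> {(N, y). (\<forall>k\<ge>N. y k = 0) \<and> (\<Sum>k<N. y k) = x}. \<Sum>k<N. r k (y k))"

text \<open>By downward induction the tail sum from \<open>j\<close> lies in \<open>U j\<close>,
  being the sum of \<open>y j\<close> and the next tail, both in \<open>U (Suc j)\<close>.\<close>

lemma sum_mem_halving_sequence:
  fixes U :: "nat \<Rightarrow> 'a::real_normed_vector set"
  assumes "\<And>k. 0 \<in> U k" "\<And>k x y. x \<in> U (Suc k) \<Longrightarrow> y \<in> U (Suc k) \<Longrightarrow> x + y \<in> U k"
    and "\<And>i. i < N \<Longrightarrow> y i \<in> U (Suc i)"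
  shows "(\<Sum>i<N. y i) \<in> U 0"
proof -
  have "(\<Sum>i=j..<N. y i) \<in> U j" for j
  proof (induction "N - j" arbitrary: j)
    case 0
    then show ?case using assms(1) by simp
  next
    case (Suc n)
    then have "j < N" by simp
    then have "(\<Sum>i=j..<N. y i) = y j + (\<Sum>i=Suc j..<N. y i)" by (simp add: sum.atLeast_Suc_lessThan)
    moreover have "(\<Sum>i=Suc j..<N. y i) \<in> U (Suc j)" using Suc by simp
    ultimately show ?case using assms(2)[OF assms(3)[OF \<open>j < N\<close>]] by simp
  qed
  from this[of 0] show ?thesis by (simp add: atLeast0LessThan)
qed

text \<open>\<open>Saks_space\<close> only asserts that a norming system exists; the locale fixes
  one as \<open>P\<close>.\<close>

locale saks =
  fixes scl :: "'k::real_normed_field \<Rightarrow> 'a::real_normed_vector \<Rightarrow> 'a"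
    and \<tau> \<gamma> :: "'a topology" and P :: "('a \<Rightarrow> real) set"
  assumes nso: "normed_space_over scl"
    and haus: "Hausdorff_space \<tau>"
    and tau_open: "\<And>U. openin \<tau> U \<Longrightarrow> open U"
    and dir: "directed_seminorms scl P"
    and gen: "generates_topology P \<tau>"
    and nrm: "\<And>x. bdd_above ((\<lambda>p. p x) ` P)" "\<And>x. norm x = (SUP p\<in>P. p x)"
    and mix: "mixed_topology scl \<tau> \<gamma>"
    and sc: "seq_complete \<gamma>"
begin

lemma scl_of_real: "scl (of_real r) x = r *\<^sub>R x"
  using nso unfolding normed_space_over_def by auto

lemma norm_scl: "norm (scl k x) = norm k * norm x"
  using nso unfolding normed_space_over_def by auto

lemma vs: "vector_space scl"
  using nso unfolding normed_space_over_def by auto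

lemma scl_simps: "scl k (x + y) = scl k x + scl k y" "scl (k + l) x = scl k x + scl l x" "scl k (scl l x) = scl (k * l) x"
  "scl 1 x = x" "scl 0 x = 0" "scl k 0 = 0" "scl (k - l) x = scl k x - scl l x" "scl k (x - y) = scl k x - scl k y"
proof -
  interpret vector_space scl by (rule vs)
  show "scl k (x + y) = scl k x + scl k y" "scl (k + l) x = scl k x + scl l x" "scl k (scl l x) = scl (k * l) x"
  "scl 1 x = x" "scl 0 x = 0" "scl k 0 = 0" "scl (k - l) x = scl k x - scl l x" "scl k (x - y) = scl k x - scl k y"
    by (simp_all add: scale_right_distrib scale_left_distrib scale_left_diff_distrib scale_right_diff_distrib)
qed

lemma scl_sum: "scl k (sum f A) = (\<Sum>i\<in>A. scl k (f i))"
  by (induction A rule: infinite_finite_induct) (auto simp: scl_simps)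

lemma seminorm_over_real:
  assumes "seminorm_over scl q"
  shows "real_seminorm q"
  unfolding real_seminorm_def
proof (intro conjI allI)
  fix x y show "q (x + y) \<le> q x + q y" using assms unfolding seminorm_over_def by auto
next
  fix r x
  have "q (scl (of_real r) x) = norm (of_real r :: 'k) * q x" using assms unfolding seminorm_over_def by blast
  then show "q (r *\<^sub>R x) = \<bar>r\<bar> * q x" by (simp add: scl_of_real)
qed

lemma P_seminorm: "p \<in> P \<Longrightarrow> seminorm_over scl p"
  using dir unfolding directed_seminorms_def by auto

lemma P_real: "p \<in> P \<Longrightarrow> real_seminorm p"
  by (rule seminorm_over_real[OF P_seminorm])

lemma P_ne: "P \<noteq> {}"
  using dir unfolding directed_seminorms_def by auto

lemma P_dir: "p \<in> P \<Longrightarrow> q \<in> P \<Longrightarrow> \<exists>r\<in>P. \<forall>x. p x \<le> r x \<and> q x \<le> r x"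
  using dir unfolding directed_seminorms_def by auto

lemma P_le_norm: "p \<in> P \<Longrightarrow> p x \<le> norm x"
  unfolding nrm(2) by (rule cSUP_upper) (use nrm(1) in auto)

lemma norm_leI: "(\<And>p. p \<in> P \<Longrightarrow> p x \<le> B) \<Longrightarrow> norm x \<le> B"
  unfolding nrm(2) by (rule cSUP_least[OF P_ne])

lemma eq_0_if_P:
  assumes "\<And>p. p \<in> P \<Longrightarrow> p x = 0"
  shows "x = 0"
proof -
  have "norm x \<le> 0" by (rule norm_leI) (simp add: assms)
  then show ?thesis by simp
qed

lemma openin_tau: "openin \<tau> U \<longleftrightarrow> (\<forall>x\<in>U. \<exists>p\<in>P. \<exists>e>0. {y. p (y - x) < e} \<subseteq> U)"
  using gen unfolding generates_topology_def by blast

lemma openin_tau_ball: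
  assumes "p \<in> P"
  shows "openin \<tau> {y. p (y - x) < e}"
  unfolding openin_tau
proof
  fix z assume z: "z \<in> {y. p (y - x) < e}"
  have "{y. p (y - z) < e - p (z - x)} \<subseteq> {y. p (y - x) < e}"
  proof
    fix y assume "y \<in> {y. p (y - z) < e - p (z - x)}"
    then show "y \<in> {y. p (y - x) < e}" using real_seminormD(1)[OF P_real[OF assms], of "y - z" "z - x"] by simp
  qed
  then show "\<exists>p'\<in>P. \<exists>e'>0. {y. p' (y - z) < e'} \<subseteq> {y. p (y - x) < e}"
    using assms z by (intro bexI[of _ p] exI[of _ "e - p (z - x)"]) auto
qed

lemma topspace_tau [simp]: "topspace \<tau> = UNIV"
proof -
  have "openin \<tau> UNIV" unfolding openin_tau using P_ne by (auto intro: exI[of _ "1::real"])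
  then show ?thesis using openin_subset by blast
qed

lemma limitin_tau_iff: "limitin \<tau> f l F \<longleftrightarrow> (\<forall>p\<in>P. ((\<lambda>i. p (f i - l)) \<longlongrightarrow> 0) F)"
proof
  assume L: "limitin \<tau> f l F"
  show "\<forall>p\<in>P. ((\<lambda>i. p (f i - l)) \<longlongrightarrow> 0) F"
  proof (intro ballI tendstoI)
    fix p and e :: real assume p: "p \<in> P" and e: "e > 0"
    have "\<forall>\<^sub>F i in F. f i \<in> {y. p (y - l) < e}"
      using L openin_tau_ball[OF p, of l e] e real_seminormD(3)[OF P_real[OF p]] unfolding limitin_def by auto
    then show "\<forall>\<^sub>F i in F. dist (p (f i - l)) 0 < e"
      by eventually_elim (use real_seminormD(5)[OF P_real[OF p]] in auto)
  qed
next
  assume R: "\<forall>p\<in>P. ((\<lambda>i. p (f i - l)) \<longlongrightarrow> 0) F"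
  show "limitin \<tau> f l F" unfolding limitin_def
  proof (intro conjI allI impI)
    fix U assume "openin \<tau> U \<and> l \<in> U"
    then obtain p e where p: "p \<in> P" "e > 0" "{y. p (y - l) < e} \<subseteq> U" unfolding openin_tau by blast
    have "\<forall>\<^sub>F i in F. dist (p (f i - l)) 0 < e" using R p tendstoD by blast
    then show "\<forall>\<^sub>F i in F. f i \<in> U" by eventually_elim (use p(3) in auto)
  qed simp
qed

lemma mix1: "linear_topology scl \<gamma>" "\<And>B. bounded B \<Longrightarrow> subtopology \<gamma> B = subtopology \<tau> B"
  "\<And>U. openin \<tau> U \<Longrightarrow> openin \<gamma> U" "\<And>U. openin \<gamma> U \<Longrightarrow> open U"
  "\<And>\<sigma> U. mixed_candidate scl \<tau> \<sigma> \<Longrightarrow> openin \<sigma> U \<Longrightarrow> openin \<gamma> U"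
  using mix unfolding mixed_topology_def mixed_candidate_def by auto

lemma topspace_gamma [simp]: "topspace \<gamma> = UNIV"
  using mix1(1) unfolding linear_topology_def by auto

lemma Hausdorff_gamma: "Hausdorff_space \<gamma>"
  using haus mix1(3) unfolding Hausdorff_space_def by (simp, meson)

lemma limitin_gamma_tau: "limitin \<gamma> f l F \<Longrightarrow> limitin \<tau> f l F"
  using mix1(3) unfolding limitin_def by auto

text \<open>On a ball the two topologies agree. The radius is at least \<open>norm l\<close>,
  because the limit has to lie in the ball too.\<close>

lemma limitin_gammaI:
  assumes "limitin \<tau> f l F" "\<forall>\<^sub>F i in F. norm (f i) \<le> B"
  shows "limitin \<gamma> f l F"
proof -
  define C :: "'a set" where "C = cball 0 (max B (norm l))"
  have ev: "\<forall>\<^sub>F i in F. f i \<in> C" using assms(2) by eventually_elim (auto simp: C_def)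
  have "limitin (subtopology \<tau> C) f l F"
    unfolding limitin_subtopology using assms(1) ev by (auto simp: C_def)
  moreover have "subtopology \<tau> C = subtopology \<gamma> C" using mix1(2)[of C] by (simp add: C_def)
  ultimately have "limitin (subtopology \<gamma> C) f l F" by simp
  then show ?thesis unfolding limitin_subtopology by simp
qed

text \<open>Smallness near 0 on every ball suffices, as differences of points of a ball lie in a
  larger ball. The unit balls of these seminorms will turn out to form a neighbourhood base of 0 for
  \<open>\<gamma>\<close>.\<close>

definition mixed_seminorm :: "('a \<Rightarrow> real) \<Rightarrow> bool" where
  "mixed_seminorm q \<longleftrightarrow> seminorm_over scl q \<and>
     (\<forall>M. \<forall>e>0. \<exists>p\<in>P. \<exists>d>0. \<forall>x. norm x \<le> M \<and> p x < d \<longrightarrow> q x < e)"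

lemma mixed_seminorm_real: "mixed_seminorm q \<Longrightarrow> real_seminorm q"
  unfolding mixed_seminorm_def by (blast intro: seminorm_over_real)

lemma mixed_seminorm_P: "p \<in> P \<Longrightarrow> mixed_seminorm p"
  unfolding mixed_seminorm_def using P_seminorm by blast

lemma mixed_seminormE:
  assumes "mixed_seminorm q" "e > 0"
  obtains p d where "p \<in> P" "d > 0" "\<And>x. norm x \<le> M \<Longrightarrow> p x < d \<Longrightarrow> q x < e"
proof -
  have "\<exists>p\<in>P. \<exists>d>0. \<forall>x. norm x \<le> M \<and> p x < d \<longrightarrow> q x < e"
    using assms unfolding mixed_seminorm_def by blast
  then show ?thesis using that by blast
qed

lemma mixed_seminorm_add:
  assumes "mixed_seminorm q" "mixed_seminorm r"
  shows "mixed_seminorm (\<lambda>x. q x + r x)"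
  unfolding mixed_seminorm_def
proof (intro conjI allI impI)
  have "seminorm_over scl q" "seminorm_over scl r" using assms unfolding mixed_seminorm_def by auto
  then have h: "q (scl k x) = norm k * q x" "r (scl k x) = norm k * r x" for k x
    unfolding seminorm_over_def by blast+
  show "seminorm_over scl (\<lambda>x. q x + r x)"
  proof (rule seminorm_overI)
    fix x y k
    show "q (x + y) + r (x + y) \<le> q x + r x + (q y + r y)"
      using real_seminormD(1)[OF mixed_seminorm_real[OF assms(1)], of x y]
        real_seminormD(1)[OF mixed_seminorm_real[OF assms(2)], of x y] by linarith
    show "0 \<le> q x + r x"
      using real_seminormD(5)[OF mixed_seminorm_real[OF assms(1)], of x] real_seminormD(5)[OF mixed_seminorm_real[OF assms(2)], of x]
      by linarith
    show "q (scl k x) + r (scl k x) = norm k * (q x + r x)" by (simp only: h distrib_left)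
  qed
  fix M and e :: real assume e: "e > 0"
  obtain p1 d1 where 1: "p1 \<in> P" "d1 > 0" "\<And>x. norm x \<le> M \<Longrightarrow> p1 x < d1 \<Longrightarrow> q x < e / 2"
    using mixed_seminormE[OF assms(1) half_gt_zero[OF e]] by blast
  obtain p2 d2 where 2: "p2 \<in> P" "d2 > 0" "\<And>x. norm x \<le> M \<Longrightarrow> p2 x < d2 \<Longrightarrow> r x < e / 2"
    using mixed_seminormE[OF assms(2) half_gt_zero[OF e]] by blast
  obtain p where p: "p \<in> P" "\<And>x. p1 x \<le> p x \<and> p2 x \<le> p x" using P_dir[OF 1(1) 2(1)] by blast
  have "q x + r x < e" if "norm x \<le> M \<and> p x < min d1 d2" for x
    using 1(3)[of x] 2(3)[of x] p(2)[of x] that by auto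
  then show "\<exists>p\<in>P. \<exists>d>0. \<forall>x. norm x \<le> M \<and> p x < d \<longrightarrow> q x + r x < e"
    using p(1) 1(2) 2(2) by (intro bexI[of _ p] exI[of _ "min d1 d2"]) auto
qed

lemma mixed_seminorm_tendsto:
  assumes q: "mixed_seminorm q" and x: "bounded (range x)" "limitin \<tau> x l sequentially"
  shows "(\<lambda>k. q (x k - l)) \<longlonglongrightarrow> 0"
proof (rule tendstoI)
  fix e :: real assume e: "e > 0"
  obtain M where M: "\<And>k. norm (x k) \<le> M" using x(1) unfolding bounded_iff by auto
  obtain p d where p: "p \<in> P" "d > 0" "\<And>z. norm z \<le> M + norm l \<Longrightarrow> p z < d \<Longrightarrow> q z < e"
    using mixed_seminormE[OF q e] by blast
  have "(\<lambda>k. p (x k - l)) \<longlonglongrightarrow> 0" using x(2) p(1) unfolding limitin_tau_iff by blast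
  then have "\<forall>\<^sub>F k in sequentially. dist (p (x k - l)) 0 < d" using p(2) tendstoD by blast
  then show "\<forall>\<^sub>F k in sequentially. dist (q (x k - l)) 0 < e"
  proof eventually_elim
    case (elim k)
    have "norm (x k - l) \<le> M + norm l" using M[of k] norm_triangle_ineq4[of "x k" l] by simp
    then have "q (x k - l) < e" using p(3) elim by auto
    then show ?case using real_seminormD(5)[OF mixed_seminorm_real[OF q]] by simp
  qed
qed

text \<open>The seminorms that are \<open>\<tau>\<close>-continuous on balls generate a candidate for the mixed topology;
  since \<open>\<gamma>\<close> is the finest one, they are \<open>\<gamma>\<close>-continuous.\<close>

lemma openin_gamma_ball:
  assumes q: "mixed_seminorm q"
  shows "openin \<gamma> {y. q (y - x) < e}"
proof -
  \<comment> \<open>One seminorm per point is enough, since the sum of two such seminorms is of the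
    same kind.\<close>
  define op where "op = (\<lambda>U. \<forall>x\<in>U. \<exists>q e. mixed_seminorm q \<and> e > 0 \<and> {y. q (y - x) < e} \<subseteq> U)"
  have ist: "istopology op" unfolding istopology_def
  proof (intro conjI allI impI)
    fix S T assume S: "op S" "op T"
    show "op (S \<inter> T)" unfolding op_def
    proof
      fix x assume x: "x \<in> S \<inter> T"
      obtain q e where q: "mixed_seminorm q" "e > 0" "{y. q (y - x) < e} \<subseteq> S"
        using S(1) x unfolding op_def by blast
      obtain r f where r: "mixed_seminorm r" "f > 0" "{y. r (y - x) < f} \<subseteq> T"
        using S(2) x unfolding op_def by blast
      have "{y. q (y - x) + r (y - x) < min e f} \<subseteq> S \<inter> T"
      proof
        fix y assume "y \<in> {y. q (y - x) + r (y - x) < min e f}"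
        moreover have "q (y - x) \<ge> 0" "r (y - x) \<ge> 0"
          using real_seminormD(5) mixed_seminorm_real q(1) r(1) by blast+
        ultimately show "y \<in> S \<inter> T" using q(3) r(3) by auto
      qed
      then show "\<exists>q e. mixed_seminorm q \<and> e > 0 \<and> {y. q (y - x) < e} \<subseteq> S \<inter> T"
        using mixed_seminorm_add[OF q(1) r(1)] q(2) r(2) by (intro exI[of _ "\<lambda>x. q x + r x"] exI[of _ "min e f"]) auto
    qed
  next
    fix K assume "\<forall>S\<in>K. op S"
    then show "op (\<Union> K)" unfolding op_def by (meson Union_iff Union_upper subset_trans)
  qed
  define \<sigma> where "\<sigma> = topology op"
  have os: "openin \<sigma> = op" unfolding \<sigma>_def by (rule topology_inverse'[OF ist])
  have ball: "openin \<sigma> {y. q (y - x) < e}" if q: "mixed_seminorm q" for q x e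
    unfolding os op_def
  proof
    fix z assume z: "z \<in> {y. q (y - x) < e}"
    have "{y. q (y - z) < e - q (z - x)} \<subseteq> {y. q (y - x) < e}"
    proof
      fix y assume "y \<in> {y. q (y - z) < e - q (z - x)}"
      then show "y \<in> {y. q (y - x) < e}" using real_seminormD(1)[OF mixed_seminorm_real[OF q], of "y - z" "z - x"] by simp
    qed
    then show "\<exists>q' e'. mixed_seminorm q' \<and> e' > 0 \<and> {y. q' (y - z) < e'} \<subseteq> {y. q (y - x) < e}"
      using q z by (intro exI[of _ q] exI[of _ "e - q (z - x)"]) auto
  qed
  have ts: "topspace \<sigma> = UNIV"
  proof -
    obtain p where "p \<in> P" using P_ne by blast
    then have "openin \<sigma> UNIV" unfolding os op_def using mixed_seminorm_P by (auto intro: exI[of _ "1::real"])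
    then show ?thesis using openin_subset by blast
  qed
  have self: "x \<in> {y. q (y - x) < e}" if "mixed_seminorm q" "e > 0" for q x e
    using real_seminormD(3)[OF mixed_seminorm_real[OF that(1)]] that(2) by simp
  have "mixed_candidate scl \<tau> \<sigma>" unfolding mixed_candidate_def linear_topology_def
  proof (intro conjI allI impI)
    show "topspace \<sigma> = UNIV" by (rule ts)
    show "continuous_map (prod_topology \<sigma> \<sigma>) \<sigma> (\<lambda>(x, y). x + y)"
      unfolding continuous_map_def
    proof (intro conjI allI impI)
      fix U assume U: "openin \<sigma> U"
      show "openin (prod_topology \<sigma> \<sigma>) {z \<in> topspace (prod_topology \<sigma> \<sigma>). (case z of (x, y) \<Rightarrow> x + y) \<in> U}"
        unfolding openin_prod_topology_alt
      proof (intro allI impI)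
        fix x y assume "(x, y) \<in> {z \<in> topspace (prod_topology \<sigma> \<sigma>). (case z of (x, y) \<Rightarrow> x + y) \<in> U}"
        then have "x + y \<in> U" by simp
        then obtain q e where q: "mixed_seminorm q" "e > 0" "{z. q (z - (x + y)) < e} \<subseteq> U"
          using U unfolding os op_def by blast
        have "{z. q (z - x) < e / 2} \<times> {z. q (z - y) < e / 2} \<subseteq> {z \<in> topspace (prod_topology \<sigma> \<sigma>). (case z of (x, y) \<Rightarrow> x + y) \<in> U}"
        proof clarsimp
          fix a b assume "q (a - x) * 2 < e" "q (b - y) * 2 < e"
          then have "q (a + b - (x + y)) < e"
            using real_seminormD(1)[OF mixed_seminorm_real[OF q(1)], of "a - x" "b - y"] by (simp add: algebra_simps)
          then show "a \<in> topspace \<sigma> \<and> b \<in> topspace \<sigma> \<and> a + b \<in> U" using q(3) ts by auto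
        qed
        then show "\<exists>V W. openin \<sigma> V \<and> openin \<sigma> W \<and> x \<in> V \<and> y \<in> W \<and> V \<times> W \<subseteq> {z \<in> topspace (prod_topology \<sigma> \<sigma>). (case z of (x, y) \<Rightarrow> x + y) \<in> U}"
          using ball[OF q(1)] self[OF q(1)] q(2) by (meson half_gt_zero)
      qed
    qed (simp add: ts)
    show "continuous_map (prod_topology euclidean \<sigma>) \<sigma> (\<lambda>(k, x). scl k x)"
      unfolding continuous_map_def
    proof (intro conjI allI impI)
      fix U assume U: "openin \<sigma> U"
      show "openin (prod_topology euclidean \<sigma>) {z \<in> topspace (prod_topology euclidean \<sigma>). (case z of (k, x) \<Rightarrow> scl k x) \<in> U}"
        unfolding openin_prod_topology_alt
      proof (intro allI impI)
        fix k x assume "(k, x) \<in> {z \<in> topspace (prod_topology euclidean \<sigma>). (case z of (k, x) \<Rightarrow> scl k x) \<in> U}"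
        then have "scl k x \<in> U" by simp
        then obtain q e where q: "mixed_seminorm q" "e > 0" "{z. q (z - scl k x) < e} \<subseteq> U"
          using U unfolding os op_def by blast
        have qs: "q (scl a z) = norm a * q z" for a z using q(1) unfolding mixed_seminorm_def seminorm_over_def by blast
        note Q = real_seminormD[OF mixed_seminorm_real[OF q(1)]]
        \<comment> \<open>The difference splits into scl a (z - x) and scl (a - k) x. The bound 1 on
          \<open>d1\<close> gives norm a <= norm k + 1, and each part then contributes at most e /
          2.\<close>
        define d1 where "d1 = min 1 (e / (2 * (q x + 1)))"
        define d2 where "d2 = e / (2 * (norm k + 1))"
        have d: "d1 > 0" "d2 > 0" "d1 \<le> 1" unfolding d1_def d2_def using q(2) Q(5)[of x]
          by (auto intro!: divide_pos_pos add_nonneg_pos)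
        have "ball k d1 \<times> {z. q (z - x) < d2} \<subseteq> {z \<in> topspace (prod_topology euclidean \<sigma>). (case z of (k, x) \<Rightarrow> scl k x) \<in> U}"
        proof clarsimp
          fix a z assume a: "dist k a < d1" and z: "q (z - x) < d2"
          have na: "norm (a - k) < d1" using a by (simp add: dist_norm norm_minus_commute)
          have "norm a \<le> norm k + 1" using na d(3) norm_triangle_ineq2[of a k] by simp
          have "scl a z - scl k x = scl a (z - x) + scl (a - k) x" by (simp add: scl_simps)
          then have "q (scl a z - scl k x) \<le> norm a * q (z - x) + norm (a - k) * q x"
            using Q(1)[of "scl a (z - x)" "scl (a - k) x"] by (simp add: qs)
          also have "norm a * q (z - x) \<le> (norm k + 1) * q (z - x)" using \<open>norm a \<le> norm k + 1\<close> Q(5) by (intro mult_right_mono) auto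
          also have "(norm k + 1) * q (z - x) < (norm k + 1) * d2" using z by (intro mult_strict_left_mono add_nonneg_pos) auto
          also have "(norm k + 1) * d2 = e / 2" unfolding d2_def using norm_ge_zero[of k] by (simp add: field_simps add_nonneg_eq_0_iff)
          also have "norm (a - k) * q x \<le> d1 * q x" using na Q(5) by (intro mult_right_mono) auto
          also have "d1 * q x \<le> (e / (2 * (q x + 1))) * q x" unfolding d1_def using Q(5) by (intro mult_right_mono) auto
          also have "(e / (2 * (q x + 1))) * q x \<le> e / 2" using Q(5)[of x] q(2) by (simp add: field_simps)
          finally have "q (scl a z - scl k x) < e" by simp
          then show "z \<in> topspace \<sigma> \<and> scl a z \<in> U" using q(3) ts by auto
        qed
        moreover have "openin euclidean (ball k d1)" by simp
        ultimately show "\<exists>V W. openin euclidean V \<and> openin \<sigma> W \<and> k \<in> V \<and> x \<in> W \<and> V \<times> W \<subseteq> {z \<in> topspace (prod_topology euclidean \<sigma>). (case z of (k, x) \<Rightarrow> scl k x) \<in> U}"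
          using ball[OF q(1)] self[OF q(1) d(2)] d(1) by (meson centre_in_ball)
      qed
    qed (simp add: ts)
    show to: "openin \<sigma> U" if "openin \<tau> U" for U
      using that mixed_seminorm_P unfolding os op_def openin_tau by blast
    show "open U" if U: "openin \<sigma> U" for U
      unfolding open_dist
    proof
      fix x assume "x \<in> U"
      then obtain q e where q: "mixed_seminorm q" "e > 0" "{z. q (z - x) < e} \<subseteq> U"
        using U unfolding os op_def by blast
      obtain p d where p: "p \<in> P" "d > 0" "\<And>z. norm z \<le> 1 \<Longrightarrow> p z < d \<Longrightarrow> q z < e"
        using mixed_seminormE[OF q(1,2)] by blast
      have "y \<in> U" if "dist y x < min 1 d" for y
      proof -
        have "norm (y - x) < min 1 d" using that by (simp add: dist_norm)
        then have "q (y - x) < e" using p(3)[of "y - x"] P_le_norm[OF p(1), of "y - x"] by simp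
        then show ?thesis using q(3) by auto
      qed
      then show "\<exists>e>0. \<forall>y. dist y x < e \<longrightarrow> y \<in> U" using p(2) by (intro exI[of _ "min 1 d"]) auto
    qed
    show "subtopology \<sigma> B = subtopology \<tau> B" if B: "bounded B" for B
      unfolding topology_eq openin_subtopology
    proof (intro allI iffI)
      fix S assume "\<exists>T. openin \<tau> T \<and> S = T \<inter> B"
      then show "\<exists>T. openin \<sigma> T \<and> S = T \<inter> B" using to by blast
    next
      fix S assume "\<exists>T. openin \<sigma> T \<and> S = T \<inter> B"
      then obtain T where T: "openin \<sigma> T" "S = T \<inter> B" by blast
      obtain M where M: "\<And>x. x \<in> B \<Longrightarrow> norm x \<le> M" using B unfolding bounded_iff by auto
      have "\<exists>V. openin \<tau> V \<and> x \<in> V \<and> V \<inter> B \<subseteq> T" if x: "x \<in> S" for x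
      proof -
        obtain q e where q: "mixed_seminorm q" "e > 0" "{z. q (z - x) < e} \<subseteq> T"
          using T x unfolding os op_def by blast
        \<comment> \<open>Two points of \<open>B\<close> differ by a vector of norm at most
          \<open>M + M\<close>.\<close>
        obtain p d where p: "p \<in> P" "d > 0" "\<And>z. norm z \<le> M + M \<Longrightarrow> p z < d \<Longrightarrow> q z < e"
          using mixed_seminormE[OF q(1,2)] by blast
        have "{y. p (y - x) < d} \<inter> B \<subseteq> T"
        proof
          fix y assume y: "y \<in> {y. p (y - x) < d} \<inter> B"
          have "norm (y - x) \<le> M + M" using M[of y] M[of x] x y T(2) norm_triangle_ineq4[of y x] by auto
          then show "y \<in> T" using p(3)[of "y - x"] y q(3) by auto
        qed
        then show ?thesis using openin_tau_ball[OF p(1)] self[OF mixed_seminorm_P[OF p(1)] p(2)] by blast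
      qed
      then obtain V where V: "\<And>x. x \<in> S \<Longrightarrow> openin \<tau> (V x) \<and> x \<in> V x \<and> V x \<inter> B \<subseteq> T" by metis
      have "openin \<tau> (\<Union>x\<in>S. V x)" using V by blast
      moreover have "S = (\<Union>x\<in>S. V x) \<inter> B" using V T(2) by blast
      ultimately show "\<exists>T. openin \<tau> T \<and> S = T \<inter> B" by blast
    qed
  qed
  from mix1(5)[OF this ball[OF q]] show ?thesis .
qed

end

section \<open>Local convexity of the mixed topology\<close>

context saks
begin

context
  fixes r :: "nat \<Rightarrow> 'a \<Rightarrow> real"
  assumes r: "\<And>k. seminorm_over scl (r k)"
begin

lemma sn_nonneg: "0 \<le> r k x"
  using r unfolding seminorm_over_def by blast

lemma sn_add: "r k (x + y) \<le> r k x + r k y"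
  using r unfolding seminorm_over_def by blast

lemma sn_scl: "r k (scl a x) = norm a * r k x"
  using r unfolding seminorm_over_def by blast

lemma sn_zero: "r k 0 = 0"
  using sn_scl[of k 0 0] by (simp add: scl_simps)

lemma inf_conv_le:
  assumes "\<And>k. k \<ge> N \<Longrightarrow> y k = 0" "(\<Sum>k<N. y k) = x"
  shows "inf_conv r x \<le> (\<Sum>k<N. r k (y k))"
proof -
  have "bdd_below ((\<lambda>(N, y). \<Sum>k<N. r k (y k)) ` {(N, y). (\<forall>k\<ge>N. y k = 0) \<and> (\<Sum>k<N. y k) = x})"
    by (rule bdd_belowI[of _ 0]) (auto intro!: sum_nonneg sn_nonneg)
  then show ?thesis unfolding inf_conv_def
    by (rule cINF_lower2[where x="(N, y)"]) (use assms in auto)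
qed

lemma inf_conv_le1: "inf_conv r x \<le> r k x"
proof -
  have "inf_conv r x \<le> (\<Sum>i<Suc k. r i (if i = k then x else 0))"
    by (rule inf_conv_le) (auto simp: sum.delta)
  also have "\<dots> = (\<Sum>i<Suc k. if i = k then r k x else 0)" by (intro sum.cong) (auto simp: sn_zero)
  also have "\<dots> = r k x" by (simp add: sum.delta)
  finally show ?thesis .
qed

lemma inf_conv_ne: "{(N::nat, y). (\<forall>k\<ge>N. y k = 0) \<and> (\<Sum>k<N. y k) = x} \<noteq> {}" (is "?S \<noteq> {}") for x :: 'a
proof
  assume "?S = {}"
  moreover have "(Suc 0, \<lambda>i. if i = 0 then x else 0) \<in> ?S" by simp
  ultimately show False by (simp only: empty_iff)
qed

lemma inf_conv_ge:
  assumes "\<And>N y. (\<And>k. k \<ge> N \<Longrightarrow> y k = 0) \<Longrightarrow> (\<Sum>k<N. y k) = x \<Longrightarrow> c \<le> (\<Sum>k<N. r k (y k))"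
  shows "c \<le> inf_conv r x"
  unfolding inf_conv_def by (rule cINF_greatest[OF inf_conv_ne]) (use assms in auto)

lemma inf_conv_less:
  assumes "inf_conv r x < c"
  obtains N and y :: "nat \<Rightarrow> 'a" where "(\<Sum>k<N. y k) = x" "(\<Sum>k<N. r k (y k)) < c"
proof (rule ccontr)
  assume nt: "\<not> thesis"
  have "c \<le> inf_conv r x"
  proof (rule inf_conv_ge)
    fix N and y :: "nat \<Rightarrow> 'a" assume "(\<Sum>k<N. y k) = x"
    then show "c \<le> (\<Sum>k<N. r k (y k))" using that[of y N] nt by linarith
  qed
  then show False using assms by simp
qed

lemma seminorm_over_inf_conv: "seminorm_over scl (inf_conv r)"
proof (rule seminorm_overI)
  show "0 \<le> inf_conv r x" for x
    by (rule inf_conv_ge) (auto intro!: sum_nonneg sn_nonneg)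
  show "inf_conv r (x + z) \<le> inf_conv r x + inf_conv r z" for x z
  proof -
    have *: "inf_conv r (x + z) \<le> (\<Sum>k<N. r k (y k)) + (\<Sum>k<M. r k (w k))"
      if y: "\<And>k. k \<ge> N \<Longrightarrow> y k = 0" "(\<Sum>k<N. y k) = x" and w: "\<And>k. k \<ge> M \<Longrightarrow> w k = 0" "(\<Sum>k<M. w k) = z" for N M and y w :: "nat \<Rightarrow> 'a"
    proof -
      define K where "K = max N M"
      have s1: "(\<Sum>k<N. y k) = (\<Sum>k<K. y k)" "(\<Sum>k<N. r k (y k)) = (\<Sum>k<K. r k (y k))"
        by (rule sum.mono_neutral_left; auto simp: K_def not_less y(1) sn_zero)+
      have s2: "(\<Sum>k<M. w k) = (\<Sum>k<K. w k)" "(\<Sum>k<M. r k (w k)) = (\<Sum>k<K. r k (w k))"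
        by (rule sum.mono_neutral_left; auto simp: K_def not_less w(1) sn_zero)+
      have "inf_conv r (x + z) \<le> (\<Sum>k<K. r k (y k + w k))"
        by (rule inf_conv_le) (use y w s1 s2 in \<open>auto simp: K_def sum.distrib\<close>)
      also have "\<dots> \<le> (\<Sum>k<K. r k (y k) + r k (w k))" by (intro sum_mono sn_add)
      finally show ?thesis unfolding s1(2) s2(2) by (simp add: sum.distrib)
    qed
    have "inf_conv r (x + z) - inf_conv r x \<le> inf_conv r z"
    proof (rule inf_conv_ge)
      fix M and w :: "nat \<Rightarrow> 'a" assume w: "\<And>k. k \<ge> M \<Longrightarrow> w k = 0" "(\<Sum>k<M. w k) = z"
      have "inf_conv r (x + z) - (\<Sum>k<M. r k (w k)) \<le> inf_conv r x"
        by (rule inf_conv_ge) (use *[OF _ _ w] in \<open>simp add: algebra_simps\<close>)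
      then show "inf_conv r (x + z) - inf_conv r x \<le> (\<Sum>k<M. r k (w k))" by simp
    qed
    then show ?thesis by simp
  qed
  have sc_le: "inf_conv r (scl a x) \<le> norm a * inf_conv r x" if a: "a \<noteq> 0" for a x
  proof -
    have "inf_conv r (scl a x) / norm a \<le> inf_conv r x"
    proof (rule inf_conv_ge)
      fix N and y :: "nat \<Rightarrow> 'a" assume y: "\<And>k. k \<ge> N \<Longrightarrow> y k = 0" "(\<Sum>k<N. y k) = x"
      have "inf_conv r (scl a x) \<le> (\<Sum>k<N. r k (scl a (y k)))"
        by (rule inf_conv_le) (use y in \<open>auto simp: scl_simps scl_sum[symmetric]\<close>)
      also have "\<dots> = norm a * (\<Sum>k<N. r k (y k))" by (simp add: sn_scl sum_distrib_left)
      finally show "inf_conv r (scl a x) / norm a \<le> (\<Sum>k<N. r k (y k))" using a by (simp add: field_simps)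
    qed
    then show ?thesis using a by (simp add: field_simps)
  qed
  show "inf_conv r (scl a x) = norm a * inf_conv r x" for a x
  proof (cases "a = 0")
    case True
    have "inf_conv r 0 \<le> 0" using inf_conv_le1[of 0 0] sn_zero by simp
    moreover have "0 \<le> inf_conv r 0" by (rule inf_conv_ge) (auto intro!: sum_nonneg sn_nonneg)
    ultimately show ?thesis using True by (simp add: scl_simps)
  next
    case False
    \<comment> \<open>The reverse inequality is \<open>sc_le\<close> for the inverse scalar.\<close>
    have "inf_conv r (scl (1 / a) (scl a x)) \<le> norm (1 / a) * inf_conv r (scl a x)"
      by (rule sc_le) (use False in simp)
    then have "norm a * inf_conv r x \<le> inf_conv r (scl a x)"
      using False by (simp add: scl_simps norm_divide field_simps)
    with sc_le[OF False, of x] show ?thesis by simp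
  qed
qed

end

lemma seminorm_over_norm: "seminorm_over scl norm"
  by (rule seminorm_overI) (auto simp: norm_scl norm_triangle_ineq)

lemma seminorm_over_max:
  assumes "seminorm_over scl p" "seminorm_over scl q" "c > 0" "d > 0"
  shows "seminorm_over scl (\<lambda>x. max (p x / c) (q x / d))"
proof (rule seminorm_overI)
  note A = assms[unfolded seminorm_over_def]
  show "0 \<le> max (p x / c) (q x / d)" for x using A by (simp add: le_max_iff_disj)
  show "max (p (x + y) / c) (q (x + y) / d) \<le> max (p x / c) (q x / d) + max (p y / c) (q y / d)" for x y
  proof -
    have "p (x + y) / c \<le> p x / c + p y / c" "q (x + y) / d \<le> q x / d + q y / d"
      using A by (simp_all add: add_divide_distrib[symmetric] divide_right_mono)
    then show ?thesis by linarith
  qed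
  show "max (p (scl k x) / c) (q (scl k x) / d) = norm k * max (p x / c) (q x / d)" for k x
    using A by (simp add: max_mult_distrib_left)
qed

text \<open>Local convexity: with a sequence \<open>W (Suc k) + W (Suc k) \<subseteq> W k\<close> of neighbourhoods and balls \<open>p k x < d k\<close>,
  \<open>norm x \<le> Suc k\<close> contained in \<open>W (Suc k)\<close>, the seminorm is the infimal convolution of the gauges of these balls.\<close>

theorem gamma_nbhd_mixed_seminorm:
  assumes U: "openin \<gamma> U" "0 \<in> U"
  obtains q where "mixed_seminorm q" "{x. q x < 1} \<subseteq> U"
proof -
  define Q where "Q = (\<lambda>V. openin \<gamma> V \<and> (0::'a) \<in> V)"
  have half: "\<exists>W. Q W \<and> (\<forall>x\<in>W. \<forall>y\<in>W. x + y \<in> V)" if V: "Q V" for V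
  proof -
    have "continuous_map (prod_topology \<gamma> \<gamma>) \<gamma> (\<lambda>(x, y). x + y)"
      using mix1(1) unfolding linear_topology_def by auto
    then have op: "openin (prod_topology \<gamma> \<gamma>) {z \<in> topspace (prod_topology \<gamma> \<gamma>). (case z of (x, y) \<Rightarrow> x + y) \<in> V}"
      using V unfolding continuous_map_def Q_def by blast
    have mem: "(0, 0) \<in> {z \<in> topspace (prod_topology \<gamma> \<gamma>). (case z of (x, y) \<Rightarrow> x + y) \<in> V}"
      using V unfolding Q_def by simp
    obtain A B where AB: "openin \<gamma> A" "openin \<gamma> B" "0 \<in> A" "0 \<in> B"
      "A \<times> B \<subseteq> {z \<in> topspace (prod_topology \<gamma> \<gamma>). (case z of (x, y) \<Rightarrow> x + y) \<in> V}"
      using openin_prod_topology_alt[THEN iffD1, rule_format, OF op mem] by (elim exE conjE)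
    then have "Q (A \<inter> B)" by (auto simp: Q_def)
    moreover have "x + y \<in> V" if "x \<in> A \<inter> B" "y \<in> A \<inter> B" for x y using AB(5) that by auto
    ultimately show ?thesis by blast
  qed
  obtain W where W: "\<And>n. Q (W n)" "W 0 = U" "\<And>n x y. x \<in> W (Suc n) \<Longrightarrow> y \<in> W (Suc n) \<Longrightarrow> x + y \<in> W n"
  proof -
    have "\<exists>W. \<forall>n. (Q (W n) \<and> (n = 0 \<longrightarrow> W n = U)) \<and> (\<forall>x\<in>W (Suc n). \<forall>y\<in>W (Suc n). x + y \<in> W n)"
      by (rule dependent_nat_choice) (use U half in \<open>auto simp: Q_def\<close>)
    then show ?thesis using that by blast
  qed
  have "\<exists>p d. p \<in> P \<and> d > 0 \<and> (\<forall>x. norm x \<le> real (Suc k) \<and> p x < d \<longrightarrow> x \<in> W (Suc k))" for k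
  proof -
    let ?B = "cball 0 (real (Suc k)) :: 'a set"
    have "openin (subtopology \<gamma> ?B) (W (Suc k) \<inter> ?B)"
      using W(1)[of "Suc k"] unfolding Q_def by (auto simp: openin_subtopology)
    then have "openin (subtopology \<tau> ?B) (W (Suc k) \<inter> ?B)" using mix1(2)[of ?B] by simp
    then obtain T where T: "openin \<tau> T" "W (Suc k) \<inter> ?B = T \<inter> ?B" unfolding openin_subtopology by blast
    have "0 \<in> W (Suc k) \<inter> ?B" using W(1)[of "Suc k"] unfolding Q_def by simp
    then have "0 \<in> T" using T(2) by blast
    then obtain p e where p: "p \<in> P" "e > 0" "{y. p (y - 0) < e} \<subseteq> T"
      using T(1) unfolding openin_tau by blast
    have "x \<in> W (Suc k)" if "norm x \<le> real (Suc k) \<and> p x < e" for x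
    proof -
      have "x \<in> T \<inter> ?B" using p(3) that by auto
      then show ?thesis using T(2) by blast
    qed
    then show ?thesis using p(1,2) by blast
  qed
  then obtain p d where pd: "\<And>k. p k \<in> P" "\<And>k. d k > 0"
    "\<And>k x. norm x \<le> real (Suc k) \<Longrightarrow> p k x < d k \<Longrightarrow> x \<in> W (Suc k)"
    by metis
  define r where "r = (\<lambda>k x. max (p k x / d k) (norm x / real (Suc k)))"
  have r: "seminorm_over scl (r k)" for k
    unfolding r_def by (intro seminorm_over_max P_seminorm pd seminorm_over_norm) simp
  have r1: "x \<in> W (Suc k)" if "r k x < 1" for k x
    using that pd(2)[of k] pd(3)[of x k] unfolding r_def by (simp add: field_simps)
  have "mixed_seminorm (inf_conv r)" unfolding mixed_seminorm_def
  proof (intro conjI allI impI seminorm_over_inf_conv r)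
    fix M and e :: real assume e: "e > 0"
    \<comment> \<open>On the ball of radius \<open>M\<close> the norm part of \<open>r k\<close> is
      below \<open>e\<close> once \<open>k\<close> is large, so that \<open>p k\<close> alone
      controls \<open>inf_conv r\<close>. This is why the radii \<open>Suc k\<close> grow.\<close>
    obtain k where k: "real k > M / e" using reals_Archimedean2 by blast
    have "inf_conv r x < e" if "norm x \<le> M \<and> p k x < d k * e" for x
    proof -
      have "inf_conv r x \<le> r k x" by (rule inf_conv_le1[OF r])
      also have "\<dots> < e"
      proof -
        have "p k x / d k < e" using that pd(2)[of k] by (simp add: field_simps)
        moreover have "norm x / real (Suc k) < e"
        proof -
          have "M < e * real k" using k e by (simp add: field_simps)
          also have "\<dots> \<le> e * real (Suc k)" using e by simp
          finally show ?thesis using that by (simp add: field_simps)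
        qed
        ultimately show ?thesis unfolding r_def by simp
      qed
      finally show ?thesis .
    qed
    then show "\<exists>p\<in>P. \<exists>d>0. \<forall>x. norm x \<le> M \<and> p x < d \<longrightarrow> inf_conv r x < e"
      using pd(1,2) e by (intro bexI[of _ "p k"] exI[of _ "d k * e"]) auto
  qed
  moreover have "{x. inf_conv r x < 1} \<subseteq> U"
  proof clarify
    fix x assume "inf_conv r x < 1"
    then obtain N y where y: "(\<Sum>k<N. y k) = x" "(\<Sum>k<N. r k (y k)) < 1" using inf_conv_less[where r=r and x=x and c=1, OF r] by blast
    have "y i \<in> W (Suc i)" if "i < N" for i
    proof (rule r1)
      have "r i (y i) \<le> (\<Sum>k<N. r k (y k))"
        by (rule member_le_sum) (use that sn_nonneg[where r=r, OF r] in auto)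
      then show "r i (y i) < 1" using y(2) by simp
    qed
    then have "(\<Sum>i<N. y i) \<in> W 0" using W by (intro sum_mem_halving_sequence) (auto simp: Q_def)
    then show "x \<in> U" using y(1) W(2) by simp
  qed
  ultimately show ?thesis using that by blast
qed

text \<open>Sequences match \<open>bi_equicontinuous\<close>, itself a condition on bounded
  \<open>\<tau>\<close>-convergent sequences; so the class is stable under composition with the
  bounded operators of a bi-equicontinuous family.\<close>

definition test_functional :: "('a \<Rightarrow> real) \<Rightarrow> bool" where
  "test_functional \<psi> \<longleftrightarrow> linear \<psi> \<and>
     (\<forall>x l. bounded (range x) \<and> limitin \<tau> x l sequentially \<longrightarrow> (\<lambda>k. \<psi> (x k)) \<longlonglongrightarrow> \<psi> l)"

lemma test_functional_linear: "test_functional \<psi> \<Longrightarrow> linear \<psi>"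
  unfolding test_functional_def by blast

lemma test_functionalI:
  assumes q: "mixed_seminorm q" and \<phi>: "linear \<phi>" "\<And>x. \<bar>\<phi> x\<bar> \<le> q x"
  shows "test_functional \<phi>"
  unfolding test_functional_def
proof (intro conjI allI impI \<phi>(1))
  fix x l assume "bounded (range x) \<and> limitin \<tau> x l sequentially"
  then have "(\<lambda>k. q (x k - l)) \<longlonglongrightarrow> 0" using mixed_seminorm_tendsto[OF q] by blast
  then have "(\<lambda>k. \<phi> (x k - l)) \<longlonglongrightarrow> 0" by (rule Lim_null_comparison[rotated]) (use \<phi>(2) in auto)
  then have "(\<lambda>k. \<phi> (x k - l) + \<phi> l) \<longlonglongrightarrow> 0 + \<phi> l" by (intro tendsto_intros)
  then show "(\<lambda>k. \<phi> (x k)) \<longlonglongrightarrow> \<phi> l" by (simp add: linear_diff[OF \<phi>(1)])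
qed

lemma test_functional_norming:
  assumes q: "mixed_seminorm q"
  obtains \<phi> where "test_functional \<phi>" "\<And>x. \<bar>\<phi> x\<bar> \<le> q x" "\<phi> x0 = q x0"
proof -
  obtain \<phi> where \<phi>: "linear \<phi>" "\<And>x. \<bar>\<phi> x\<bar> \<le> q x" "\<phi> x0 = q x0"
    using Hahn_Banach_seminorm[OF mixed_seminorm_real[OF q]] by blast
  with test_functionalI[OF q \<phi>(1,2)] show ?thesis using that by blast
qed

text \<open>The premise also grants a \<open>p\<close> in \<open>P\<close> that dominates the
  functional, because composition with \<open>C\<close> is handled for such functionals
  (\<open>test_functional_C\<close>).\<close>

lemma test_functional_eqI:
  assumes "\<And>p \<psi>. p \<in> P \<Longrightarrow> test_functional \<psi> \<Longrightarrow> (\<And>x. \<bar>\<psi> x\<bar> \<le> p x) \<Longrightarrow> \<psi> x = \<psi> y"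
  shows "x = y"
proof -
  have "p (x - y) = 0" if p: "p \<in> P" for p
  proof -
    obtain \<phi> where \<phi>: "test_functional \<phi>" "\<And>x. \<bar>\<phi> x\<bar> \<le> p x" "\<phi> (x - y) = p (x - y)"
      using test_functional_norming[OF mixed_seminorm_P[OF p]] by blast
    then show ?thesis using assms[OF p \<phi>(1,2)] linear_diff[OF test_functional_linear[OF \<phi>(1)], of x y] by simp
  qed
  then have "x - y = 0" by (rule eq_0_if_P)
  then show ?thesis by simp
qed

lemma limitin_tau_norm:
  assumes "(f \<longlongrightarrow> l) F"
  shows "limitin \<tau> f l F"
  unfolding limitin_tau_iff
proof
  fix p assume p: "p \<in> P"
  have "((\<lambda>i. norm (f i - l)) \<longlongrightarrow> 0) F" using assms by (simp add: LIM_zero tendsto_norm_zero)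
  then show "((\<lambda>i. p (f i - l)) \<longlongrightarrow> 0) F"
    by (rule Lim_null_comparison[rotated]) (use P_le_norm[OF p] real_seminormD(5)[OF P_real[OF p]] in auto)
qed

text \<open>Otherwise there would be vectors \<open>y k\<close> with value 1 that tend to 0 in norm,
  hence form a bounded sequence converging to 0 in \<open>\<tau>\<close>.\<close>

lemma test_functional_bounded:
  assumes "test_functional \<psi>"
  obtains K where "K > 0" "\<And>x. \<bar>\<psi> x\<bar> \<le> K * norm x"
proof (rule ccontr)
  assume "\<not> thesis"
  have "\<exists>x. \<bar>\<psi> x\<bar> > real (Suc k) * norm x" for k
  proof (rule ccontr)
    assume "\<not> ?thesis"
    then have "\<bar>\<psi> x\<bar> \<le> real (Suc k) * norm x" for x by (simp add: not_less)
    then show False using that[of "real (Suc k)"] \<open>\<not> thesis\<close> by simp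
  qed
  then obtain x where x: "\<And>k. \<bar>\<psi> (x k)\<bar> > real (Suc k) * norm (x k)" by metis
  note lin = test_functional_linear[OF assms]
  have pos: "\<bar>\<psi> (x k)\<bar> > 0" for k
    by (rule le_less_trans[OF _ x[of k]]) simp
  define y where "y = (\<lambda>k. (1 / \<psi> (x k)) *\<^sub>R x k)"
  have \<psi>y: "\<psi> (y k) = 1" for k using pos[of k] by (simp add: y_def linear_scale[OF lin])
  have ny: "norm (y k) \<le> 1 / real (Suc k)" for k
    using x[of k] pos[of k] by (simp add: y_def field_simps)
  have y0: "y \<longlonglongrightarrow> 0"
    by (rule Lim_null_comparison[OF _ LIMSEQ_inverse_real_of_nat]) (use ny in \<open>auto simp: inverse_eq_divide\<close>)
  then have "bounded (range y)" using convergent_imp_bounded by blast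
  then have "(\<lambda>k. \<psi> (y k)) \<longlonglongrightarrow> \<psi> 0"
    using assms limitin_tau_norm[OF y0] unfolding test_functional_def by blast
  then have "(\<lambda>k. 1) \<longlonglongrightarrow> (0::real)" by (simp add: \<psi>y linear_0[OF lin])
  then show False by (simp add: tendsto_const_iff)
qed

text \<open>Test functionals respect limits of bounded sequences only, so the boundedness of
  \<open>f\<close> along convergent sequences of times is a premise of its own.\<close>

lemma test_functional_continuous_on:
  fixes f :: "real \<Rightarrow> 'a"
  assumes "test_functional \<psi>" "continuous_map (top_of_set T) \<tau> f" 
    and "\<And>t x. t \<in> T \<Longrightarrow> (\<And>k. x k \<in> T) \<Longrightarrow> x \<longlonglongrightarrow> t \<Longrightarrow> bounded (range (\<lambda>k. f (x k)))"
  shows "continuous_on T (\<lambda>t. \<psi> (f t))"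
  unfolding continuous_on_sequentially
proof (intro ballI allI impI)
  fix x t assume t: "t \<in> T" and x: "(\<forall>k. x k \<in> T) \<and> x \<longlonglongrightarrow> t"
  have "limitin \<tau> (\<lambda>k. f (x k)) (f t) sequentially" unfolding limitin_def
  proof (intro conjI allI impI)
    fix U assume U: "openin \<tau> U \<and> f t \<in> U"
    then have "openin (top_of_set T) {s \<in> T. f s \<in> U}" using assms(2) unfolding continuous_map_def by auto
    then obtain V where V: "open V" "{s \<in> T. f s \<in> U} = T \<inter> V" unfolding openin_open by blast
    have "t \<in> V" using V(2) U t by blast
    then have "\<forall>\<^sub>F k in sequentially. x k \<in> V" using x V(1) topological_tendstoD by blast
    then show "\<forall>\<^sub>F k in sequentially. f (x k) \<in> U" by eventually_elim (use V(2) x in blast)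
  qed simp
  moreover have "bounded (range (\<lambda>k. f (x k)))" using assms(3)[OF t] x by blast
  ultimately show "((\<lambda>t. \<psi> (f t)) \<circ> x) \<longlonglongrightarrow> \<psi> (f t)"
    using assms(1) unfolding test_functional_def comp_def by blast
qed

end

section \<open>Integrals in the mixed topology\<close>

lemma eventually_riemann_filter:
  "eventually Q (riemann_filter a b) \<longleftrightarrow>
     (\<exists>\<delta>>0. \<forall>D. D tagged_division_of {a..b} \<and> (\<lambda>x. ball x \<delta>) fine D \<longrightarrow> Q D)"
proof -
  have "eventually Q (riemann_filter a b) \<longleftrightarrow>
     (\<exists>\<delta>\<in>{0<..}. eventually Q (principal {p. p tagged_division_of {a..b} \<and> (\<lambda>x. ball x \<delta>) fine p}))"
    unfolding riemann_filter_def
  proof (rule eventually_INF_base)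
    fix d e :: real assume "d \<in> {0<..}" "e \<in> {0<..}"
    moreover have "(\<lambda>x. ball x (min d e)) fine D \<Longrightarrow> (\<lambda>x. ball x d) fine D \<and> (\<lambda>x. ball x e) fine D" for D :: "(real \<times> real set) set"
      unfolding fine_def by fastforce
    ultimately show "\<exists>x\<in>{0<..}. principal {p. p tagged_division_of {a..b} \<and> (\<lambda>y. ball y x) fine p}
       \<le> inf (principal {p. p tagged_division_of {a..b} \<and> (\<lambda>x. ball x d) fine p}) (principal {p. p tagged_division_of {a..b} \<and> (\<lambda>x. ball x e) fine p})"
      by (intro bexI[of _ "min d e"]) auto
  qed auto
  then show ?thesis by (auto simp: eventually_principal)
qed

lemma ex_fine_tagged_division:
  fixes a b :: real
  assumes "\<delta> > 0"
  obtains D where "D tagged_division_of {a..b}" "(\<lambda>x. ball x \<delta>) fine D"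
  using fine_division_exists_real[of "\<lambda>x. ball x \<delta>" a b] assms by (auto simp: gauge_def)

text \<open>Fine divisions exist for every radius; this is what makes limits of Riemann sums
  unique.\<close>

lemma riemann_filter_neq_bot: "riemann_filter a b \<noteq> bot"
proof -
  have "\<not> eventually (\<lambda>_. False) (riemann_filter a b)"
    unfolding eventually_riemann_filter using ex_fine_tagged_division[of _ a b] by metis
  then show ?thesis by (simp add: trivial_limit_def)
qed

lemma sum_content_tagged_division:
  fixes a b :: real
  assumes "D tagged_division_of {a..b}" "a \<le> b"
  shows "(\<Sum>(x, k)\<in>D. measure lborel k) = b - a"
  using additive_content_tagged_division[of D a b] assms by simp

text \<open>The bound depends on \<open>g\<close> only through the pair \<open>\<delta>\<close>,
  \<open>e\<close>. It is therefore uniform over all functionals dominated by one seminorm, which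
  turns scalar estimates into estimates for vectors.\<close>

lemma riemann_sum_error:
  fixes g :: "real \<Rightarrow> real"
  assumes g: "continuous_on {a..b} g" and ab: "a \<le> b"
    and m: "\<And>s t. s \<in> {a..b} \<Longrightarrow> t \<in> {a..b} \<Longrightarrow> \<bar>s - t\<bar> < \<delta> \<Longrightarrow> \<bar>g s - g t\<bar> \<le> e"
    and D: "D tagged_division_of {a..b}" "(\<lambda>x. ball x \<delta>) fine D"
  shows "\<bar>(\<Sum>(x, k)\<in>D. measure lborel k * g x) - integral {a..b} g\<bar> \<le> e * (b - a)"
proof -
  have gi: "g integrable_on {a..b}" using g by (rule integrable_continuous_real)
  have "integral {a..b} g = (\<Sum>(x, k)\<in>D. integral k g)"
    using integral_combine_tagged_division_topdown[of g a b D] gi D(1) by simp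
  then have "\<bar>(\<Sum>(x, k)\<in>D. measure lborel k * g x) - integral {a..b} g\<bar> = \<bar>\<Sum>(x, k)\<in>D. measure lborel k * g x - integral k g\<bar>"
    by (simp add: case_prod_unfold sum_subtractf)
  also have "\<dots> \<le> (\<Sum>(x, k)\<in>D. \<bar>measure lborel k * g x - integral k g\<bar>)"
    by (rule order.trans[OF sum_abs]) (simp add: case_prod_unfold)
  also have "\<dots> \<le> (\<Sum>(x, k)\<in>D. e * measure lborel k)"
  proof (rule sum_mono, clarify)
    fix x k assume xk: "(x, k) \<in> D"
    obtain c d where k: "k = {c..d}" using tagged_division_ofD(4)[OF D(1) xk] by auto
    have x: "x \<in> k" "k \<subseteq> {a..b}" using tagged_division_ofD(2,3)[OF D(1) xk] by auto
    have kb: "k \<subseteq> ball x \<delta>" using D(2) xk unfolding fine_def by auto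
    have gk: "continuous_on {c..d} g" using g x(2) k continuous_on_subset by blast
    have hi: "((\<lambda>t. g x - g t) has_integral (measure lborel k * g x - integral k g)) (cbox c d)"
      unfolding k using has_integral_diff[OF has_integral_const_real[of "g x" c d] integrable_integral[OF integrable_continuous_real[OF gk]]]
      by simp
    have bnd: "norm (g x - g t) \<le> e" if t: "t \<in> cbox c d" for t
    proof -
      have "\<bar>x - t\<bar> < \<delta>" using t kb k by (auto simp: dist_real_def)
      then show ?thesis using m[of x t] x t k by auto
    qed
    have "x \<in> cbox c d" using x k by simp
    then have "0 \<le> e" using bnd[of x] by simp
    from has_integral_bound[OF this hi bnd]
    have "norm (measure lborel k * g x - integral k g) \<le> e * measure lborel (cbox c d)" .
    then show "\<bar>measure lborel k * g x - integral k g\<bar> \<le> e * measure lborel k" using k by simp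
  qed
  also have "\<dots> = e * (b - a)"
    using sum_content_tagged_division[OF D(1) ab] by (simp add: case_prod_unfold sum_distrib_left[symmetric])
  finally show ?thesis .
qed

lemma riemann_sum_tendsto:
  fixes g :: "real \<Rightarrow> real"
  assumes g: "continuous_on {a..b} g" and ab: "a \<le> b"
  shows "((\<lambda>D. \<Sum>(x, k)\<in>D. measure lborel k * g x) \<longlongrightarrow> integral {a..b} g) (riemann_filter a b)"
proof (rule tendstoI)
  fix e :: real assume e: "e > 0"
  define e' where "e' = e / (2 * (b - a + 1))"
  have e': "e' > 0" unfolding e'_def using e ab by simp
  have "uniformly_continuous_on {a..b} g" by (rule compact_uniformly_continuous[OF g]) simp
  then obtain \<delta> where d: "\<delta> > 0" "\<And>s t. s \<in> {a..b} \<Longrightarrow> t \<in> {a..b} \<Longrightarrow> dist t s < \<delta> \<Longrightarrow> dist (g t) (g s) < e'"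
    using e' unfolding uniformly_continuous_on_def by metis
  have "dist (\<Sum>(x, k)\<in>D. measure lborel k * g x) (integral {a..b} g) < e"
    if D: "D tagged_division_of {a..b}" "(\<lambda>x. ball x \<delta>) fine D" for D
  proof -
    have "\<bar>(\<Sum>(x, k)\<in>D. measure lborel k * g x) - integral {a..b} g\<bar> \<le> e' * (b - a)"
    proof (rule riemann_sum_error[OF g ab _ D])
      fix s t assume "s \<in> {a..b}" "t \<in> {a..b}" "\<bar>s - t\<bar> < \<delta>"
      then show "\<bar>g s - g t\<bar> \<le> e'" using d(2)[of t s] by (simp add: dist_real_def)
    qed
    also have "\<dots> < e' * (2 * (b - a + 1))" using e' ab by (intro mult_strict_left_mono) auto
    also have "\<dots> = e" unfolding e'_def using ab by simp
    finally show ?thesis by (simp add: dist_real_def)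
  qed
  then show "\<forall>\<^sub>F D in riemann_filter a b. dist (\<Sum>(x, k)\<in>D. measure lborel k * g x) (integral {a..b} g) < e"
    unfolding eventually_riemann_filter using d(1) by blast
qed

section \<open>Existence of Riemann and improper integrals\<close>

context saks
begin

text \<open>On the differences of a bounded sequence every mixed seminorm is controlled by a single
  member of \<open>P\<close>; so Cauchy with respect to \<open>P\<close> implies Cauchy for
  \<open>\<gamma>\<close>, and sequential completeness applies.\<close>

lemma gamma_convergent:
  assumes b: "bounded (range x)" and c: "\<And>p e. p \<in> P \<Longrightarrow> e > 0 \<Longrightarrow> \<exists>N. \<forall>i\<ge>N. \<forall>j\<ge>N. p (x i - x j) < e"
  obtains l where "limitin \<gamma> x l sequentially"
proof -
  obtain B where B: "\<And>i. norm (x i) \<le> B" using b unfolding bounded_iff by auto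
  have "Cauchy_seq_in \<gamma> x" unfolding Cauchy_seq_in_def
  proof (intro allI impI)
    fix U assume U: "openin \<gamma> U \<and> 0 \<in> U"
    then obtain q where q: "mixed_seminorm q" "{x. q x < 1} \<subseteq> U" using gamma_nbhd_mixed_seminorm by blast
    obtain p d where p: "p \<in> P" "d > 0" "\<And>z. norm z \<le> B + B \<Longrightarrow> p z < d \<Longrightarrow> q z < 1"
      using mixed_seminormE[OF q(1) zero_less_one] by blast
    obtain N where N: "\<forall>i\<ge>N. \<forall>j\<ge>N. p (x i - x j) < d" using c[OF p(1,2)] by blast
    have "x i - x j \<in> U" if "i \<ge> N" "j \<ge> N" for i j
    proof -
      have "norm (x i - x j) \<le> B + B" using B[of i] B[of j] norm_triangle_ineq4[of "x i" "x j"] by simp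
      then show ?thesis using p(3) N that q(2) by blast
    qed
    then show "\<exists>N. \<forall>i\<ge>N. \<forall>j\<ge>N. x i - x j \<in> U" by blast
  qed
  then show ?thesis using sc that unfolding seq_complete_def by blast
qed

lemma limitin_gamma_unique:
  "limitin \<gamma> f l F \<Longrightarrow> limitin \<gamma> f m F \<Longrightarrow> F \<noteq> bot \<Longrightarrow> l = m"
  using limitin_Hausdorff_unique[OF _ _ _ Hausdorff_gamma] by blast

text \<open>A Lebesgue number of a cover of the compact interval, with the seminorm in place of a
  metric.\<close>

lemma tau_uniformly_continuous:
  fixes f :: "real \<Rightarrow> 'a"
  assumes f: "continuous_map (top_of_set {a..b}) \<tau> f" and p: "p \<in> P" and e: "e > 0"
  obtains \<delta> where "\<delta> > 0" "\<And>s t. s \<in> {a..b} \<Longrightarrow> t \<in> {a..b} \<Longrightarrow> \<bar>s - t\<bar> < \<delta> \<Longrightarrow> p (f s - f t) \<le> e"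
proof -
  note Q = real_seminormD[OF P_real[OF p]]
  have "\<exists>V. open V \<and> t \<in> V \<and> (\<forall>s\<in>V \<inter> {a..b}. p (f s - f t) < e / 2)" if t: "t \<in> {a..b}" for t
  proof -
    have "openin (top_of_set {a..b}) {s \<in> {a..b}. f s \<in> {y. p (y - f t) < e / 2}}"
      using f openin_tau_ball[OF p, of "f t" "e / 2"] unfolding continuous_map_def by auto
    then obtain V where V: "open V" "{s \<in> {a..b}. f s \<in> {y. p (y - f t) < e / 2}} = {a..b} \<inter> V"
      unfolding openin_open by blast
    have "t \<in> {s \<in> {a..b}. f s \<in> {y. p (y - f t) < e / 2}}" using t e Q(3) by simp
    then show ?thesis using V by blast
  qed
  then obtain V where V: "\<And>t. t \<in> {a..b} \<Longrightarrow> open (V t) \<and> t \<in> V t \<and> (\<forall>s\<in>V t \<inter> {a..b}. p (f s - f t) < e / 2)"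
    by metis
  have "{a..b} \<subseteq> \<Union> (V ` {a..b})" using V by blast
  moreover have "\<And>G. G \<in> V ` {a..b} \<Longrightarrow> open G" using V by blast
  ultimately obtain \<delta> where d: "\<delta> > 0" "\<And>t. t \<in> {a..b} \<Longrightarrow> \<exists>G\<in>V ` {a..b}. ball t \<delta> \<subseteq> G"
    using Heine_Borel_lemma[OF compact_Icc, of a b "V ` {a..b}"] by metis
  have "p (f s - f t) \<le> e" if st: "s \<in> {a..b}" "t \<in> {a..b}" "\<bar>s - t\<bar> < \<delta>" for s t
  proof -
    obtain u where u: "u \<in> {a..b}" "ball s \<delta> \<subseteq> V u" using d(2)[OF st(1)] by blast
    have "s \<in> V u" "t \<in> V u" using u(2) st(3) d(1) by (auto simp: dist_real_def subset_iff)
    then have "p (f s - f u) < e / 2" "p (f t - f u) < e / 2" using V[OF u(1)] st by blast+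
    then show ?thesis using Q(6)[of "f s - f u" "f t - f u"] by simp
  qed
  with d(1) that show ?thesis by blast
qed

lemma test_functional_riemann_sum:
  assumes "linear \<psi>"
  shows "\<psi> (\<Sum>(x, k)\<in>D. measure lborel k *\<^sub>R f x) = (\<Sum>(x, k)\<in>D. measure lborel k * \<psi> (f x))"
  by (simp add: linear_sum[OF assms] case_prod_unfold linear_scale[OF assms])

lemma test_functional_continuous_on_bounded:
  fixes f :: "real \<Rightarrow> 'a"
  assumes "test_functional \<psi>" "continuous_map (top_of_set T) \<tau> f" "\<And>t. t \<in> T \<Longrightarrow> norm (f t) \<le> B"
  shows "continuous_on T (\<lambda>t. \<psi> (f t))"
  by (rule test_functional_continuous_on[OF assms(1,2)]) (use assms(3) in \<open>auto simp: bounded_iff\<close>)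

theorem riemann_integral_exists:
  fixes f :: "real \<Rightarrow> 'a"
  assumes ab: "a \<le> b" and f: "continuous_map (top_of_set {a..b}) \<tau> f" and B: "\<And>t. t \<in> {a..b} \<Longrightarrow> norm (f t) \<le> B"
  obtains I where "has_riemann_integral \<gamma> f I a b" "\<And>\<psi>. test_functional \<psi> \<Longrightarrow> \<psi> I = integral {a..b} (\<lambda>t. \<psi> (f t))"
proof -
  define rs :: "(real \<times> real set) set \<Rightarrow> 'a" where "rs = (\<lambda>D. \<Sum>(x, k)\<in>D. measure lborel k *\<^sub>R f x)"
  have rsb: "norm (rs D) \<le> B * (b - a)" if D: "D tagged_division_of {a..b}" for D
  proof -
    have "norm (rs D) \<le> (\<Sum>(x, k)\<in>D. norm (measure lborel k *\<^sub>R f x))"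
      unfolding rs_def case_prod_unfold by (rule norm_sum)
    also have "\<dots> \<le> (\<Sum>(x, k)\<in>D. B * measure lborel k)"
    proof (rule sum_mono, clarify)
      fix x k assume "(x, k) \<in> D"
      then have "x \<in> {a..b}" using tagged_division_ofD(2,3)[OF D] by blast
      then show "norm (measure lborel k *\<^sub>R f x) \<le> B * measure lborel k" using B[of x] by (simp add: mult.commute mult_right_mono)
    qed
    also have "\<dots> = B * (b - a)"
      using sum_content_tagged_division[OF D ab] by (simp add: case_prod_unfold sum_distrib_left[symmetric])
    finally show ?thesis .
  qed
  have cont: "continuous_on {a..b} (\<lambda>t. \<psi> (f t))" if "test_functional \<psi>" for \<psi>
    by (rule test_functional_continuous_on_bounded[OF that f B])
  \<comment> \<open>Here \<open>\<delta>\<close> depends on \<open>p\<close> and \<open>e\<close>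
    but not on the functional; \<open>test_functional_norming\<close> then recovers estimates of
    \<open>p\<close> itself.\<close>
  have err: "\<exists>\<delta>>0. \<forall>D \<phi>. D tagged_division_of {a..b} \<and> (\<lambda>x. ball x \<delta>) fine D \<and> test_functional \<phi> \<and> (\<forall>x. \<bar>\<phi> x\<bar> \<le> p x)
      \<longrightarrow> \<bar>\<phi> (rs D) - integral {a..b} (\<lambda>t. \<phi> (f t))\<bar> \<le> e" if p: "p \<in> P" and e: "e > 0" for p e
  proof -
    define e' where "e' = e / (b - a + 1)"
    have e': "e' > 0" "e' * (b - a) \<le> e" unfolding e'_def using e ab by (auto simp: field_simps)
    obtain \<delta> where d: "\<delta> > 0" "\<And>s t. s \<in> {a..b} \<Longrightarrow> t \<in> {a..b} \<Longrightarrow> \<bar>s - t\<bar> < \<delta> \<Longrightarrow> p (f s - f t) \<le> e'"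
      using tau_uniformly_continuous[OF f p e'(1)] by blast
    have "\<bar>\<phi> (rs D) - integral {a..b} (\<lambda>t. \<phi> (f t))\<bar> \<le> e"
      if D: "D tagged_division_of {a..b}" "(\<lambda>x. ball x \<delta>) fine D" and \<phi>: "test_functional \<phi>" "\<forall>x. \<bar>\<phi> x\<bar> \<le> p x" for D \<phi>
    proof -
      note lin = test_functional_linear[OF \<phi>(1)]
      have "\<bar>(\<Sum>(x, k)\<in>D. measure lborel k * \<phi> (f x)) - integral {a..b} (\<lambda>t. \<phi> (f t))\<bar> \<le> e' * (b - a)"
      proof (rule riemann_sum_error[OF cont[OF \<phi>(1)] ab _ D])
        fix s t assume "s \<in> {a..b}" "t \<in> {a..b}" "\<bar>s - t\<bar> < \<delta>"
        then have "p (f s - f t) \<le> e'" by (rule d(2))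
        moreover have "\<bar>\<phi> (f s - f t)\<bar> \<le> p (f s - f t)" using \<phi>(2) by blast
        ultimately show "\<bar>\<phi> (f s) - \<phi> (f t)\<bar> \<le> e'" by (simp add: linear_diff[OF lin])
      qed
      then show ?thesis unfolding rs_def test_functional_riemann_sum[OF lin] using e'(2) by linarith
    qed
    then show ?thesis using d(1) by blast
  qed
  \<comment> \<open>Completeness is available for sequences, so the limit is found along one
    sequence of divisions; convergence along the whole filter follows afterwards from
    \<open>err\<close>.\<close>
  obtain D where D: "\<And>k. D k tagged_division_of {a..b}" "\<And>k. (\<lambda>x. ball x (1 / real (Suc k))) fine D k"
  proof -
    have "\<exists>D. D tagged_division_of {a..b} \<and> (\<lambda>x. ball x (1 / real (Suc k))) fine D" for k
    proof -
      have k0: "1 / real (Suc k) > 0" by simp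
      obtain D where "D tagged_division_of {a..b}" "(\<lambda>x. ball x (1 / real (Suc k))) fine D"
        by (rule ex_fine_tagged_division[OF k0])
      then show ?thesis by (intro exI conjI)
    qed
    then show ?thesis using that by metis
  qed
  have fine_D: "\<exists>N. \<forall>k\<ge>N. (\<lambda>x. ball x \<delta>) fine D k" if "\<delta> > 0" for \<delta>
  proof -
    obtain N where N: "1 / real (Suc N) < \<delta>" using nat_approx_posE[OF \<open>\<delta> > 0\<close>] by blast
    have "(\<lambda>x. ball x \<delta>) fine D k" if "k \<ge> N" for k
    proof -
      have "1 / real (Suc k) \<le> 1 / real (Suc N)" using that by (simp add: frac_le)
      then have "ball x (1 / real (Suc k)) \<subseteq> ball x \<delta>" for x :: real using N by (intro subset_ball) simp
      then show ?thesis using D(2)[of k] unfolding fine_def by fast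
    qed
    then show ?thesis by blast
  qed
  have bd: "bounded (range (\<lambda>k. rs (D k)))" unfolding bounded_iff using rsb D(1) by blast
  obtain I where I: "limitin \<gamma> (\<lambda>k. rs (D k)) I sequentially"
  proof (rule gamma_convergent[OF bd])
    fix p and e :: real assume p: "p \<in> P" and e: "e > 0"
    obtain \<delta> where d: "\<delta> > 0" and d': "\<forall>D \<phi>. D tagged_division_of {a..b} \<and> (\<lambda>x. ball x \<delta>) fine D \<and> test_functional \<phi> \<and> (\<forall>x. \<bar>\<phi> x\<bar> \<le> p x)
      \<longrightarrow> \<bar>\<phi> (rs D) - integral {a..b} (\<lambda>t. \<phi> (f t))\<bar> \<le> e / 3"
      using err[OF p, of "e / 3"] e by auto
    obtain N where N: "\<forall>k\<ge>N. (\<lambda>x. ball x \<delta>) fine D k" using fine_D[OF d] by blast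
    have "p (rs (D i) - rs (D j)) < e" if ij: "i \<ge> N" "j \<ge> N" for i j
    proof -
      obtain \<phi> where \<phi>: "test_functional \<phi>" "\<And>x. \<bar>\<phi> x\<bar> \<le> p x" "\<phi> (rs (D i) - rs (D j)) = p (rs (D i) - rs (D j))"
        using test_functional_norming[OF mixed_seminorm_P[OF p]] by blast
      have "\<bar>\<phi> (rs (D i)) - integral {a..b} (\<lambda>t. \<phi> (f t))\<bar> \<le> e / 3" "\<bar>\<phi> (rs (D j)) - integral {a..b} (\<lambda>t. \<phi> (f t))\<bar> \<le> e / 3"
        using d' D(1) N ij \<phi>(1,2) by blast+
      then show ?thesis using \<phi>(3) e linear_diff[OF test_functional_linear[OF \<phi>(1)], of "rs (D i)" "rs (D j)"] by linarith
    qed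
    then show "\<exists>N. \<forall>i\<ge>N. \<forall>j\<ge>N. p (rs (D i) - rs (D j)) < e" by blast
  qed
  have psi: "\<psi> I = integral {a..b} (\<lambda>t. \<psi> (f t))" if \<psi>: "test_functional \<psi>" for \<psi>
  proof (rule LIMSEQ_unique)
    show "(\<lambda>k. \<psi> (rs (D k))) \<longlonglongrightarrow> \<psi> I"
      using \<psi> bd limitin_gamma_tau[OF I] unfolding test_functional_def by blast
    have "filterlim D (riemann_filter a b) sequentially"
      unfolding filterlim_def le_filter_def eventually_filtermap eventually_riemann_filter eventually_sequentially
    proof (intro allI impI)
      fix Q assume "\<exists>\<delta>>0. \<forall>D. D tagged_division_of {a..b} \<and> (\<lambda>x. ball x \<delta>) fine D \<longrightarrow> Q D"
      then obtain \<delta> where "\<delta> > 0" "\<And>D. D tagged_division_of {a..b} \<Longrightarrow> (\<lambda>x. ball x \<delta>) fine D \<Longrightarrow> Q D" by blast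
      then show "\<exists>N. \<forall>n\<ge>N. Q (D n)" using fine_D D(1) by blast
    qed
    from filterlim_compose[OF riemann_sum_tendsto[OF cont[OF \<psi>] ab] this]
    show "(\<lambda>k. \<psi> (rs (D k))) \<longlonglongrightarrow> integral {a..b} (\<lambda>t. \<psi> (f t))"
      unfolding rs_def test_functional_riemann_sum[OF test_functional_linear[OF \<psi>]] .
  qed
  have "has_riemann_integral \<gamma> f I a b"
    unfolding has_riemann_integral_def rs_def[symmetric]
  proof (rule limitin_gammaI)
    show "\<forall>\<^sub>F D in riemann_filter a b. norm (rs D) \<le> B * (b - a)"
      unfolding eventually_riemann_filter using rsb by (intro exI[of _ 1]) auto
    show "limitin \<tau> rs I (riemann_filter a b)"
      unfolding limitin_tau_iff
    proof (intro ballI tendstoI)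
      fix p and e :: real assume p: "p \<in> P" and e: "e > 0"
      obtain \<delta> where d: "\<delta> > 0" and d': "\<forall>D \<phi>. D tagged_division_of {a..b} \<and> (\<lambda>x. ball x \<delta>) fine D \<and> test_functional \<phi> \<and> (\<forall>x. \<bar>\<phi> x\<bar> \<le> p x)
        \<longrightarrow> \<bar>\<phi> (rs D) - integral {a..b} (\<lambda>t. \<phi> (f t))\<bar> \<le> e / 2"
        using err[OF p, of "e / 2"] e by auto
      have "dist (p (rs D - I)) 0 < e" if D: "D tagged_division_of {a..b}" "(\<lambda>x. ball x \<delta>) fine D" for D
      proof -
        obtain \<phi> where \<phi>: "test_functional \<phi>" "\<And>x. \<bar>\<phi> x\<bar> \<le> p x" "\<phi> (rs D - I) = p (rs D - I)"
          using test_functional_norming[OF mixed_seminorm_P[OF p]] by blast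
        have "\<bar>\<phi> (rs D) - integral {a..b} (\<lambda>t. \<phi> (f t))\<bar> \<le> e / 2" using d' D \<phi>(1,2) by blast
        then have "p (rs D - I) < e" using \<phi>(3) psi[OF \<phi>(1)] e linear_diff[OF test_functional_linear[OF \<phi>(1)], of "rs D" I] by linarith
        then show ?thesis using real_seminormD(5)[OF P_real[OF p]] by simp
      qed
      then show "\<forall>\<^sub>F D in riemann_filter a b. dist (p (rs D - I)) 0 < e"
        unfolding eventually_riemann_filter using d by blast
    qed
  qed
  with psi that show ?thesis by blast
qed

lemma has_riemann_integral_unique:
  "has_riemann_integral \<gamma> f I a b \<Longrightarrow> has_riemann_integral \<gamma> f J a b \<Longrightarrow> I = J"
  unfolding has_riemann_integral_def by (rule limitin_gamma_unique[OF _ _ riemann_filter_neq_bot])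

lemma test_functional_riemann_integral:
  fixes f :: "real \<Rightarrow> 'a"
  assumes f: "continuous_map (top_of_set {min a b..max a b}) \<tau> f" and B: "\<And>t. t \<in> {min a b..max a b} \<Longrightarrow> norm (f t) \<le> B"
    and \<psi>: "test_functional \<psi>"
  shows "\<psi> (riemann_integral \<gamma> a b f) = oriented_integral a b (\<lambda>t. \<psi> (f t))"
proof -
  have the: "(THE I. has_riemann_integral \<gamma> f I c d) = I" if "has_riemann_integral \<gamma> f I c d" for I c d
    using that has_riemann_integral_unique by blast
  have mm: "min a b \<le> max a b" by simp
  obtain I where I: "has_riemann_integral \<gamma> f I (min a b) (max a b)" "\<psi> I = integral {min a b..max a b} (\<lambda>t. \<psi> (f t))"
    using riemann_integral_exists[OF mm f B] \<psi> by blast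
  show ?thesis
  proof (cases "a \<le> b")
    case True
    then show ?thesis using I the[of I a b] by (simp add: riemann_integral_def oriented_integral_def)
  next
    case False
    then show ?thesis using I the[of I b a] linear_neg[OF test_functional_linear[OF \<psi>]]
      by (simp add: riemann_integral_def oriented_integral_def)
  qed
qed

lemma has_improper_integral_unique:
  assumes "has_improper_integral \<gamma> f I" "has_improper_integral \<gamma> f J"
  shows "I = J"
proof -
  obtain F where F: "\<And>b. b \<ge> 0 \<Longrightarrow> has_riemann_integral \<gamma> f (F b) 0 b" "limitin \<gamma> F I at_top"
    using assms(1) unfolding has_improper_integral_def by blast
  obtain G where G: "\<And>b. b \<ge> 0 \<Longrightarrow> has_riemann_integral \<gamma> f (G b) 0 b" "limitin \<gamma> G J at_top"
    using assms(2) unfolding has_improper_integral_def by blast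
  have "\<forall>\<^sub>F b in at_top. F b = G b"
    using eventually_ge_at_top[of "0::real"] by eventually_elim (use F(1) G(1) has_riemann_integral_unique in blast)
  from limitin_transform_eventually[OF this F(2)] have "limitin \<gamma> G I at_top" .
  from limitin_gamma_unique[OF this G(2)] show ?thesis by simp
qed

lemma improper_integral_eq:
  assumes "has_improper_integral \<gamma> f I"
  shows "improper_integral \<gamma> f = I"
  unfolding improper_integral_def using assms has_improper_integral_unique by blast

text \<open>The tails decay like exp (-c b) uniformly over the functionals dominated by any
  \<open>p\<close> in \<open>P\<close>, because \<open>p\<close> is below the norm. The limit is
  taken over integer endpoints first, where sequential completeness applies, and then over all
  endpoints.\<close>

theorem improper_integral_exists:
  fixes f :: "real \<Rightarrow> 'a"
  assumes f: "continuous_map (top_of_set {0..}) \<tau> f" and c: "c > 0"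
    and M: "\<And>t. t \<ge> 0 \<Longrightarrow> norm (f t) \<le> M * exp (- c * t)"
  shows "has_improper_integral \<gamma> f (improper_integral \<gamma> f)"
    and "\<And>\<psi>. test_functional \<psi> \<Longrightarrow> \<psi> (improper_integral \<gamma> f) = (LBINT t:{0..}. \<psi> (f t))"
    and "\<And>\<psi>. test_functional \<psi> \<Longrightarrow> set_integrable lborel {0..} (\<lambda>t. \<psi> (f t))"
    and "\<And>\<psi>. test_functional \<psi> \<Longrightarrow> continuous_on {0..} (\<lambda>t. \<psi> (f t))"
proof -
  have M0: "M \<ge> 0" by (rule order.trans[OF norm_ge_zero[of "f 0"]]) (use M[of 0] in simp)
  have MB: "norm (f t) \<le> M" if "t \<ge> 0" for t
  proof -
    have "M * exp (- c * t) \<le> M" using M0 c that by (simp add: mult_left_le)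
    then show ?thesis using M[OF that] by linarith
  qed
  show cont: "continuous_on {0..} (\<lambda>t. \<psi> (f t))" if "test_functional \<psi>" for \<psi>
    by (rule test_functional_continuous_on_bounded[OF that f]) (use MB in auto)
  show int: "set_integrable lborel {0..} (\<lambda>t. \<psi> (f t))" if \<psi>: "test_functional \<psi>" for \<psi>
  proof -
    obtain K where K: "K > 0" "\<And>x. \<bar>\<psi> x\<bar> \<le> K * norm x" using test_functional_bounded[OF \<psi>] by blast
    have "exp_order (\<lambda>t. \<psi> (f t)) (- c)"
    proof (rule exp_orderI[OF cont[OF \<psi>]])
      fix t :: real assume t: "t \<ge> 0"
      have "K * norm (f t) \<le> K * (M * exp (- c * t))" using K(1) M[OF t] by (intro mult_left_mono) auto
      then show "\<bar>\<psi> (f t)\<bar> \<le> (K * M) * exp (- c * t)"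
        using K(2)[of "f t"] by (simp add: mult.assoc)
    qed
    from exp_order_integrable[OF this, of 0] c show ?thesis by simp
  qed
  have "\<exists>I. has_riemann_integral \<gamma> f I 0 b \<and> (\<forall>\<psi>. test_functional \<psi> \<longrightarrow> \<psi> I = integral {0..b} (\<lambda>t. \<psi> (f t)))" if "b \<ge> 0" for b
  proof -
    have fb: "continuous_map (top_of_set {0..b}) \<tau> f"
      by (rule continuous_map_from_subtopology_mono[OF f]) auto
    show ?thesis using riemann_integral_exists[OF that fb MB] by auto
  qed
  then obtain F where F: "\<And>b. b \<ge> 0 \<Longrightarrow> has_riemann_integral \<gamma> f (F b) 0 b"
    "\<And>b \<psi>. b \<ge> 0 \<Longrightarrow> test_functional \<psi> \<Longrightarrow> \<psi> (F b) = integral {0..b} (\<lambda>t. \<psi> (f t))"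
    by metis
  have diff: "\<bar>\<phi> (F d) - \<phi> (F b)\<bar> \<le> (M / c) * exp (- c * b)"
    if \<phi>: "test_functional \<phi>" "\<And>x. \<bar>\<phi> x\<bar> \<le> p x" and p: "p \<in> P" and b: "0 \<le> b" "b \<le> d" for \<phi> p b d
  proof -
    have ci: "(\<lambda>t. \<phi> (f t)) integrable_on {0..d}" "(\<lambda>t. \<phi> (f t)) integrable_on {b..d}"
      by (intro integrable_continuous_real continuous_on_subset[OF cont[OF \<phi>(1)]]; use b in auto)+
    have "\<phi> (F d) - \<phi> (F b) = integral {b..d} (\<lambda>t. \<phi> (f t))"
      using F(2)[OF _ \<phi>(1)] b Henstock_Kurzweil_Integration.integral_combine[OF b ci(1)] by simp
    have g: "((\<lambda>t. M * exp (- c * t)) has_integral (- (M / c) * exp (- c * d) - - (M / c) * exp (- c * b))) {b..d}"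
      using c by (intro fundamental_theorem_of_calculus b(2))
        (auto simp: has_real_derivative_iff_has_vector_derivative[symmetric] intro!: derivative_eq_intros)
    have "norm (integral {b..d} (\<lambda>t. \<phi> (f t))) \<le> integral {b..d} (\<lambda>t. M * exp (- c * t))"
    proof (rule integral_norm_bound_integral[OF ci(2) has_integral_integrable[OF g]])
      fix t assume t: "t \<in> {b..d}"
      have "\<bar>\<phi> (f t)\<bar> \<le> p (f t)" by (rule \<phi>(2))
      also have "\<dots> \<le> norm (f t)" by (rule P_le_norm[OF p])
      also have "\<dots> \<le> M * exp (- c * t)" using t b by (intro M) auto
      finally show "norm (\<phi> (f t)) \<le> M * exp (- c * t)" by simp
    qed
    also have "\<dots> \<le> (M / c) * exp (- c * b)" using integral_unique[OF g] M0 c by simp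
    finally show ?thesis using \<open>\<phi> (F d) - \<phi> (F b) = _\<close> by simp
  qed
  have pdiff: "p (F d - F b) \<le> (M / c) * exp (- c * b)" if p: "p \<in> P" and b: "0 \<le> b" "b \<le> d" for p b d
  proof -
    obtain \<phi> where \<phi>: "test_functional \<phi>" "\<And>x. \<bar>\<phi> x\<bar> \<le> p x" "\<phi> (F d - F b) = p (F d - F b)"
      using test_functional_norming[OF mixed_seminorm_P[OF p]] by blast
    show ?thesis using diff[OF \<phi>(1,2) p b] \<phi>(3) linear_diff[OF test_functional_linear[OF \<phi>(1)], of "F d" "F b"] by linarith
  qed
  have tail: "((\<lambda>b. (M / c) * exp (- c * b)) \<longlongrightarrow> 0) at_top" using c by real_asymp
  \<comment> \<open>Together with the tail estimate from 0 on this bounds \<open>F\<close> in norm,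
    the norm being the supremum over \<open>P\<close>.\<close>
  have F0: "F 0 = 0"
    by (rule test_functional_eqI) (simp add: F(2) linear_0[OF test_functional_linear])
  have Fb: "norm (F b) \<le> M / c" if "b \<ge> 0" for b
    by (rule norm_leI) (use pdiff[of _ 0 b] that F0 in simp)
  have bd: "bounded (range (\<lambda>k. F (real k)))" unfolding bounded_iff by (intro exI[of _ "M / c"]) (auto intro: Fb)
  obtain I where I: "limitin \<gamma> (\<lambda>k. F (real k)) I sequentially"
  proof (rule gamma_convergent[OF bd])
    fix p and e :: real assume p: "p \<in> P" and e: "e > 0"
    obtain N where N: "\<And>b. b \<ge> N \<Longrightarrow> (M / c) * exp (- c * b) < e / 2"
      using order_tendstoD(2)[OF tail, of "e/2"] e unfolding eventually_at_top_linorder by auto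
    obtain K where K: "real K \<ge> N" using real_arch_simple by blast
    have half: "p (F (real i) - F (real K)) < e / 2" if "i \<ge> K" for i
      using le_less_trans[OF pdiff[OF p, of "real K" "real i"] N[OF K]] that by simp
    have "p (F (real i) - F (real j)) < e" if "i \<ge> K" "j \<ge> K" for i j
      using half[OF that(1)] half[OF that(2)]
        real_seminormD(6)[OF P_real[OF p], of "F (real i) - F (real K)" "F (real j) - F (real K)"] by simp
    then show "\<exists>N. \<forall>i\<ge>N. \<forall>j\<ge>N. p (F (real i) - F (real j)) < e" by blast
  qed
  have psi: "\<psi> I = (LBINT t:{0..}. \<psi> (f t))" if \<psi>: "test_functional \<psi>" for \<psi>
  proof (rule LIMSEQ_unique)
    show "(\<lambda>k. \<psi> (F (real k))) \<longlonglongrightarrow> \<psi> I"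
      using \<psi> bd limitin_gamma_tau[OF I] unfolding test_functional_def by blast
    have "((\<lambda>b. LBINT t:{0..b}. \<psi> (f t)) \<longlongrightarrow> (LBINT t:{0..}. \<psi> (f t))) at_top"
      by (rule tendsto_set_lebesgue_integral_at_top[OF _ int[OF \<psi>]]) auto
    from filterlim_compose[OF this filterlim_real_sequentially]
    show "(\<lambda>k. \<psi> (F (real k))) \<longlonglongrightarrow> (LBINT t:{0..}. \<psi> (f t))"
      using lborel_eq_integral[OF continuous_on_subset[OF cont[OF \<psi>]]] F(2)[OF _ \<psi>] by simp
  qed
  have "limitin \<gamma> F I at_top"
  proof (rule limitin_gammaI)
    show "\<forall>\<^sub>F b in at_top. norm (F b) \<le> M / c"
      using eventually_ge_at_top[of 0] by eventually_elim (rule Fb)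
    show "limitin \<tau> F I at_top" unfolding limitin_tau_iff
    proof
      fix p assume p: "p \<in> P"
      have "p (F b - I) \<le> (M / c) * exp (- c * b)" if b: "b \<ge> 0" for b
      proof -
        obtain \<phi> where \<phi>: "test_functional \<phi>" "\<And>x. \<bar>\<phi> x\<bar> \<le> p x" "\<phi> (F b - I) = p (F b - I)"
          using test_functional_norming[OF mixed_seminorm_P[OF p]] by blast
        have "(\<lambda>k. \<phi> (F (real k))) \<longlonglongrightarrow> \<phi> I"
          using \<phi>(1) bd limitin_gamma_tau[OF I] unfolding test_functional_def by blast
        then have "(\<lambda>k. \<bar>\<phi> (F (real k)) - \<phi> (F b)\<bar>) \<longlonglongrightarrow> \<bar>\<phi> I - \<phi> (F b)\<bar>" by (intro tendsto_intros)
        moreover have "\<forall>\<^sub>F k in sequentially. \<bar>\<phi> (F (real k)) - \<phi> (F b)\<bar> \<le> (M / c) * exp (- c * b)"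
          using filterlim_real_sequentially[unfolded filterlim_at_top, rule_format, of b]
          by eventually_elim (rule diff[OF \<phi>(1,2) p b])
        ultimately have "\<bar>\<phi> I - \<phi> (F b)\<bar> \<le> (M / c) * exp (- c * b)"
          by (intro tendsto_upperbound[OF _ _ sequentially_bot])
        then show ?thesis using \<phi>(3) linear_diff[OF test_functional_linear[OF \<phi>(1)], of "F b" I] by linarith
      qed
      then have "norm (p (F b - I)) \<le> (M / c) * exp (- c * b)" if "b \<ge> 0" for b
        using that real_seminormD(5)[OF P_real[OF p], of "F b - I"] by simp
      then have "\<forall>\<^sub>F b in at_top. norm (p (F b - I)) \<le> (M / c) * exp (- c * b)"
        by (rule eventually_mono[OF eventually_ge_at_top[of 0]])
      then show "((\<lambda>b. p (F b - I)) \<longlongrightarrow> 0) at_top" by (rule Lim_null_comparison[OF _ tail])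
    qed
  qed
  then have I': "has_improper_integral \<gamma> f I" unfolding has_improper_integral_def using F(1) by blast
  then show "has_improper_integral \<gamma> f (improper_integral \<gamma> f)" by (simp add: improper_integral_eq)
  show "\<psi> (improper_integral \<gamma> f) = (LBINT t:{0..}. \<psi> (f t))" if "test_functional \<psi>" for \<psi>
    using psi[OF that] improper_integral_eq[OF I'] by simp
qed

end

section \<open>The cosine family\<close>

lemma eq_minus_self_imp_0:
  fixes v :: "'a::real_vector"
  assumes "v = - v"
  shows "v = 0"
proof -
  have "v + v = 0" using assms by (rule eq_neg_iff_add_eq_0[THEN iffD1])
  then have "2 *\<^sub>R v = 0" by (simp only: scaleR_2)
  then show ?thesis by simp
qed

section \<open>Orbits under test functionals\<close>

context saks
begin

lemma continuous_map_tauI: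
  assumes "\<And>t p. t \<in> T \<Longrightarrow> p \<in> P \<Longrightarrow> ((\<lambda>s. p (f s - f t)) \<longlongrightarrow> 0) (at t within T)"
  shows "continuous_map (top_of_set T) \<tau> f"
  unfolding continuous_map_iff_limitin limitin_tau_iff using assms by blast

lemma continuous_map_tauD:
  assumes "continuous_map (top_of_set T) \<tau> f" "t \<in> T" "p \<in> P"
  shows "((\<lambda>s. p (f s - f t)) \<longlongrightarrow> 0) (at t within T)"
  using assms unfolding continuous_map_iff_limitin limitin_tau_iff by blast

lemma continuous_map_tau_scaleR:
  fixes w :: "real \<Rightarrow> real"
  assumes f: "continuous_map (top_of_set T) \<tau> f" and w: "continuous_on T w"
  shows "continuous_map (top_of_set T) \<tau> (\<lambda>t. w t *\<^sub>R f t)"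
proof (rule continuous_map_tauI)
  fix t p assume t: "t \<in> T" and p: "p \<in> P"
  note Q = real_seminormD[OF P_real[OF p]]
  have wt: "(w \<longlongrightarrow> w t) (at t within T)" using w t by (simp add: continuous_on)
  have "((\<lambda>s. \<bar>w s\<bar> * p (f s - f t) + \<bar>w s - w t\<bar> * p (f t)) \<longlongrightarrow> \<bar>w t\<bar> * 0 + \<bar>w t - w t\<bar> * p (f t)) (at t within T)"
    by (intro tendsto_intros wt continuous_map_tauD[OF f t p])
  then have lim: "((\<lambda>s. \<bar>w s\<bar> * p (f s - f t) + \<bar>w s - w t\<bar> * p (f t)) \<longlongrightarrow> 0) (at t within T)" by simp
  have "norm (p (w s *\<^sub>R f s - w t *\<^sub>R f t)) \<le> \<bar>w s\<bar> * p (f s - f t) + \<bar>w s - w t\<bar> * p (f t)" for s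
  proof -
    have "w s *\<^sub>R f s - w t *\<^sub>R f t = w s *\<^sub>R (f s - f t) + (w s - w t) *\<^sub>R f t" by (simp add: algebra_simps)
    then show ?thesis using Q(1)[of "w s *\<^sub>R (f s - f t)" "(w s - w t) *\<^sub>R f t"] Q(2)[of "w s" "f s - f t"] Q(2)[of "w s - w t" "f t"] Q(5) by simp
  qed
  then show "((\<lambda>s. p (w s *\<^sub>R f s - w t *\<^sub>R f t)) \<longlongrightarrow> 0) (at t within T)"
    by (intro Lim_null_comparison[OF _ lim]) simp
qed

text \<open>A test functional is only real linear, so a scalar of the field cannot be taken out of
  it; instead it is absorbed into the functional.\<close>

lemma test_functional_scl:
  assumes "test_functional \<psi>"
  shows "test_functional (\<lambda>x. \<psi> (scl k x))"
  unfolding test_functional_def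
proof (intro conjI allI impI)
  note lin = test_functional_linear[OF assms]
  have "scl k (r *\<^sub>R x) = r *\<^sub>R scl k x" for r x
    by (simp add: scl_of_real[symmetric] scl_simps mult.commute)
  then show "linear (\<lambda>x. \<psi> (scl k x))"
    by (intro linearI) (simp_all add: scl_simps linear_add[OF lin] linear_scale[OF lin])
  fix x l assume x: "bounded (range x) \<and> limitin \<tau> x l sequentially"
  have "bounded (range (\<lambda>i. scl k (x i)))"
  proof -
    obtain B where B: "\<And>i. norm (x i) \<le> B" using x unfolding bounded_iff by auto
    have "norm (scl k (x i)) \<le> norm k * B" for i using B[of i] by (simp add: norm_scl mult_left_mono)
    then show ?thesis unfolding bounded_iff by blast
  qed
  moreover have "limitin \<tau> (\<lambda>i. scl k (x i)) (scl k l) sequentially"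
    unfolding limitin_tau_iff
  proof
    fix p assume p: "p \<in> P"
    have "p (scl k z) = norm k * p z" for z using P_seminorm[OF p] unfolding seminorm_over_def by blast
    then have "p (scl k (x i) - scl k l) = norm k * p (x i - l)" for i by (simp add: scl_simps(8)[symmetric])
    moreover have "(\<lambda>i. norm k * p (x i - l)) \<longlonglongrightarrow> norm k * 0"
      using x p unfolding limitin_tau_iff by (intro tendsto_intros) blast
    ultimately show "(\<lambda>i. p (scl k (x i) - scl k l)) \<longlonglongrightarrow> 0" by simp
  qed
  ultimately show "(\<lambda>i. \<psi> (scl k (x i))) \<longlonglongrightarrow> \<psi> (scl k l)"
    using assms unfolding test_functional_def by blast
qed

text \<open>Bi-equicontinuity makes the images of \<open>x k - l\<close> tend to 0 in
  \<open>\<tau>\<close>, and the operator bound keeps them bounded.\<close>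

lemma test_functional_bi_equicontinuous:
  assumes \<psi>: "test_functional \<psi>" and T: "linear (T t)" "\<And>x. norm (T t x) \<le> K * norm x"
    and equi: "bi_equicontinuous \<tau> N T" and t: "t \<in> N"
  shows "test_functional (\<lambda>x. \<psi> (T t x))"
  unfolding test_functional_def
proof (intro conjI allI impI)
  show "linear (\<lambda>x. \<psi> (T t x))"
    using linear_compose[OF T(1) test_functional_linear[OF \<psi>]] by (simp add: comp_def)
  fix x l assume x: "bounded (range x) \<and> limitin \<tau> x l sequentially"
  have ev: "\<forall>\<^sub>F k in sequentially. T t (x k - l) \<in> U" if "openin \<tau> U" "0 \<in> U" for U
  proof -
    have "\<forall>\<^sub>F k in sequentially. \<forall>j\<in>N. T j (x k - l) \<in> U"
      using equi x that unfolding bi_equicontinuous_def by blast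
    then show ?thesis by eventually_elim (use t in blast)
  qed
  have l0: "limitin \<tau> (\<lambda>k. T t (x k - l)) 0 sequentially"
    unfolding limitin_def using ev by auto
  obtain B where B: "\<And>k. norm (x k) \<le> B" using x unfolding bounded_iff by auto
  have "norm (T t (x k - l)) \<le> \<bar>K\<bar> * (B + norm l)" for k
  proof -
    have "norm (x k - l) \<le> B + norm l" using B[of k] norm_triangle_ineq4[of "x k" l] by simp
    then have "K * norm (x k - l) \<le> \<bar>K\<bar> * (B + norm l)" by (intro mult_mono) auto
    then show ?thesis using T(2)[of "x k - l"] by linarith
  qed
  then have "bounded (range (\<lambda>k. T t (x k - l)))" unfolding bounded_iff by blast
  then have "(\<lambda>k. \<psi> (T t (x k - l))) \<longlonglongrightarrow> \<psi> 0" using \<psi> l0 unfolding test_functional_def by blast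
  then have "(\<lambda>k. \<psi> (T t (x k - l)) + \<psi> (T t l)) \<longlonglongrightarrow> \<psi> 0 + \<psi> (T t l)" by (intro tendsto_intros)
  then show "(\<lambda>k. \<psi> (T t (x k))) \<longlonglongrightarrow> \<psi> (T t l)"
    by (simp add: linear_diff[OF T(1)] linear_diff[OF test_functional_linear[OF \<psi>]] linear_0[OF test_functional_linear[OF \<psi>]])
qed

lemma orbit_continuous:
  fixes f :: "real \<Rightarrow> 'a"
  assumes \<psi>: "test_functional \<psi>" and f: "continuous_map (top_of_set {0..}) \<tau> f"
    and growth: "\<And>t. t \<ge> 0 \<Longrightarrow> norm (f t) \<le> B * exp (b * t)" and b: "b \<ge> 0"
  shows "continuous_on {0..} (\<lambda>t. \<psi> (f t))"
proof (rule test_functional_continuous_on[OF \<psi> f])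
  fix t and s :: "nat \<Rightarrow> real" assume s: "\<And>k. s k \<in> {0..}" "s \<longlonglongrightarrow> t"
  have "bounded (range s)" using s(2) convergent_imp_bounded by blast
  then obtain T where T: "\<And>k. norm (s k) \<le> T" unfolding bounded_iff by auto
  have "0 \<le> norm (f 0)" by simp
  also have "\<dots> \<le> B" using growth[of 0] by simp
  finally have B: "0 \<le> B" .
  have "norm (f (s k)) \<le> B * exp (b * T)" for k
  proof -
    have "norm (f (s k)) \<le> B * exp (b * s k)" using growth s(1) by simp
    also have "\<dots> \<le> B * exp (b * T)"
      using T[of k] s(1)[of k] b B by (auto intro!: mult_left_mono)
    finally show ?thesis .
  qed
  then show "bounded (range (\<lambda>k. f (s k)))" unfolding bounded_iff by blast
qed

lemma orbit_exp_order:
  fixes f :: "real \<Rightarrow> 'a"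
  assumes \<psi>: "test_functional \<psi>" and f: "continuous_map (top_of_set {0..}) \<tau> f"
    and growth: "\<And>t. t \<ge> 0 \<Longrightarrow> norm (f t) \<le> B * exp (b * t)" and b: "b \<ge> 0"
  shows "exp_order (\<lambda>t. \<psi> (f t)) b"
proof -
  obtain K where K: "K > 0" "\<And>x. \<bar>\<psi> x\<bar> \<le> K * norm x" using test_functional_bounded[OF \<psi>] by blast
  show ?thesis
  proof (rule exp_orderI[OF orbit_continuous[OF assms]])
    fix t :: real assume t: "t \<ge> 0"
    have "K * norm (f t) \<le> K * (B * exp (b * t))" using K(1) growth[OF t] by (intro mult_left_mono) auto
    then show "\<bar>\<psi> (f t)\<bar> \<le> (K * B) * exp (b * t)" using K(2)[of "f t"] by (simp add: mult_ac)
  qed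
qed

lemma orbit_laplace:
  fixes f :: "real \<Rightarrow> 'a"
  assumes \<psi>: "test_functional \<psi>" and f: "continuous_map (top_of_set {0..}) \<tau> f"
    and growth: "\<And>t. t \<ge> 0 \<Longrightarrow> norm (f t) \<le> B * exp (b * t)"
    and l: "l > b" and w: "\<And>t. t \<ge> 0 \<Longrightarrow> w t = c * exp (- l * t)"
  shows "\<psi> (improper_integral \<gamma> (\<lambda>t. w t *\<^sub>R f t)) = c * laplace (\<lambda>t. \<psi> (f t)) l"
proof -
  have wc: "continuous_on {0..} w" by (rule continuous_on_eq[of _ "\<lambda>t. c * exp (- l * t)"]) (auto simp: w intro!: continuous_intros)
  have "norm (w t *\<^sub>R f t) \<le> (\<bar>c\<bar> * B) * exp (- (l - b) * t)" if t: "t \<ge> 0" for t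
  proof -
    have "norm (w t *\<^sub>R f t) = \<bar>c\<bar> * exp (- l * t) * norm (f t)" by (simp add: w[OF t] abs_mult)
    also have "\<dots> \<le> \<bar>c\<bar> * exp (- l * t) * (B * exp (b * t))" by (intro mult_left_mono growth t) auto
    also have "\<dots> = (\<bar>c\<bar> * B) * (exp (- l * t) * exp (b * t))" by simp
    also have "exp (- l * t) * exp (b * t) = exp (- (l - b) * t)" by (simp add: exp_add[symmetric] algebra_simps)
    finally show ?thesis .
  qed
  then have "\<psi> (improper_integral \<gamma> (\<lambda>t. w t *\<^sub>R f t)) = (LBINT t:{0..}. \<psi> (w t *\<^sub>R f t))"
    using l by (intro improper_integral_exists(2)[OF continuous_map_tau_scaleR[OF f wc], of "l - b"] \<psi>) auto
  also have "\<dots> = (LBINT t:{0..}. c * (exp (- l * t) * \<psi> (f t)))"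
    by (intro set_lebesgue_integral_cong) (auto simp: w linear_scale[OF test_functional_linear[OF \<psi>]])
  also have "\<dots> = c * laplace (\<lambda>t. \<psi> (f t)) l" unfolding laplace_def by simp
  finally show ?thesis .
qed

lemma orbit_riemann_integral:
  fixes f :: "real \<Rightarrow> 'a"
  assumes \<psi>: "test_functional \<psi>" and f: "continuous_map (top_of_set {0..}) \<tau> f"
    and growth: "\<And>t. t \<ge> 0 \<Longrightarrow> norm (f t) \<le> B * exp (b * t)"
    and w: "continuous_on UNIV w" and cd: "0 \<le> c" "0 \<le> d"
  shows "\<psi> (riemann_integral \<gamma> c d (\<lambda>r. w r *\<^sub>R f r)) = oriented_integral c d (\<lambda>r. w r * \<psi> (f r))"
proof -
  let ?I = "{min c d..max c d}"
  have sub: "?I \<subseteq> {0..}" using cd by auto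
  have wf: "continuous_map (top_of_set ?I) \<tau> (\<lambda>r. w r *\<^sub>R f r)"
    by (intro continuous_map_tau_scaleR continuous_map_from_subtopology_mono[OF f sub] continuous_on_subset[OF w]) simp
  have "continuous_on ?I (\<lambda>r. \<bar>w r\<bar> * (B * exp (b * r)))"
    by (intro continuous_intros continuous_on_subset[OF w]) simp
  then have "bounded ((\<lambda>r. \<bar>w r\<bar> * (B * exp (b * r))) ` ?I)"
    by (intro compact_imp_bounded compact_continuous_image) auto
  then obtain K where K: "\<forall>z\<in>(\<lambda>r. \<bar>w r\<bar> * (B * exp (b * r))) ` ?I. norm z \<le> K"
    unfolding bounded_iff by blast
  have "norm (w r *\<^sub>R f r) \<le> K" if r: "r \<in> ?I" for r
  proof -
    have "norm (w r *\<^sub>R f r) = \<bar>w r\<bar> * norm (f r)" by simp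
    also have "\<dots> \<le> \<bar>w r\<bar> * (B * exp (b * r))" using r sub by (intro mult_left_mono growth) auto
    also have "\<dots> \<le> norm (\<bar>w r\<bar> * (B * exp (b * r)))" by simp
    also have "\<dots> \<le> K" using K r by blast
    finally show ?thesis .
  qed
  from test_functional_riemann_integral[OF wf this \<psi>]
  show ?thesis by (simp add: linear_scale[OF test_functional_linear[OF \<psi>]])
qed

end

text \<open>The rate \<open>a\<close> is positive so that powers of \<open>t\<close> are of order
  \<open>a\<close> as well.\<close>

locale cosine_family = saks +
  fixes C :: "'b \<Rightarrow> 'b" and n :: nat and Cos :: "real \<Rightarrow> 'b \<Rightarrow> 'b" and D :: "'b set" and A :: "'b \<Rightarrow> 'b"
    and M a :: real
  assumes C_linear: "Vector_Spaces.linear scl scl C" and C_cont: "continuous_map \<gamma> \<gamma> C"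
    and cosine: "integrated_cosine scl \<gamma> (2 * n) C Cos"
    and nondeg: "non_degenerate Cos"
    and bicont: "locally_bi_continuous scl \<tau> Cos"
    and generator: "cosine_generator \<gamma> (2 * n) C Cos D A"
    and a_pos: "a > 0" and M_nonneg: "M \<ge> 0"
    and growth: "\<And>t x. t \<ge> 0 \<Longrightarrow> norm (Cos t x) \<le> M * exp (a * t) * norm x"
begin

lemma C_add: "C (x + y) = C x + C y" and C_scl: "C (scl k x) = scl k (C x)" and C_linear_real: "linear C"
proof -
  show *: "C (x + y) = C x + C y" "C (scl k x) = scl k (C x)" for x y k
    using C_linear unfolding Vector_Spaces.linear_iff by auto
  show "linear C" by (rule linearI) (simp_all add: * scl_of_real[symmetric])
qed

lemma Cos_linear: "t \<ge> 0 \<Longrightarrow> linear (Cos t)"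
  using bicont unfolding locally_bi_continuous_def by (auto intro: bounded_linear.linear)

lemma Cos_scl: "t \<ge> 0 \<Longrightarrow> Cos t (scl k x) = scl k (Cos t x)"
  using bicont unfolding locally_bi_continuous_def Vector_Spaces.linear_iff by auto

lemma Cos_cont: "continuous_map (top_of_set {0..}) \<tau> (\<lambda>t. Cos t x)"
  using bicont unfolding locally_bi_continuous_def strongly_continuous_def by auto

lemma Cos_bi_equi: "compact N \<Longrightarrow> N \<subseteq> {0..} \<Longrightarrow> bi_equicontinuous \<tau> N Cos"
  using bicont unfolding locally_bi_continuous_def by auto

lemma C_cos0: "n = 0 \<Longrightarrow> Cos 0 x = C x" "n = 0 \<Longrightarrow> 0 \<le> s \<Longrightarrow> s \<le> t \<Longrightarrow> 2 *\<^sub>R Cos t (Cos s x) = Cos (t + s) (C x) + Cos (t - s) (C x)"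
  using cosine unfolding integrated_cosine_def by auto

lemma test_functional_Cos:
  assumes \<psi>: "test_functional \<psi>" and t: "t \<ge> 0"
  shows "test_functional (\<lambda>x. \<psi> (Cos t x))"
  by (rule test_functional_bi_equicontinuous[OF \<psi> Cos_linear[OF t] growth[OF t] Cos_bi_equi[of "{t}"]]) (use t in auto)

text \<open>Continuity in \<open>\<gamma>\<close> gives \<open>\<tau>\<close>-convergence of the
  images under \<open>C\<close>; domination of the functional by \<open>p\<close> takes the place of
  their boundedness.\<close>

lemma test_functional_C:
  assumes p: "p \<in> P" and \<phi>: "test_functional \<phi>" "\<And>x. \<bar>\<phi> x\<bar> \<le> p x"
  shows "test_functional (\<lambda>x. \<phi> (C x))"
  unfolding test_functional_def
proof (intro conjI allI impI)
  show "linear (\<lambda>x. \<phi> (C x))"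
    using linear_compose[OF C_linear_real test_functional_linear[OF \<phi>(1)]] by (simp add: comp_def)
  fix x l assume x: "bounded (range x) \<and> limitin \<tau> x l sequentially"
  obtain B where B: "\<And>k. norm (x k) \<le> B" using x unfolding bounded_iff by auto
  have "limitin \<gamma> x l sequentially" by (rule limitin_gammaI[where B=B]) (use x B in auto)
  then have "limitin \<gamma> (C \<circ> x) (C l) sequentially" by (rule continuous_map_limit[OF C_cont])
  then have "limitin \<tau> (C \<circ> x) (C l) sequentially" by (rule limitin_gamma_tau)
  then have "(\<lambda>k. p (C (x k) - C l)) \<longlonglongrightarrow> 0" using p unfolding limitin_tau_iff by auto
  then have "(\<lambda>k. \<phi> (C (x k) - C l)) \<longlonglongrightarrow> 0" by (rule Lim_null_comparison[rotated]) (use \<phi>(2) in auto)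
  then have "(\<lambda>k. \<phi> (C (x k) - C l) + \<phi> (C l)) \<longlonglongrightarrow> 0 + \<phi> (C l)" by (intro tendsto_intros)
  then show "(\<lambda>k. \<phi> (C (x k))) \<longlonglongrightarrow> \<phi> (C l)" by (simp add: linear_diff[OF test_functional_linear[OF \<phi>(1)]])
qed

lemma Cos_orbit_growth: "t \<ge> 0 \<Longrightarrow> norm (Cos t x) \<le> (M * norm x) * exp (a * t)"
  using growth[of t x] by (simp add: mult_ac)

lemma Cos_test_continuous: "test_functional \<psi> \<Longrightarrow> continuous_on {0..} (\<lambda>t. \<psi> (Cos t x))"
  by (rule orbit_continuous[OF _ Cos_cont Cos_orbit_growth]) (use a_pos in auto)

lemma Cos_test_exp_order: "test_functional \<psi> \<Longrightarrow> exp_order (\<lambda>t. \<psi> (Cos t x)) a"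
  by (rule orbit_exp_order[OF _ Cos_cont Cos_orbit_growth]) (use a_pos in auto)

text \<open>The factor \<open>l ^ m\<close> of \<open>laplace_op\<close> is left off, so that the
  transforms of \<open>Cos\<close> and \<open>S\<close> can be compared although the degrees of
  integration differ.\<close>

definition L :: "real \<Rightarrow> 'b \<Rightarrow> 'b" where
  "L l x = improper_integral \<gamma> (\<lambda>t. exp (- l * t) *\<^sub>R Cos t x)"

lemma weighted_laplace:
  assumes l: "l > a" and w: "\<And>t. t \<ge> 0 \<Longrightarrow> w t = c * exp (- l * t)" and \<psi>: "test_functional \<psi>"
  shows "\<psi> (improper_integral \<gamma> (\<lambda>t. w t *\<^sub>R Cos t x)) = c * laplace (\<lambda>t. \<psi> (Cos t x)) l"
  by (rule orbit_laplace[OF \<psi> Cos_cont Cos_orbit_growth l w])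

lemma test_L: "l > a \<Longrightarrow> test_functional \<psi> \<Longrightarrow> \<psi> (L l x) = laplace (\<lambda>t. \<psi> (Cos t x)) l"
  unfolding L_def using weighted_laplace[of l "\<lambda>t. exp (- l * t)" 1] by simp

lemma laplace_op_Cos:
  assumes "l > a"
  shows "laplace_op \<gamma> m Cos l x = l ^ m *\<^sub>R L l x"
proof (rule test_functional_eqI)
  fix \<psi> assume \<psi>: "test_functional \<psi>"
  have "\<psi> (laplace_op \<gamma> m Cos l x) = l ^ m * laplace (\<lambda>t. \<psi> (Cos t x)) l"
    unfolding laplace_op_def by (rule weighted_laplace[OF assms _ \<psi>]) simp
  then show "\<psi> (laplace_op \<gamma> m Cos l x) = \<psi> (l ^ m *\<^sub>R L l x)"
    using test_L[OF assms \<psi>] by (simp add: linear_scale[OF test_functional_linear[OF \<psi>]])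
qed

lemma L_linear:
  assumes "l > a"
  shows "linear (L l)"
proof (rule linearI; rule test_functional_eqI)
  fix \<psi> x y assume \<psi>: "test_functional \<psi>"
  note lin = test_functional_linear[OF \<psi>]
  have "laplace (\<lambda>t. \<psi> (Cos t (x + y))) l = laplace (\<lambda>t. \<psi> (Cos t x) + \<psi> (Cos t y)) l"
    by (rule laplace_cong) (simp add: linear_add[OF Cos_linear] linear_add[OF lin])
  also have "\<dots> = laplace (\<lambda>t. \<psi> (Cos t x)) l + laplace (\<lambda>t. \<psi> (Cos t y)) l"
    by (rule laplace_add[OF Cos_test_exp_order[OF \<psi>] Cos_test_exp_order[OF \<psi>] assms])
  finally show "\<psi> (L l (x + y)) = \<psi> (L l x + L l y)" by (simp add: linear_add[OF lin] test_L[OF assms \<psi>])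
next
  fix \<psi> r x assume \<psi>: "test_functional \<psi>"
  note lin = test_functional_linear[OF \<psi>]
  have "laplace (\<lambda>t. \<psi> (Cos t (r *\<^sub>R x))) l = laplace (\<lambda>t. r * \<psi> (Cos t x)) l"
    by (rule laplace_cong) (simp add: linear_scale[OF Cos_linear] linear_scale[OF lin])
  then show "\<psi> (L l (r *\<^sub>R x)) = \<psi> (r *\<^sub>R L l x)" by (simp add: linear_scale[OF lin] test_L[OF assms \<psi>] laplace_cmult)
qed

text \<open>The generator is only well defined if \<open>C\<close> is injective: an element \<open>z\<close> of its kernel would
  satisfy \<open>A z - A 0 = l\<^sup>2 z\<close> for all large \<open>l\<close>.\<close>

lemma C_injective:
  assumes "C z = 0"
  shows "z = 0"
proof -
  obtain \<omega> where \<omega>: "\<And>l. l > \<omega> \<Longrightarrow> D = {x. C x \<in> range (laplace_op \<gamma> (2 * n) Cos l)}"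
    "\<And>l x. l > \<omega> \<Longrightarrow> x \<in> D \<Longrightarrow> A x = l *\<^sub>R (l *\<^sub>R x - inv (laplace_op \<gamma> (2 * n) Cos l) (C x))"
    using generator unfolding cosine_generator_def by blast
  define m where "m = max \<omega> a"
  have C0: "C 0 = 0" by (rule linear_0[OF C_linear_real])
  have *: "A z - A 0 = (l * l) *\<^sub>R z" if l: "l > m" for l
  proof -
    have l': "l > \<omega>" "l > a" using l unfolding m_def by auto
    have "laplace_op \<gamma> (2 * n) Cos l 0 = 0"
      using laplace_op_Cos[OF l'(2)] linear_0[OF L_linear[OF l'(2)]] by simp
    then have "0 \<in> range (laplace_op \<gamma> (2 * n) Cos l)" by (metis rangeI)
    then have "z \<in> D" "0 \<in> D" using \<omega>(1)[OF l'(1)] assms C0 by auto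
    \<comment> \<open>\<open>laplace_op\<close> is not yet known to be injective, so the value of
      its \<open>inv\<close> at 0 is unknown; it occurs in both equations and cancels.\<close>
    then have "A z = l *\<^sub>R (l *\<^sub>R z - inv (laplace_op \<gamma> (2 * n) Cos l) 0)" "A 0 = l *\<^sub>R (l *\<^sub>R 0 - inv (laplace_op \<gamma> (2 * n) Cos l) 0)"
      using \<omega>(2)[OF l'(1), of z] \<omega>(2)[OF l'(1), of 0] unfolding assms C0 by blast+
    then show ?thesis by (simp add: scaleR_diff_right)
  qed
  have "((m + 2) * (m + 2)) *\<^sub>R z = ((m + 1) * (m + 1)) *\<^sub>R z"
    by (rule trans[OF *[symmetric] *]) simp_all
  then have "((m + 2) * (m + 2) - (m + 1) * (m + 1)) *\<^sub>R z = 0"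
    by (simp only: scaleR_left_diff_distrib diff_self)
  moreover have "(m + 2) * (m + 2) - (m + 1) * (m + 1) = 2 * m + 3" by (simp add: algebra_simps)
  ultimately have "2 * m + 3 = 0 \<or> z = 0" by simp
  moreover have "m > 0" using a_pos unfolding m_def by simp
  ultimately show ?thesis by simp
qed

lemma Cos_eq_0_imp: "(\<And>t. t > 0 \<Longrightarrow> Cos t x = 0) \<Longrightarrow> x = 0"
  using nondeg unfolding non_degenerate_def by blast

text \<open>D'Alembert's equation makes the values of the orbit of \<open>C y\<close> at two times
  opposite as soon as the times are \<open>2 * c\<close> apart. Three times with such gaps have
  pairwise opposite values, which must be 0; then \<open>C y = 0\<close> by non-degeneracy.\<close>

lemma eventually_zero_imp_zero:
  assumes n0: "n = 0" and c: "c \<ge> 0" and y: "\<And>u. u \<ge> c \<Longrightarrow> Cos u y = 0"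
  shows "y = 0"
proof -
  have step: "Cos q' (C y) = - Cos q (C y)" if "0 \<le> q" "q + 2 * c \<le> q'" for q q'
  proof -
    define t u where "t = (q' + q) / 2" and "u = (q' - q) / 2"
    have "u \<ge> c" "0 \<le> u" "u \<le> t" "t + u = q'" "t - u = q" using that c unfolding t_def u_def by (auto simp: field_simps)
    then have "Cos q' (C y) + Cos q (C y) = 2 *\<^sub>R Cos t 0" using C_cos0(2)[OF n0, of u t y] y[of u] by simp
    also have "\<dots> = 0" using \<open>0 \<le> u\<close> \<open>u \<le> t\<close> linear_0[OF Cos_linear] by simp
    finally show ?thesis by (simp add: add_eq_0_iff2)
  qed
  have "Cos q (C y) = 0" if q: "q \<ge> 0" for q
  proof -
    have e: "Cos (q + 2 * c) (C y) = - Cos q (C y)" "Cos (q + 4 * c) (C y) = - Cos (q + 2 * c) (C y)" "Cos (q + 4 * c) (C y) = - Cos q (C y)"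
      by (rule step; use q c in simp)+
    have "Cos (q + 2 * c) (C y) = Cos q (C y)" using trans[OF e(2)[symmetric] e(3)] by (rule neg_equal_iff_equal[THEN iffD1])
    from eq_minus_self_imp_0[OF trans[OF this[symmetric] e(1)]] show ?thesis .
  qed
  then have "C y = 0" by (rule Cos_eq_0_imp[OF _]) simp
  then show ?thesis by (rule C_injective)
qed

text \<open>For \<open>n = 0\<close> this is not part of the definition. A triple product expanded
  in two ways shows that the orbit of the difference \<open>y\<close> changes sign between distant
  times, and three such times make it vanish eventually.\<close>

lemma C_Cos_commute:
  assumes s: "s \<ge> 0"
  shows "C (Cos s x) = Cos s (C x)"
proof (cases "n = 0")
  case False
  then show ?thesis using cosine s unfolding integrated_cosine_def by auto
next
  case True
  define y where "y = C (Cos s x) - Cos s (C x)"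
  have pair: "Cos u y = - Cos v y" if v: "s \<le> v" "v + 2 * s \<le> u" for u v
  proof -
    define c b where "c = (u + v) / 2" and "b = (u - v) / 2"
    have cb: "c + b = u" "c - b = v" "s \<le> b" "0 \<le> b" "b + s \<le> c" "b \<le> c" "0 \<le> c" "0 \<le> u" "0 \<le> v" "s \<le> u"
      using v s unfolding c_def b_def by (auto simp: field_simps)
    note E = C_cos0(2)[OF True]
    have 1: "2 *\<^sub>R Cos c (Cos b (Cos s x)) = Cos u (C (Cos s x)) + Cos v (C (Cos s x))"
      using E[of b c "Cos s x"] cb by simp
    have 2: "2 *\<^sub>R Cos b (Cos s x) = Cos (b + s) (C x) + Cos (b - s) (C x)"
      using E[of s b x] cb s by simp
    have "2 *\<^sub>R (2 *\<^sub>R Cos c (Cos b (Cos s x))) = 2 *\<^sub>R Cos c (2 *\<^sub>R Cos b (Cos s x))"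
      using cb by (simp add: linear_scale[OF Cos_linear])
    also have "\<dots> = 2 *\<^sub>R Cos c (Cos (b + s) (C x)) + 2 *\<^sub>R Cos c (Cos (b - s) (C x))"
      unfolding 2 using cb by (simp add: linear_add[OF Cos_linear] scaleR_add_right)
    also have "\<dots> = (Cos (u + s) (C (C x)) + Cos (v - s) (C (C x))) + (Cos (u - s) (C (C x)) + Cos (v + s) (C (C x)))"
      using E[of "b + s" c "C x"] E[of "b - s" c "C x"] cb s by (simp add: algebra_simps)
    also have "\<dots> = 2 *\<^sub>R Cos u (Cos s (C x)) + 2 *\<^sub>R Cos v (Cos s (C x))"
      using E[of s u "C x"] E[of s v "C x"] cb s v by (simp add: algebra_simps)
    finally have "2 *\<^sub>R (Cos u (C (Cos s x)) + Cos v (C (Cos s x))) = 2 *\<^sub>R (Cos u (Cos s (C x)) + Cos v (Cos s (C x)))"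
      unfolding 1 by (simp add: scaleR_add_right)
    then have "Cos u (C (Cos s x)) + Cos v (C (Cos s x)) = Cos u (Cos s (C x)) + Cos v (Cos s (C x))" by simp
    then have "Cos u y + Cos v y = 0"
      unfolding y_def using cb by (simp add: linear_diff[OF Cos_linear] algebra_simps)
    then show ?thesis by (simp add: add_eq_0_iff2)
  qed
  have "y = 0"
  proof (rule eventually_zero_imp_zero[OF True s])
    fix v assume v: "v \<ge> s"
    have e: "Cos (v + 2 * s) y = - Cos v y" "Cos (v + 4 * s) y = - Cos (v + 2 * s) y" "Cos (v + 4 * s) y = - Cos v y"
      by (rule pair; use v s in simp)+
    have "Cos (v + 2 * s) y = Cos v y" using trans[OF e(2)[symmetric] e(3)] by (rule neg_equal_iff_equal[THEN iffD1])
    from eq_minus_self_imp_0[OF trans[OF this[symmetric] e(1)]] show "Cos v y = 0" .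
  qed
  then show ?thesis unfolding y_def by simp
qed

text \<open>For t < s the given equation applies with the two times exchanged, so the operators have
  to commute. Under \<open>Cos c\<close> with large \<open>c\<close> their product is a sum that is
  symmetric in \<open>u\<close> and \<open>v\<close>.\<close>

lemma Cos_Cos_0:
  assumes n0: "n = 0" and t: "t \<ge> 0" "s \<ge> 0"
  shows "2 *\<^sub>R Cos t (Cos s x) = Cos (t + s) (C x) + Cos \<bar>t - s\<bar> (C x)"
proof -
  note E = C_cos0(2)[OF n0]
  have comm: "Cos v (Cos u x) = Cos u (Cos v x)" if uv: "u \<ge> 0" "v \<ge> 0" for u v
  proof -
    define y where "y = Cos v (Cos u x) - Cos u (Cos v x)"
    have "y = 0"
    proof (rule eventually_zero_imp_zero[OF n0])
      show "0 \<le> u + v" using uv by simp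
      fix c assume c: "c \<ge> u + v"
      have half: "2 *\<^sub>R (2 *\<^sub>R Cos c (Cos u' (Cos v' x)))
        = Cos (c + u' + v') (C (C x)) + Cos (c + u' - v') (C (C x)) + (Cos (c - u' + v') (C (C x)) + Cos (c - u' - v') (C (C x)))"
        if u': "u' \<ge> 0" "v' \<ge> 0" "c \<ge> u' + v'" for u' v'
      proof -
        have "2 *\<^sub>R Cos c (Cos u' (Cos v' x)) = Cos (c + u') (Cos v' (C x)) + Cos (c - u') (Cos v' (C x))"
          using E[of u' c "Cos v' x"] u' C_Cos_commute[OF u'(2)] by simp
        then have "2 *\<^sub>R (2 *\<^sub>R Cos c (Cos u' (Cos v' x))) = 2 *\<^sub>R Cos (c + u') (Cos v' (C x)) + 2 *\<^sub>R Cos (c - u') (Cos v' (C x))"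
          by (simp add: scaleR_add_right)
        then show ?thesis using E[of v' "c + u'" "C x"] E[of v' "c - u'" "C x"] u' by simp
      qed
      have "2 *\<^sub>R (2 *\<^sub>R Cos c (Cos u (Cos v x))) = 2 *\<^sub>R (2 *\<^sub>R Cos c (Cos v (Cos u x)))"
        using half[of u v] half[of v u] uv c by (simp add: algebra_simps)
      then have "Cos c (Cos u (Cos v x)) = Cos c (Cos v (Cos u x))" by simp
      then show "Cos c y = 0" unfolding y_def using c uv by (simp add: linear_diff[OF Cos_linear])
    qed
    then show ?thesis unfolding y_def by simp
  qed
  show ?thesis
  proof (cases "s \<le> t")
    case True
    then show ?thesis using E[OF t(2) True] by simp
  next
    case False
    then show ?thesis using E[of t s x] t comm[OF t] by (simp add: add.commute)
  qed
qed

lemma test_riemann_integral_Cos: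
  assumes "continuous_on UNIV w" "0 \<le> b" "0 \<le> c" "test_functional \<psi>"
  shows "\<psi> (riemann_integral \<gamma> b c (\<lambda>r. w r *\<^sub>R Cos r y)) = oriented_integral b c (\<lambda>r. w r * \<psi> (Cos r y))"
  by (rule orbit_riemann_integral[OF assms(4) Cos_cont Cos_orbit_growth assms(1-3)])

lemma Cos_Cos_pos:
  assumes n: "n > 0" and t: "t \<ge> 0" "s \<ge> 0" and \<psi>: "test_functional \<psi>"
  shows "2 * \<psi> (Cos t (Cos s x)) = (1 / fact (2 * n - 1)) * cosine_kernel (2 * n - 1) (\<lambda>r. \<psi> (Cos r (C x))) t s"
proof -
  note lin = test_functional_linear[OF \<psi>]
  let ?h = "\<lambda>r. \<psi> (Cos r (C x))"
  let ?g = "\<lambda>r. (t + s - r) ^ (2 * n - 1) *\<^sub>R Cos r (C x)"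
  have eq: "2 *\<^sub>R Cos t (Cos s x) = (1 / Gamma (real (2 * n))) *\<^sub>R
             (riemann_integral \<gamma> 0 (s + t) ?g - riemann_integral \<gamma> 0 t ?g - riemann_integral \<gamma> 0 s ?g
              + riemann_integral \<gamma> \<bar>t - s\<bar> t (\<lambda>r. (s - t + r) ^ (2 * n - 1) *\<^sub>R Cos r (C x))
              + riemann_integral \<gamma> \<bar>t - s\<bar> s (\<lambda>r. (t - s + r) ^ (2 * n - 1) *\<^sub>R Cos r (C x))
              + riemann_integral \<gamma> 0 \<bar>t - s\<bar> (\<lambda>r. (\<bar>t - s\<bar> + r) ^ (2 * n - 1) *\<^sub>R Cos r (C x)))"
    using cosine n t unfolding integrated_cosine_def Let_def by simp
  have G: "Gamma (real (2 * n)) = fact (2 * n - 1)"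
    using Gamma_fact[of "2 * n - 1", where 'a=real] n by (simp add: of_nat_diff)
  have w: "continuous_on UNIV (\<lambda>r. (t + s - r) ^ (2 * n - 1))" "continuous_on UNIV (\<lambda>r. (c + r) ^ (2 * n - 1))" for c :: real
    by (intro continuous_intros)+
  have "2 * \<psi> (Cos t (Cos s x)) = \<psi> (2 *\<^sub>R Cos t (Cos s x))" by (simp add: linear_scale[OF lin])
  also have "\<dots> = (1 / fact (2 * n - 1)) *
     (oriented_integral 0 (s + t) (\<lambda>r. (t + s - r) ^ (2 * n - 1) * ?h r) - oriented_integral 0 t (\<lambda>r. (t + s - r) ^ (2 * n - 1) * ?h r)
      - oriented_integral 0 s (\<lambda>r. (t + s - r) ^ (2 * n - 1) * ?h r)
      + oriented_integral \<bar>t - s\<bar> t (\<lambda>r. (s - t + r) ^ (2 * n - 1) * ?h r)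
      + oriented_integral \<bar>t - s\<bar> s (\<lambda>r. (t - s + r) ^ (2 * n - 1) * ?h r)
      + oriented_integral 0 \<bar>t - s\<bar> (\<lambda>r. (\<bar>t - s\<bar> + r) ^ (2 * n - 1) * ?h r))"
    unfolding eq G using t
    by (simp only: linear_scale[OF lin] linear_add[OF lin] linear_diff[OF lin] test_riemann_integral_Cos[OF w(1) _ _ \<psi>]
      test_riemann_integral_Cos[OF w(2) _ _ \<psi>] abs_ge_zero order.refl add_nonneg_nonneg real_scaleR_def)
  also have "\<dots> = (1 / fact (2 * n - 1)) * cosine_kernel (2 * n - 1) ?h t s"
    using cosine_kernel_eq[OF Cos_test_continuous[OF \<psi>, of "C x"] t, of "2 * n - 1"] n t
    by (simp add: oriented_integral_def[of 0])
  finally show ?thesis .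
qed

text \<open>The quotient \<open>l / l ^ (2 * n)\<close> is the power of \<open>l\<close> with
  exponent 1 - 2 n, written so that n = 0 is included. Since \<open>\<psi>\<close> composed with
  \<open>Cos t\<close> is again a test functional, both transforms can be written as scalar
  ones.\<close>

theorem L_L:
  assumes l: "a < m" "m < l"
  shows "L l (L m x) = (1 / (l\<^sup>2 - m\<^sup>2)) *\<^sub>R ((l / l ^ (2 * n)) *\<^sub>R L m (C x) - (m / m ^ (2 * n)) *\<^sub>R L l (C x))"
proof (rule test_functional_eqI)
  fix \<psi> assume \<psi>: "test_functional \<psi>"
  note lin = test_functional_linear[OF \<psi>]
  have al: "a < l" using l by simp
  let ?h = "\<lambda>r. \<psi> (Cos r (C x))"
  note hc = Cos_test_continuous[OF \<psi>, of "C x"] and he = Cos_test_exp_order[OF \<psi>, of "C x"]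
  have "\<psi> (L l (L m x)) = laplace (\<lambda>t. \<psi> (Cos t (L m x))) l" by (rule test_L[OF al \<psi>])
  also have "\<dots> = laplace (\<lambda>t. laplace (\<lambda>s. \<psi> (Cos t (Cos s x))) m) l"
    by (rule laplace_cong) (rule test_L[OF l(1) test_functional_Cos[OF \<psi>]])
  also have "\<dots> = (l / l ^ (2 * n) * laplace ?h m - m / m ^ (2 * n) * laplace ?h l) / (l\<^sup>2 - m\<^sup>2)"
  proof (cases "n = 0")
    case True
    obtain b where b: "a < b" "b < m" using dense[OF l(1)] by blast
    have "laplace (\<lambda>s. \<psi> (Cos t (Cos s x))) m = (1 / 2) * (lshift ?h m t + (conv ?h (\<lambda>v. exp (- m * v)) t + laplace ?h m * exp (- m * t)))"
      if t: "t \<ge> 0" for t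
    proof -
      have "\<psi> (Cos t (Cos s x)) = (1 / 2) * (?h (t + s) + ?h \<bar>t - s\<bar>)" if s: "s \<ge> 0" for s
      proof -
        have "\<psi> (2 *\<^sub>R Cos t (Cos s x)) = ?h (t + s) + ?h \<bar>t - s\<bar>"
          unfolding Cos_Cos_0[OF True t s] by (simp add: linear_add[OF lin])
        then show ?thesis by (simp add: linear_scale[OF lin])
      qed
      then have "laplace (\<lambda>s. \<psi> (Cos t (Cos s x))) m = laplace (\<lambda>s. (1 / 2) * (?h (t + s) + ?h \<bar>t - s\<bar>)) m"
        by (intro laplace_cong) simp
      also have "\<dots> = (1 / 2) * (laplace (\<lambda>s. ?h (t + s)) m + laplace (\<lambda>s. ?h \<bar>t - s\<bar>) m)"
        unfolding laplace_cmult laplace_add[OF exp_order_shift[OF he t] exp_order_abs_shift[OF hc he a_pos t] l(1)] ..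
      finally show ?thesis unfolding laplace_abs_shift[OF hc he a_pos l(1) t] lshift_def .
    qed
    then have eq: "laplace (\<lambda>t. laplace (\<lambda>s. \<psi> (Cos t (Cos s x))) m) l
      = laplace (\<lambda>t. (1 / 2) * (lshift ?h m t + (conv ?h (\<lambda>v. exp (- m * v)) t + laplace ?h m * exp (- m * t)))) l"
      by (rule laplace_cong)
    have half: "(1 / 2) * (2 * X / d) = X / d" for X d :: real by simp
    show ?thesis unfolding eq laplace_cmult laplace_laplace_dalembert[OF hc he a_pos l] half using True by simp
  next
    case False
    define k where "k = 2 * n - 1"
    have k: "k > 0" "Suc k = 2 * n" using False unfolding k_def by auto
    let ?R = "\<lambda>t. (fact k / m ^ Suc k * lshift ?h m t - laplace ?h m * lshift (\<lambda>x. x ^ k) m t)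
      + laplace ?h m * conv (\<lambda>x. x ^ k) (\<lambda>v. exp (- m * v)) t + fact k / m ^ Suc k * conv ?h (\<lambda>v. exp (- m * v)) t"
    have "laplace (\<lambda>s. \<psi> (Cos t (Cos s x))) m = (1 / (2 * fact k)) * ?R t" if t: "t \<ge> 0" for t
    proof -
      have "laplace (\<lambda>s. \<psi> (Cos t (Cos s x))) m = laplace (\<lambda>s. (1 / (2 * fact k)) * cosine_kernel k ?h t s) m"
      proof (rule laplace_cong)
        fix s :: real assume s: "s \<ge> 0"
        show "\<psi> (Cos t (Cos s x)) = (1 / (2 * fact k)) * cosine_kernel k ?h t s"
          using Cos_Cos_pos[OF _ t s \<psi>, of x] False unfolding k_def by simp
      qed
      then show ?thesis unfolding laplace_cmult laplace_cosine_kernel[OF hc he a_pos l(1) t k(1)] .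
    qed
    then have "laplace (\<lambda>t. laplace (\<lambda>s. \<psi> (Cos t (Cos s x))) m) l = laplace (\<lambda>t. (1 / (2 * fact k)) * ?R t) l"
      by (rule laplace_cong)
    also have "\<dots> = (1 / (2 * fact k)) * (2 * fact k * (l * laplace ?h m / l ^ Suc k - m * laplace ?h l / m ^ Suc k) / (l\<^sup>2 - m\<^sup>2))"
      unfolding laplace_cmult laplace_laplace_cosine_kernel[OF hc he a_pos l] ..
    also have "\<dots> = (l / l ^ (2 * n) * laplace ?h m - m / m ^ (2 * n) * laplace ?h l) / (l\<^sup>2 - m\<^sup>2)"
      unfolding k(2) by simp
    finally show ?thesis .
  qed
  also have "\<dots> = \<psi> ((1 / (l\<^sup>2 - m\<^sup>2)) *\<^sub>R ((l / l ^ (2 * n)) *\<^sub>R L m (C x) - (m / m ^ (2 * n)) *\<^sub>R L l (C x)))"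
    by (simp add: linear_scale[OF lin] linear_diff[OF lin] test_L[OF l(1) \<psi>] test_L[OF al \<psi>])
  finally show "\<psi> (L l (L m x)) = \<psi> ((1 / (l\<^sup>2 - m\<^sup>2)) *\<^sub>R ((l / l ^ (2 * n)) *\<^sub>R L m (C x) - (m / m ^ (2 * n)) *\<^sub>R L l (C x)))" .
qed

lemma L_zero_imp_zero:
  assumes m: "\<And>l. l > m \<Longrightarrow> L l x = 0" and "m \<ge> a"
  shows "x = 0"
proof (rule Cos_eq_0_imp)
  fix t :: real assume t: "t > 0"
  show "Cos t x = 0"
  proof (rule test_functional_eqI)
    fix \<psi> assume \<psi>: "test_functional \<psi>"
    have "laplace (\<lambda>t. \<psi> (Cos t x)) l = 0" if "l > m" for l
      using test_L[OF _ \<psi>, of l x] m[OF that] that \<open>m \<ge> a\<close> linear_0[OF test_functional_linear[OF \<psi>]] by simp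
    then have "\<psi> (Cos t x) = 0"
      using t by (intro laplace_eq_0_imp_eq_0[OF Cos_test_continuous[OF \<psi>] Cos_test_exp_order[OF \<psi>], of m]) auto
    then show "\<psi> (Cos t x) = \<psi> 0" using linear_0[OF test_functional_linear[OF \<psi>]] by simp
  qed
qed

lemma C_L_commute:
  assumes "m > a"
  shows "C (L m x) = L m (C x)"
proof (rule test_functional_eqI)
  fix p \<psi> assume p: "p \<in> P" and \<psi>: "test_functional \<psi>" "\<And>x. \<bar>\<psi> x\<bar> \<le> p x"
  have "\<psi> (C (L m x)) = laplace (\<lambda>t. \<psi> (C (Cos t x))) m"
    by (rule test_L[OF assms test_functional_C[OF p \<psi>]])
  also have "\<dots> = laplace (\<lambda>t. \<psi> (Cos t (C x))) m" by (rule laplace_cong) (simp add: C_Cos_commute)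
  finally show "\<psi> (C (L m x)) = \<psi> (L m (C x))" using test_L[OF assms \<psi>(1)] by simp
qed

text \<open>If \<open>L m y = 0\<close>, then \<open>L m (C y) = 0\<close> by commutation, and the
  resolvent equation forces \<open>L l (C y) = 0\<close> for all larger \<open>l\<close>; uniqueness
  of the transform and injectivity of \<open>C\<close> finish.\<close>

lemma L_injective:
  assumes m: "m > a" and "L m y = 0"
  shows "y = 0"
proof -
  have Lm: "L m (C y) = 0" using C_L_commute[OF m, of y] assms(2) linear_0[OF C_linear_real] by simp
  have "L l (C y) = 0" if l: "l > m" for l
  proof -
    have "l > a" using l m by simp
    define c d where "c = 1 / (l\<^sup>2 - m\<^sup>2)" and "d = m / m ^ (2 * n)"
    have nz: "c \<noteq> 0" "d \<noteq> 0" unfolding c_def d_def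
      using l m a_pos by (simp_all add: power2_eq_iff)
    have "0 = L l (L m y)" using assms(2) linear_0[OF L_linear[OF \<open>l > a\<close>]] by simp
    also have "\<dots> = - (c *\<^sub>R d *\<^sub>R L l (C y))"
      unfolding L_L[OF m l] Lm c_def d_def by (simp only: scaleR_zero_right diff_0 scaleR_minus_right)
    finally show ?thesis using nz by simp
  qed
  from L_zero_imp_zero[OF this] have "C y = 0" using m by simp
  then show ?thesis by (rule C_injective)
qed

end

section \<open>The subordinated family\<close>

text \<open>The Gaussian is traded for exponential decay of rate 1, the form in which
  \<open>improper_integral_exists\<close> asks for it. The 1/2 comes from completing the square with
  the extra term s.\<close>

lemma gauss_exp_bound:
  fixes b s :: real
  shows "exp (- s\<^sup>2) * exp (2 * b * s) \<le> exp ((b + 1 / 2)\<^sup>2) * exp (- 1 * s)"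
proof -
  have "0 \<le> (s - (b + 1 / 2))\<^sup>2" by simp
  then have "- s\<^sup>2 + 2 * b * s \<le> (b + 1 / 2)\<^sup>2 + (- 1 * s)" by (simp add: power2_eq_square algebra_simps)
  then show ?thesis unfolding exp_add[symmetric] by simp
qed

text \<open>A case of Legendre's duplication formula; the induction starts from the value sqrt pi at
  1/2.\<close>

lemma Gamma_nat_plus_half:
  "Gamma (real n + 1 / 2) = fact (2 * n) * sqrt pi / (4 ^ n * fact n)"
proof (induction n)
  case 0
  show ?case by (simp add: Gamma_one_half_real)
next
  case (Suc n)
  have "Gamma (real (Suc n) + 1 / 2) = Gamma ((real n + 1 / 2) + 1)" by (simp add: algebra_simps)
  also have "\<dots> = (real n + 1 / 2) * Gamma (real n + 1 / 2)" 
    by (rule Gamma_plus1) (metis (no_types, opaque_lifting) add_nonneg_pos half_gt_zero_iff less_numeral_extra(1) nonpos_Ints_nonpos not_le of_nat_0_le_iff zero_less_divide_1_iff zero_less_numeral)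
  also have "\<dots> = (real n + 1 / 2) * (fact (2 * n) * sqrt pi / (4 ^ n * fact n))" unfolding Suc ..
  also have "\<dots> = fact (2 * Suc n) * sqrt pi / (4 ^ Suc n * fact (Suc n))"
  proof -
    have "(fact (2 * Suc n) :: real) = (2 * real n + 2) * ((2 * real n + 1) * fact (2 * n))"
      by (simp add: algebra_simps)
    moreover have "(fact (Suc n) :: real) = (real n + 1) * fact n" by (simp add: algebra_simps)
    ultimately show ?thesis by (simp only: power_Suc) (simp add: divide_simps, simp add: algebra_simps)
  qed
  finally show ?case .
qed

text \<open>The exponent 2 n - 1 is -1 for \<open>n = 0\<close>, hence the integer power.\<close>

lemma normalising_constant:
  "fact (2 * n) / (2 powi (2 * int n - 1) * fact n * Gamma (real n + 1 / 2)) = 2 / sqrt pi"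
proof -
  have pw: "(2::real) powi (2 * int n - 1) = 4 ^ n / 2"
  proof -
    have "(2::real) powi (2 * int n - 1) = 2 powi (2 * int n) / 2 powi 1" by (rule power_int_diff) simp
    also have "(2::real) powi (2 * int n) = 4 ^ n"
      using power_int_of_nat[of "2::real" "2 * n"] by (simp add: power_mult)
    finally show ?thesis by simp
  qed
  show ?thesis unfolding pw Gamma_nat_plus_half by simp
qed

context saks
begin

lemma P_diff_continuous:
  fixes f g :: "real \<Rightarrow> 'a"
  assumes f: "continuous_map (top_of_set T) \<tau> f" and g: "continuous_map (top_of_set T) \<tau> g" and p: "p \<in> P"
  shows "continuous_on T (\<lambda>t. p (f t - g t))"
  unfolding continuous_on_def
proof
  fix t assume t: "t \<in> T"
  note Q = real_seminormD[OF P_real[OF p]]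
  have "((\<lambda>s. p (f s - f t) + p (g s - g t)) \<longlongrightarrow> 0 + 0) (at t within T)"
    by (intro tendsto_intros continuous_map_tauD[OF f t p] continuous_map_tauD[OF g t p])
  then have lim: "((\<lambda>s. p (f s - f t) + p (g s - g t)) \<longlongrightarrow> 0) (at t within T)" by simp
  have "norm (p (f s - g s) - p (f t - g t)) \<le> p (f s - f t) + p (g s - g t)" for s
  proof -
    have "\<bar>p (f s - g s) - p (f t - g t)\<bar> \<le> p ((f s - g s) - (f t - g t))" by (rule Q(8))
    also have "(f s - g s) - (f t - g t) = (f s - f t) - (g s - g t)" by simp
    also have "p ((f s - f t) - (g s - g t)) \<le> p (f s - f t) + p (g s - g t)" by (rule Q(6))
    finally show ?thesis by simp
  qed
  then have "((\<lambda>s. p (f s - g s) - p (f t - g t)) \<longlongrightarrow> 0) (at t within T)"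
    by (intro Lim_null_comparison[OF _ lim]) simp
  then show "((\<lambda>s. p (f s - g s)) \<longlongrightarrow> p (f t - g t)) (at t within T)" by (rule LIM_zero_cancel)
qed

end

locale subordinated_family = cosine_family +
  fixes S :: "real \<Rightarrow> 'b \<Rightarrow> 'b"
  assumes S_eq: "\<And>t x. t \<ge> 0 \<Longrightarrow>
    S t x = (2 / sqrt pi) *\<^sub>R improper_integral \<gamma> (\<lambda>s. exp (- s\<^sup>2) *\<^sub>R Cos (2 * sqrt t * s) x)"
begin

lemma Cos_sqrt_cont:
  assumes "t \<ge> 0"
  shows "continuous_map (top_of_set {0..}) \<tau> (\<lambda>s. Cos (2 * sqrt t * s) x)"
proof -
  have "continuous_map (top_of_set {0..}) (top_of_set {0..}) (\<lambda>s. 2 * sqrt t * s)"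
    using assms by (auto simp: continuous_map_in_subtopology intro!: continuous_intros)
  from continuous_map_compose[OF this Cos_cont[of x]] show ?thesis by (simp add: comp_def)
qed

lemma integrand_cont:
  assumes "t \<ge> 0"
  shows "continuous_map (top_of_set {0..}) \<tau> (\<lambda>s. exp (- s\<^sup>2) *\<^sub>R Cos (2 * sqrt t * s) x)"
  by (intro continuous_map_tau_scaleR Cos_sqrt_cont assms continuous_intros)

lemma Cos_sqrt_bound:
  assumes "t \<ge> 0" "s \<ge> 0"
  shows "norm (Cos (2 * sqrt t * s) x) \<le> M * norm x * exp (2 * (a * sqrt t) * s)"
  using Cos_orbit_growth[of "2 * sqrt t * s" x] assms by (simp add: mult_ac)

lemma integrand_bound:
  assumes "t \<ge> 0" "s \<ge> 0"
  shows "norm (exp (- s\<^sup>2) *\<^sub>R Cos (2 * sqrt t * s) x) \<le> (M * norm x * exp ((a * sqrt t + 1 / 2)\<^sup>2)) * exp (- 1 * s)"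
proof -
  have "norm (exp (- s\<^sup>2) *\<^sub>R Cos (2 * sqrt t * s) x) = exp (- s\<^sup>2) * norm (Cos (2 * sqrt t * s) x)" by simp
  also have "\<dots> \<le> exp (- s\<^sup>2) * (M * norm x * exp (2 * (a * sqrt t) * s))"
    by (intro mult_left_mono Cos_sqrt_bound assms) simp
  also have "\<dots> = (M * norm x) * (exp (- s\<^sup>2) * exp (2 * (a * sqrt t) * s))" by simp
  also have "\<dots> \<le> (M * norm x) * (exp ((a * sqrt t + 1 / 2)\<^sup>2) * exp (- 1 * s))"
    by (intro mult_left_mono gauss_exp_bound) (simp add: M_nonneg)
  finally show ?thesis by simp
qed

lemmas S_improper = improper_integral_exists[OF integrand_cont zero_less_one integrand_bound]

lemma test_S:
  assumes t: "t \<ge> 0" and \<psi>: "test_functional \<psi>"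
  shows "\<psi> (S t x) = subord (\<lambda>r. \<psi> (Cos r x)) t"
  unfolding S_eq[OF t] subord_def
  using S_improper(2)[OF t t _ \<psi>, of x]
  by (simp add: linear_scale[OF test_functional_linear[OF \<psi>]])

text \<open>Formulated for all mixed seminorms, as it serves both the norm bound, through the
  members of \<open>P\<close>, and the equicontinuity in \<open>\<gamma>\<close>.\<close>

lemma S_seminorm_bound:
  assumes q: "mixed_seminorm q" and B: "\<And>r. r \<ge> 0 \<Longrightarrow> q (Cos r x) \<le> B * exp (w * r)" and t: "t \<ge> 0"
  shows "q (S t x) \<le> 2 * B * exp (w\<^sup>2 * t)"
proof -
  obtain \<phi> where \<phi>: "test_functional \<phi>" "\<And>x. \<bar>\<phi> x\<bar> \<le> q x" "\<phi> (S t x) = q (S t x)"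
    using test_functional_norming[OF q] by blast
  have "\<bar>subord (\<lambda>r. \<phi> (Cos r x)) t\<bar> \<le> 2 * B * exp (w\<^sup>2 * t)"
    by (rule subord_bound[OF _ t]) (use \<phi>(2) B order.trans in blast)
  then show ?thesis using test_S[OF t \<phi>(1), of x] \<phi>(3) by simp
qed

lemma S_growth:
  assumes t: "t \<ge> 0"
  shows "norm (S t x) \<le> (2 * M * norm x) * exp (a\<^sup>2 * t)"
proof (rule norm_leI)
  fix p assume p: "p \<in> P"
  have "p (S t x) \<le> 2 * (M * norm x) * exp (a\<^sup>2 * t)"
    by (rule S_seminorm_bound[OF mixed_seminorm_P[OF p] _ t]) (use P_le_norm[OF p] Cos_orbit_growth order.trans in blast)
  then show "p (S t x) \<le> (2 * M * norm x) * exp (a\<^sup>2 * t)" by simp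
qed

lemma S_scl:
  assumes t: "t \<ge> 0"
  shows "S t (scl k x) = scl k (S t x)"
proof (rule test_functional_eqI)
  fix \<psi> assume \<psi>: "test_functional \<psi>"
  have "\<psi> (S t (scl k x)) = subord (\<lambda>r. \<psi> (scl k (Cos r x))) t"
    unfolding test_S[OF t \<psi>] subord_def
    by (intro arg_cong2[where f="(*)"] refl set_lebesgue_integral_cong) (auto simp: Cos_scl t)
  then show "\<psi> (S t (scl k x)) = \<psi> (scl k (S t x))" unfolding test_S[OF t test_functional_scl[OF \<psi>]] .
qed

lemma S_add:
  assumes t: "t \<ge> 0"
  shows "S t (x + y) = S t x + S t y"
proof (rule test_functional_eqI)
  fix \<psi> assume \<psi>: "test_functional \<psi>"
  note lin = test_functional_linear[OF \<psi>]
  have i: "set_integrable lborel {0..} (\<lambda>s. exp (- s\<^sup>2) * \<psi> (Cos (2 * sqrt t * s) z))" for z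
    using S_improper(3)[OF t t _ \<psi>, of z] by (simp add: linear_scale[OF lin])
  have "(LBINT s:{0..}. exp (- s\<^sup>2) * \<psi> (Cos (2 * sqrt t * s) (x + y)))
      = (LBINT s:{0..}. exp (- s\<^sup>2) * \<psi> (Cos (2 * sqrt t * s) x) + exp (- s\<^sup>2) * \<psi> (Cos (2 * sqrt t * s) y))"
    by (intro set_lebesgue_integral_cong) (auto simp: linear_add[OF Cos_linear] linear_add[OF lin] t algebra_simps)
  also have "\<dots> = (LBINT s:{0..}. exp (- s\<^sup>2) * \<psi> (Cos (2 * sqrt t * s) x)) + (LBINT s:{0..}. exp (- s\<^sup>2) * \<psi> (Cos (2 * sqrt t * s) y))"
    by (rule set_integral_add(2)[OF i i])
  finally show "\<psi> (S t (x + y)) = \<psi> (S t x + S t y)"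
    by (simp add: linear_add[OF lin] test_S[OF t \<psi>] subord_def distrib_left)
qed

lemma S_linear: "t \<ge> 0 \<Longrightarrow> linear (S t)"
  by (rule linearI) (simp_all add: S_add S_scl scl_of_real[symmetric])

lemma S_linear_scl: "t \<ge> 0 \<Longrightarrow> Vector_Spaces.linear scl scl (S t)"
  unfolding Vector_Spaces.linear_iff using vs by (simp add: S_add S_scl)

lemma S_bounded_linear:
  assumes "t \<ge> 0"
  shows "bounded_linear (S t)"
  by (rule bounded_linear_intro[of _ "2 * M * exp (a\<^sup>2 * t)"])
     (use linear_add[OF S_linear[OF assms]] linear_scale[OF S_linear[OF assms]] S_growth[OF assms] in \<open>auto simp: mult_ac\<close>)

text \<open>Two times and two vectors are compared at once: equal vectors will give continuity in
  time, and the pair \<open>u = 0\<close>, \<open>y = 0\<close> will give bi-equicontinuity.\<close>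

lemma S_diff_bound:
  assumes p: "p \<in> P" and t: "t \<ge> 0" "u \<ge> 0"
  shows "set_integrable lborel {0..} (\<lambda>s. exp (- s\<^sup>2) * p (Cos (2 * sqrt t * s) x - Cos (2 * sqrt u * s) y))" (is ?A)
    and "p (S t x - S u y) \<le> (2 / sqrt pi) * (LBINT s:{0..}. exp (- s\<^sup>2) * p (Cos (2 * sqrt t * s) x - Cos (2 * sqrt u * s) y))" (is ?B)
proof -
  let ?f = "\<lambda>s. Cos (2 * sqrt t * s) x" and ?g = "\<lambda>s. Cos (2 * sqrt u * s) y"
  note Q = real_seminormD[OF P_real[OF p]]
  define K where "K = M * norm x * exp ((a * sqrt t + 1 / 2)\<^sup>2) + M * norm y * exp ((a * sqrt u + 1 / 2)\<^sup>2)"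
  have "exp_order (\<lambda>s. exp (- s\<^sup>2) * p (?f s - ?g s)) (- 1)"
  proof (rule exp_orderI)
    show "continuous_on {0..} (\<lambda>s. exp (- s\<^sup>2) * p (?f s - ?g s))"
      by (intro continuous_intros P_diff_continuous[OF Cos_sqrt_cont Cos_sqrt_cont] t p)
    fix s :: real assume s: "s \<ge> 0"
    have "\<bar>exp (- s\<^sup>2) * p (?f s - ?g s)\<bar> = exp (- s\<^sup>2) * p (?f s - ?g s)" using Q(5) by simp
    also have "\<dots> \<le> exp (- s\<^sup>2) * (norm (?f s) + norm (?g s))"
      using P_le_norm[OF p, of "?f s - ?g s"] norm_triangle_ineq4[of "?f s" "?g s"] by (intro mult_left_mono) auto
    also have "\<dots> \<le> K * exp (- 1 * s)"
      using integrand_bound[OF t(1) s, of x] integrand_bound[OF t(2) s, of y] by (simp add: K_def algebra_simps)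
    finally show "\<bar>exp (- s\<^sup>2) * p (?f s - ?g s)\<bar> \<le> K * exp (- 1 * s)" .
  qed
  from exp_order_integrable[OF this, of 0] show A: ?A by simp
  obtain \<phi> where \<phi>: "test_functional \<phi>" "\<And>x. \<bar>\<phi> x\<bar> \<le> p x" "\<phi> (S t x - S u y) = p (S t x - S u y)"
    using test_functional_norming[OF mixed_seminorm_P[OF p]] by blast
  note lin = test_functional_linear[OF \<phi>(1)]
  have i: "set_integrable lborel {0..} (\<lambda>s. exp (- s\<^sup>2) * \<phi> (Cos (2 * sqrt v * s) z))" if "v \<ge> 0" for z v
    using S_improper(3)[OF that that _ \<phi>(1), of z] by (simp add: linear_scale[OF lin])
  have "(LBINT s:{0..}. exp (- s\<^sup>2) * \<phi> (?f s)) - (LBINT s:{0..}. exp (- s\<^sup>2) * \<phi> (?g s))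
      = (LBINT s:{0..}. exp (- s\<^sup>2) * \<phi> (?f s) - exp (- s\<^sup>2) * \<phi> (?g s))"
    by (rule set_integral_diff(2)[OF i[OF t(1)] i[OF t(2)], symmetric])
  also have "\<dots> \<le> (LBINT s:{0..}. exp (- s\<^sup>2) * p (?f s - ?g s))"
  proof (rule set_integral_mono[OF set_integral_diff(1)[OF i[OF t(1)] i[OF t(2)]] A])
    fix s
    have "\<phi> (?f s - ?g s) \<le> p (?f s - ?g s)" using \<phi>(2)[of "?f s - ?g s"] by linarith
    then have "exp (- s\<^sup>2) * \<phi> (?f s - ?g s) \<le> exp (- s\<^sup>2) * p (?f s - ?g s)" by (intro mult_left_mono) auto
    then show "exp (- s\<^sup>2) * \<phi> (?f s) - exp (- s\<^sup>2) * \<phi> (?g s) \<le> exp (- s\<^sup>2) * p (?f s - ?g s)"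
      by (simp add: linear_diff[OF lin] right_diff_distrib)
  qed
  finally have "(2 / sqrt pi) * ((LBINT s:{0..}. exp (- s\<^sup>2) * \<phi> (?f s)) - (LBINT s:{0..}. exp (- s\<^sup>2) * \<phi> (?g s)))
     \<le> (2 / sqrt pi) * (LBINT s:{0..}. exp (- s\<^sup>2) * p (?f s - ?g s))" by (rule mult_left_mono) simp
  moreover have "p (S t x - S u y) = (2 / sqrt pi) * ((LBINT s:{0..}. exp (- s\<^sup>2) * \<phi> (?f s)) - (LBINT s:{0..}. exp (- s\<^sup>2) * \<phi> (?g s)))"
    unfolding \<phi>(3)[symmetric] linear_diff[OF lin] test_S[OF t(1) \<phi>(1)] test_S[OF t(2) \<phi>(1)] subord_def
    by (simp add: right_diff_distrib)
  ultimately show ?B by simp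
qed

lemma S_diff_tendsto:
  assumes p: "p \<in> P" and t: "\<And>k. 0 \<le> t k" "\<And>k. t k \<le> T" and u: "\<And>k. 0 \<le> u k" "\<And>k. u k \<le> T"
    and x: "\<And>k. norm (x k) \<le> B" and y: "\<And>k. norm (y k) \<le> B"
    and lim: "\<And>s. s \<ge> 0 \<Longrightarrow> (\<lambda>k. p (Cos (2 * sqrt (t k) * s) (x k) - Cos (2 * sqrt (u k) * s) (y k))) \<longlonglongrightarrow> 0"
  shows "(\<lambda>k. p (S (t k) (x k) - S (u k) (y k))) \<longlonglongrightarrow> 0"
proof -
  note Q = real_seminormD[OF P_real[OF p]]
  let ?g = "\<lambda>k s. indicator {0..} s *\<^sub>R (exp (- s\<^sup>2) * p (Cos (2 * sqrt (t k) * s) (x k) - Cos (2 * sqrt (u k) * s) (y k)))"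
  have i: "integrable lborel (?g k)" for k
    using S_diff_bound(1)[OF p t(1) u(1)] unfolding set_integrable_def by blast
  have bnd: "norm (Cos (2 * sqrt v * s) z) \<le> M * B * exp (2 * (a * sqrt T) * s)"
    if "0 \<le> v" "v \<le> T" "norm z \<le> B" "s \<ge> 0" for v z s
  proof -
    have "norm (Cos (2 * sqrt v * s) z) \<le> M * norm z * exp (2 * (a * sqrt v) * s)" by (rule Cos_sqrt_bound) (use that in auto)
    also have "\<dots> \<le> M * B * exp (2 * (a * sqrt T) * s)"
    proof (intro mult_mono mult_left_mono)
      show "exp (2 * (a * sqrt v) * s) \<le> exp (2 * (a * sqrt T) * s)"
        using that a_pos by (auto intro!: mult_right_mono mult_left_mono)
      show "0 \<le> M * B" using M_nonneg order.trans[OF norm_ge_zero that(3)] by simp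
    qed (use that M_nonneg in auto)
    finally show ?thesis .
  qed
  \<comment> \<open>Dominated convergence; the majorant is the growth bound of \<open>Cos\<close> at
    the largest time \<open>T\<close>, integrable against the Gaussian.\<close>
  have "(\<lambda>k. LINT s|lborel. ?g k s) \<longlonglongrightarrow> (LINT (s::real)|lborel. (0::real))"
  proof (rule integral_dominated_convergence[where s="?g" and f="\<lambda>_. 0" and w="\<lambda>s. (2 * M * B) * (indicator {0..} s *\<^sub>R (exp (- s\<^sup>2) * exp (2 * (a * sqrt T) * s)))"])
    show "?g k \<in> borel_measurable lborel" for k using i by blast
    show "integrable lborel (\<lambda>s. (2 * M * B) * (indicator {0..} s *\<^sub>R (exp (- s\<^sup>2) * exp (2 * (a * sqrt T) * s))))"
      using gauss_exp_integrable(1)[of "a * sqrt T"] unfolding set_integrable_def by (rule integrable_mult_right)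
    show "AE s in lborel. (\<lambda>k. ?g k s) \<longlonglongrightarrow> 0"
    proof (rule AE_I2)
      fix s :: real
      show "(\<lambda>k. ?g k s) \<longlonglongrightarrow> 0"
      proof (cases "s \<ge> 0")
        case True
        have "(\<lambda>k. exp (- s\<^sup>2) * p (Cos (2 * sqrt (t k) * s) (x k) - Cos (2 * sqrt (u k) * s) (y k))) \<longlonglongrightarrow> exp (- s\<^sup>2) * 0"
          by (intro tendsto_intros lim True)
        then show ?thesis using True by simp
      qed simp
    qed
    show "AE s in lborel. norm (?g k s) \<le> (2 * M * B) * (indicator {0..} s *\<^sub>R (exp (- s\<^sup>2) * exp (2 * (a * sqrt T) * s)))" for k
    proof (rule AE_I2)
      fix s :: real
      show "norm (?g k s) \<le> (2 * M * B) * (indicator {0..} s *\<^sub>R (exp (- s\<^sup>2) * exp (2 * (a * sqrt T) * s)))"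
      proof (cases "s \<ge> 0")
        case True
        let ?d = "Cos (2 * sqrt (t k) * s) (x k) - Cos (2 * sqrt (u k) * s) (y k)"
        have "p ?d \<le> norm ?d" by (rule P_le_norm[OF p])
        also have "\<dots> \<le> norm (Cos (2 * sqrt (t k) * s) (x k)) + norm (Cos (2 * sqrt (u k) * s) (y k))" by (rule norm_triangle_ineq4)
        also have "\<dots> \<le> 2 * (M * B * exp (2 * (a * sqrt T) * s))"
          using bnd[OF t x True, of k k] bnd[OF u y True, of k k] by simp
        finally have "exp (- s\<^sup>2) * p ?d \<le> exp (- s\<^sup>2) * (2 * (M * B * exp (2 * (a * sqrt T) * s)))" by (rule mult_left_mono) simp
        then show ?thesis using True Q(5)[of ?d] by (simp add: mult_ac)
      qed simp
    qed
  qed simp_all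
  then have "(\<lambda>k. (2 / sqrt pi) * (LINT s|lborel. ?g k s)) \<longlonglongrightarrow> (2 / sqrt pi) * 0" by (intro tendsto_intros) simp
  then have lim0: "(\<lambda>k. (2 / sqrt pi) * (LINT s|lborel. ?g k s)) \<longlonglongrightarrow> 0" by simp
  have "norm (p (S (t k) (x k) - S (u k) (y k))) \<le> (2 / sqrt pi) * (LINT s|lborel. ?g k s)" for k
    using S_diff_bound(2)[OF p t(1)[of k] u(1)[of k], of "x k" "y k"] Q(5) unfolding set_lebesgue_integral_def by simp
  then show ?thesis by (intro Lim_null_comparison[OF _ lim0]) simp
qed

lemma S_cont: "continuous_map (top_of_set {0..}) \<tau> (\<lambda>t. S t x)"
proof (rule continuous_map_tauI)
  fix t :: real and p assume t: "t \<in> {0..}" and p: "p \<in> P"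
  show "((\<lambda>s. p (S s x - S t x)) \<longlongrightarrow> 0) (at t within {0..})"
    unfolding tendsto_at_iff_sequentially comp_def
  proof (intro allI impI)
    fix X :: "nat \<Rightarrow> real" assume X: "\<forall>i. X i \<in> {0..} - {t}" "X \<longlonglongrightarrow> t"
    have "bounded (range X)" using X(2) convergent_imp_bounded by blast
    then obtain T where T: "\<And>k. norm (X k) \<le> T" unfolding bounded_iff by auto
    show "(\<lambda>k. p (S (X k) x - S t x)) \<longlonglongrightarrow> 0"
    proof (rule S_diff_tendsto[OF p, of X "max T t" "\<lambda>_. t" "\<lambda>_. x" "norm x" "\<lambda>_. x"])
      show "0 \<le> X k" "0 \<le> t" for k using X t by auto
      show "X k \<le> max T t" for k using T[of k] by simp
      fix s :: real assume s: "s \<ge> 0"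
      let ?r = "2 * sqrt t * s"
      have c: "continuous_on {0..} (\<lambda>v. p (Cos v x - Cos ?r x))"
        by (rule P_diff_continuous[OF Cos_cont _ p]) simp
      have "(\<lambda>k. 2 * sqrt (X k) * s) \<longlonglongrightarrow> ?r" by (intro tendsto_intros X)
      from continuous_on_tendsto_compose[OF c this]
      have "(\<lambda>k. p (Cos (2 * sqrt (X k) * s) x - Cos ?r x)) \<longlonglongrightarrow> p (Cos ?r x - Cos ?r x)"
        using X t s by simp
      then show "(\<lambda>k. p (Cos (2 * sqrt (X k) * s) x - Cos ?r x)) \<longlonglongrightarrow> 0"
        using real_seminormD(3)[OF P_real[OF p]] by simp
    qed simp_all
  qed
qed

lemma S_bi_equicontinuous:
  assumes N: "compact N" "N \<subseteq> {0..}"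
  shows "bi_equicontinuous \<tau> N S"
  unfolding bi_equicontinuous_def
proof (intro allI impI)
  fix x l U assume x: "bounded (range x) \<and> limitin \<tau> x l sequentially" and U: "openin \<tau> U \<and> 0 \<in> U"
  obtain p e where p: "p \<in> P" "e > 0" "{y. p (y - 0) < e} \<subseteq> U" using U unfolding openin_tau by blast
  obtain B where B: "\<And>k. norm (x k) \<le> B" using x unfolding bounded_iff by auto
  obtain T where T: "\<And>t. t \<in> N \<Longrightarrow> \<bar>t\<bar> \<le> T" using compact_imp_bounded[OF N(1)] unfolding bounded_iff by auto
  define z where "z = (\<lambda>k. x k - l)"
  show "\<forall>\<^sub>F k in sequentially. \<forall>j\<in>N. S j (x k - l) \<in> U"
  proof (cases "N = {}")
    case False
    \<comment> \<open>For each \<open>k\<close> a time is chosen at which membership fails if it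
      fails anywhere in \<open>N\<close>; this reduces uniformity over \<open>N\<close> to a single
      sequence.\<close>
    have "\<exists>t\<in>N. (\<forall>j\<in>N. S j (z k) \<in> U) \<or> S t (z k) \<notin> U" for k using False by blast
    then obtain t where t: "\<And>k. t k \<in> N" "\<And>k. (\<forall>j\<in>N. S j (z k) \<in> U) \<or> S (t k) (z k) \<notin> U" by metis
    have t0: "0 \<le> t k" for k using t(1) N(2) by auto
    have "(\<lambda>k. p (S (t k) (z k) - S 0 0)) \<longlonglongrightarrow> 0"
    proof (rule S_diff_tendsto[OF p(1), of t "\<bar>T\<bar>" "\<lambda>_. 0" z "B + norm l" "\<lambda>_. 0"])
      show "0 \<le> t k" for k by (rule t0)
      show "t k \<le> \<bar>T\<bar>" for k using T[OF t(1), of k] by simp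
      show "norm (z k) \<le> B + norm l" for k using B[of k] norm_triangle_ineq4[of "x k" l] by (simp add: z_def)
      show "norm (0::'b) \<le> B + norm l" by (rule order.trans[OF _ add_mono[OF order.trans[OF norm_ge_zero B] norm_ge_zero]]) simp
      fix s :: real assume s: "s \<ge> 0"
      \<comment> \<open>For fixed \<open>s\<close> the times at which \<open>Cos\<close> is
        evaluated stay in this compact interval, so bi-equicontinuity of \<open>Cos\<close> applies
        to all of them at once.\<close>
      let ?N = "{0..2 * sqrt \<bar>T\<bar> * s}"
      have "bi_equicontinuous \<tau> ?N Cos" by (rule Cos_bi_equi) auto
      then have ev: "\<forall>\<^sub>F k in sequentially. \<forall>r\<in>?N. Cos r (z k) \<in> V" if "openin \<tau> V" "0 \<in> V" for V
        using x that unfolding bi_equicontinuous_def z_def by blast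
      show "(\<lambda>k. p (Cos (2 * sqrt (t k) * s) (z k) - Cos (2 * sqrt 0 * s) 0)) \<longlonglongrightarrow> 0"
      proof (rule tendstoI)
        fix d :: real assume d: "d > 0"
        have "\<forall>\<^sub>F k in sequentially. \<forall>r\<in>?N. Cos r (z k) \<in> {y. p (y - 0) < d}"
          using d real_seminormD(3)[OF P_real[OF p(1)]] by (intro ev openin_tau_ball p(1)) simp
        then show "\<forall>\<^sub>F k in sequentially. dist (p (Cos (2 * sqrt (t k) * s) (z k) - Cos (2 * sqrt 0 * s) 0)) 0 < d"
        proof eventually_elim
          case (elim k)
          have "sqrt (t k) * s \<le> sqrt \<bar>T\<bar> * s" using T[OF t(1), of k] s by (intro mult_right_mono) auto
          then have "2 * sqrt (t k) * s \<in> ?N" using t0[of k] s by simp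
          then have "p (Cos (2 * sqrt (t k) * s) (z k)) < d" using elim by auto
          then show ?case using real_seminormD(5)[OF P_real[OF p(1)]] linear_0[OF Cos_linear[of 0]] by simp
        qed
      qed
    qed auto
    moreover have "S 0 0 = 0" by (rule linear_0[OF S_linear]) simp
    ultimately have "\<forall>\<^sub>F k in sequentially. p (S (t k) (z k)) < e"
      using p(2) order_tendstoD(2)[of "\<lambda>k. p (S (t k) (z k))" 0 sequentially e] by simp
    then show ?thesis
    proof eventually_elim
      case (elim k)
      then have "S (t k) (z k) \<in> U" using p(3) by auto
      then show ?case using t(2)[of k] unfolding z_def by blast
    qed
  qed simp
qed

lemma S_locally_bi_continuous: "locally_bi_continuous scl \<tau> S"
  unfolding locally_bi_continuous_def strongly_continuous_def
proof (intro conjI allI impI)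
  show "Vector_Spaces.linear scl scl (S t)" "bounded_linear (S t)" if "t \<ge> 0" for t
    using that by (rule S_linear_scl, rule S_bounded_linear)
  show "continuous_map (top_of_set {0..}) \<tau> (\<lambda>t. S t x)" for x by (rule S_cont)
  fix N :: "real set" assume N: "compact N \<and> N \<subseteq> {0..}"
  then show "bi_equicontinuous \<tau> N S" by (intro S_bi_equicontinuous) auto
  have "bounded N" using N compact_imp_bounded by blast
  then obtain T where T: "\<And>t. t \<in> N \<Longrightarrow> \<bar>t\<bar> \<le> T" unfolding bounded_iff by auto
  have "onorm (S t) \<le> 2 * M * exp (a\<^sup>2 * T)" if t: "t \<in> N" for t
  proof (rule onorm_bound)
    show "0 \<le> 2 * M * exp (a\<^sup>2 * T)" using M_nonneg by simp
    fix x
    have "t \<ge> 0" "t \<le> T" using t N T[OF t] by auto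
    have "norm (S t x) \<le> (2 * M * norm x) * exp (a\<^sup>2 * t)" by (rule S_growth[OF \<open>t \<ge> 0\<close>])
    also have "\<dots> \<le> (2 * M * norm x) * exp (a\<^sup>2 * T)"
      using \<open>t \<le> T\<close> M_nonneg by (intro mult_left_mono) (auto intro: mult_left_mono)
    finally show "norm (S t x) \<le> 2 * M * exp (a\<^sup>2 * T) * norm x" by (simp add: mult_ac)
  qed
  then show "bdd_above ((\<lambda>t. onorm (S t)) ` N)" by (intro bdd_aboveI) auto
qed

lemma S_exponentially_bounded: "exponentially_bounded S"
  unfolding exponentially_bounded_def
proof (intro exI[of _ "- a\<^sup>2"] bdd_aboveI)
  fix c assume "c \<in> (\<lambda>t. onorm (\<lambda>x. exp (- a\<^sup>2 * t) *\<^sub>R S t x)) ` {0..}"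
  then obtain t where t: "t \<ge> 0" "c = onorm (\<lambda>x. exp (- a\<^sup>2 * t) *\<^sub>R S t x)" by auto
  show "c \<le> 2 * M" unfolding t(2)
  proof (rule onorm_bound)
    show "0 \<le> 2 * M" using M_nonneg by simp
    fix x
    have "norm (exp (- a\<^sup>2 * t) *\<^sub>R S t x) \<le> exp (- a\<^sup>2 * t) * ((2 * M * norm x) * exp (a\<^sup>2 * t))"
      using S_growth[OF t(1), of x] by simp
    also have "\<dots> = (exp (- a\<^sup>2 * t) * exp (a\<^sup>2 * t)) * (2 * M * norm x)" by simp
    also have "exp (- a\<^sup>2 * t) * exp (a\<^sup>2 * t) = 1" by (simp add: exp_add[symmetric])
    finally show "norm (exp (- a\<^sup>2 * t) *\<^sub>R S t x) \<le> 2 * M * norm x" by simp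
  qed
qed

end

section \<open>Functional equation and generator of the subordinated family\<close>

context subordinated_family
begin

lemma a2_pos: "a\<^sup>2 > 0"
  using a_pos by simp

lemma sqrt_gt: "l > a\<^sup>2 \<Longrightarrow> sqrt l > a"
  by (rule real_less_rsqrt)

lemma S_test_continuous: "test_functional \<psi> \<Longrightarrow> continuous_on {0..} (\<lambda>t. \<psi> (S t x))"
  by (rule orbit_continuous[OF _ S_cont S_growth]) auto

lemma S_test_exp_order: "test_functional \<psi> \<Longrightarrow> exp_order (\<lambda>t. \<psi> (S t x)) (a\<^sup>2)"
  by (rule orbit_exp_order[OF _ S_cont S_growth]) auto

lemma test_functional_S:
  assumes \<psi>: "test_functional \<psi>" and t: "t \<ge> 0"
  shows "test_functional (\<lambda>x. \<psi> (S t x))"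
proof (rule test_functional_bi_equicontinuous[OF \<psi> S_linear[OF t] _ S_bi_equicontinuous[of "{t}"]])
  show "norm (S t x) \<le> (2 * M * exp (a\<^sup>2 * t)) * norm x" for x using S_growth[OF t, of x] by (simp add: mult_ac)
qed (use t in auto)

lemma laplace_S:
  assumes l: "l > a\<^sup>2" and \<psi>: "test_functional \<psi>"
  shows "laplace (\<lambda>t. \<psi> (S t x)) l = (1 / sqrt l) * \<psi> (L (sqrt l) x)"
proof -
  have "laplace (\<lambda>t. \<psi> (S t x)) l = laplace (subord (\<lambda>r. \<psi> (Cos r x))) l"
    by (rule laplace_cong) (rule test_S[OF _ \<psi>])
  also have "\<dots> = laplace (\<lambda>r. \<psi> (Cos r x)) (sqrt l) / sqrt l"
    by (rule laplace_subord[OF Cos_test_exp_order[OF \<psi>] _ l]) (use a_pos in simp)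
  finally show ?thesis unfolding test_L[OF sqrt_gt[OF l] \<psi>] by simp
qed

lemma laplace_op_S:
  assumes l: "l > a\<^sup>2"
  shows "laplace_op \<gamma> m S l x = l ^ m *\<^sub>R (1 / sqrt l) *\<^sub>R L (sqrt l) x"
proof (rule test_functional_eqI)
  fix \<psi> assume \<psi>: "test_functional \<psi>"
  have "\<psi> (laplace_op \<gamma> m S l x) = l ^ m * laplace (\<lambda>t. \<psi> (S t x)) l"
    unfolding laplace_op_def by (rule orbit_laplace[OF \<psi> S_cont S_growth l]) simp_all
  then show "\<psi> (laplace_op \<gamma> m S l x) = \<psi> (l ^ m *\<^sub>R (1 / sqrt l) *\<^sub>R L (sqrt l) x)"
    unfolding laplace_S[OF l \<psi>] by (simp only: linear_scale[OF test_functional_linear[OF \<psi>]] real_scaleR_def)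
qed

lemma S_non_degenerate: "non_degenerate S"
  unfolding non_degenerate_def
proof (intro allI impI)
  fix x assume x: "\<forall>t>0. S t x = 0"
  have "L l x = 0" if l: "l > a" for l
  proof (rule test_functional_eqI)
    fix \<psi> assume \<psi>: "test_functional \<psi>"
    note lin = test_functional_linear[OF \<psi>]
    have l2: "l\<^sup>2 > a\<^sup>2" "sqrt (l\<^sup>2) = l" using l a_pos by (simp_all add: power_strict_mono)
    \<comment> \<open>The assumption covers positive times only; the value at 0 follows by
      continuity.\<close>
    have "(\<lambda>k. \<psi> (S (1 / real (Suc k)) x)) \<longlonglongrightarrow> \<psi> (S 0 x)"
      by (rule continuous_on_tendsto_compose[OF S_test_continuous[OF \<psi>] LIMSEQ_Suc[OF lim_1_over_n]]) simp_all
    moreover have "(\<lambda>k. \<psi> (S (1 / real (Suc k)) x)) = (\<lambda>k. 0)"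
      using x linear_0[OF lin] by (simp add: fun_eq_iff)
    ultimately have S0: "\<psi> (S 0 x) = 0" by (simp add: LIMSEQ_const_iff)
    have "laplace (\<lambda>t. \<psi> (S t x)) (l\<^sup>2) = laplace (\<lambda>t. 0) (l\<^sup>2)"
    proof (rule laplace_cong)
      fix t :: real assume "t \<ge> 0"
      then show "\<psi> (S t x) = 0" using S0 x linear_0[OF lin] by (cases "t = 0") auto
    qed
    then have "(1 / l) * \<psi> (L l x) = 0" using laplace_S[OF l2(1) \<psi>, of x] l2(2) by (simp add: laplace_def)
    then show "\<psi> (L l x) = \<psi> 0" using linear_0[OF lin] l a_pos by simp
  qed
  then show "x = 0" by (rule L_zero_imp_zero[of a]) simp_all
qed

lemma C_S_commute:
  assumes t: "t \<ge> 0"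
  shows "C (S t x) = S t (C x)"
proof (rule test_functional_eqI)
  fix p \<psi> assume p: "p \<in> P" and \<psi>: "test_functional \<psi>" "\<And>x. \<bar>\<psi> x\<bar> \<le> p x"
  have "\<psi> (C (S t x)) = subord (\<lambda>r. \<psi> (C (Cos r x))) t" by (rule test_S[OF t test_functional_C[OF p \<psi>]])
  also have "\<dots> = subord (\<lambda>r. \<psi> (Cos r (C x))) t"
    unfolding subord_def by (intro arg_cong2[where f="(*)"] refl set_lebesgue_integral_cong) (auto simp: C_Cos_commute t)
  finally show "\<psi> (C (S t x)) = \<psi> (S t (C x))" unfolding test_S[OF t \<psi>(1)] .
qed

lemma S_0: "S 0 x = Cos 0 x"
proof (rule test_functional_eqI)
  fix \<psi> assume \<psi>: "test_functional \<psi>"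
  have g: "(LBINT v:{0..}. exp (- v\<^sup>2)) = sqrt pi / 2"
    using gaussian_moment_0 unfolding set_lebesgue_integral_def by (simp add: has_bochner_integral_iff)
  have "\<psi> (S 0 x) = (2 / sqrt pi) * (LBINT v:{0..}. exp (- v\<^sup>2) * \<psi> (Cos 0 x))"
    using test_S[OF order.refl \<psi>, of x] by (simp add: subord_def)
  also have "(LBINT v:{0..}. exp (- v\<^sup>2) * \<psi> (Cos 0 x)) = (sqrt pi / 2) * \<psi> (Cos 0 x)"
    using g by simp
  finally show "\<psi> (S 0 x) = \<psi> (Cos 0 x)" by simp
qed

text \<open>The factors \<open>1 / \<mu>\<close> and \<open>1 / \<kappa>\<close> from the two
  transforms cancel against a numerator of \<open>L_L\<close> and the factor gained in returning
  from \<open>L\<close> to the transform of \<open>S\<close>. The \<open>2 * n\<close>-th powers of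
  the square roots become \<open>n\<close>-th powers: here 2 n integrations turn into n.\<close>

lemma laplace_laplace_S:
  fixes x :: 'b
  assumes l: "a\<^sup>2 < m" "m < l" and \<psi>: "test_functional \<psi>"
  defines "h \<equiv> \<lambda>r. \<psi> (S r (C x))"
  shows "laplace (\<lambda>t. laplace (\<lambda>s. \<psi> (S t (S s x))) m) l = (laplace h m / l ^ n - laplace h l / m ^ n) / (l - m)"
proof -
  have al: "a\<^sup>2 < l" and lm0: "0 < m" "0 < l" using l a2_pos by linarith+
  define \<mu> \<kappa> where "\<mu> = sqrt m" and "\<kappa> = sqrt l"
  have sq: "m = \<mu>\<^sup>2" "l = \<kappa>\<^sup>2" "0 < \<mu>" "0 < \<kappa>" "a < \<mu>" "\<mu> < \<kappa>"
    using lm0 l sqrt_gt[OF l(1)] unfolding \<mu>_def \<kappa>_def by auto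
  note lin = test_functional_linear[OF \<psi>]
  have "laplace (\<lambda>t. laplace (\<lambda>s. \<psi> (S t (S s x))) m) l = laplace (\<lambda>t. (1 / \<mu>) * \<psi> (S t (L \<mu> x))) l"
    by (rule laplace_cong) (use laplace_S[OF l(1) test_functional_S[OF \<psi>]] in \<open>simp add: \<mu>_def\<close>)
  also have "\<dots> = (1 / \<mu>) * ((1 / \<kappa>) * \<psi> (L \<kappa> (L \<mu> x)))"
    unfolding laplace_cmult laplace_S[OF al \<psi>] \<kappa>_def ..
  also have "\<psi> (L \<kappa> (L \<mu> x)) = (1 / (\<kappa>\<^sup>2 - \<mu>\<^sup>2)) * ((\<kappa> / \<kappa> ^ (2 * n)) * \<psi> (L \<mu> (C x)) - (\<mu> / \<mu> ^ (2 * n)) * \<psi> (L \<kappa> (C x)))"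
    unfolding L_L[OF sq(5,6)] by (simp only: linear_scale[OF lin] linear_diff[OF lin] real_scaleR_def)
  also have "\<psi> (L \<mu> (C x)) = \<mu> * laplace h m"
    using laplace_S[OF l(1) \<psi>, of "C x"] sq(3) unfolding h_def \<mu>_def by simp
  also have "\<psi> (L \<kappa> (C x)) = \<kappa> * laplace h l"
    using laplace_S[OF al \<psi>, of "C x"] sq(4) unfolding h_def \<kappa>_def by simp
  also have "(1 / \<mu>) * ((1 / \<kappa>) * ((1 / (\<kappa>\<^sup>2 - \<mu>\<^sup>2)) * ((\<kappa> / \<kappa> ^ (2 * n)) * (\<mu> * laplace h m) - (\<mu> / \<mu> ^ (2 * n)) * (\<kappa> * laplace h l))))
      = (laplace h m / l ^ n - laplace h l / m ^ n) / (l - m)"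
  proof -
    have p: "\<kappa> ^ (2 * n) = l ^ n" "\<mu> ^ (2 * n) = m ^ n" unfolding sq(1,2) by (simp_all add: power_mult)
    have "(\<kappa> / l ^ n) * (\<mu> * laplace h m) - (\<mu> / m ^ n) * (\<kappa> * laplace h l) = (\<mu> * \<kappa>) * (laplace h m / l ^ n - laplace h l / m ^ n)"
      by (simp add: algebra_simps)
    then show ?thesis unfolding p sq(1,2)[symmetric] using sq(3,4) by simp
  qed
  finally show ?thesis .
qed

text \<open>\<open>G\<close> stands for the right-hand side of the functional equation and
  \<open>H m\<close> for its transform in \<open>s\<close>. Uniqueness is used for fixed
  \<open>m\<close> in the variable \<open>t\<close>, then for fixed \<open>t\<close> in the variable
  \<open>s\<close>; this argument is common to \<open>n = 0\<close> and
  \<open>n > 0\<close>.\<close>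

lemma S_functional_equation_aux:
  assumes t: "t \<ge> 0" "s \<ge> 0" and \<psi>: "test_functional \<psi>"
    and b: "a\<^sup>2 < b"
    and Gc: "\<And>t. t \<ge> 0 \<Longrightarrow> continuous_on {0..} (G t)" and Ge: "\<And>t. t \<ge> 0 \<Longrightarrow> exp_order (G t) b"
    and G1: "\<And>t m. t \<ge> 0 \<Longrightarrow> m > b \<Longrightarrow> laplace (G t) m = H m t"
    and Hc: "\<And>m. m > b \<Longrightarrow> continuous_on {0..} (H m)" and He: "\<And>m. m > b \<Longrightarrow> exp_order (H m) b"
    and H1: "\<And>m l. m > b \<Longrightarrow> l > m \<Longrightarrow> laplace (H m) l
      = (laplace (\<lambda>r. \<psi> (S r (C x))) m / l ^ n - laplace (\<lambda>r. \<psi> (S r (C x))) l / m ^ n) / (l - m)"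
  shows "\<psi> (S t (S s x)) = G t s"
proof -
  have eq: "laplace (\<lambda>s. \<psi> (S t (S s x))) m = H m t" if m: "m > b" and t: "t \<ge> 0" for m t
  proof -
    have ma: "m > a\<^sup>2" using m b by simp
    have LS: "laplace (\<lambda>s. \<psi> (S t (S s x))) m = (1 / sqrt m) * \<psi> (S t (L (sqrt m) x))" if "t \<ge> 0" for t
      by (rule laplace_S[OF ma test_functional_S[OF \<psi> that]])
    let ?F = "\<lambda>t. (1 / sqrt m) * \<psi> (S t (L (sqrt m) x)) - H m t"
    \<comment> \<open>Uniqueness asks only for large \<open>l\<close>, so transforms computed under
      the restriction \<open>m < l\<close> suffice.\<close>
    have "?F t = 0"
    proof (rule laplace_eq_0_imp_eq_0[of ?F b m])
      show "continuous_on {0..} ?F" by (intro continuous_intros S_test_continuous \<psi> Hc m)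
      have Se: "exp_order (\<lambda>t. (1 / sqrt m) * \<psi> (S t (L (sqrt m) x))) b"
        by (rule exp_order_mono[OF exp_order_cmult[OF S_test_exp_order[OF \<psi>]]]) (use b in simp)
      show "exp_order ?F b" by (rule exp_order_diff[OF Se He[OF m]])
      fix l assume l: "l > m"
      then have "b < l" using m by simp
      have "laplace ?F l = laplace (\<lambda>t. (1 / sqrt m) * \<psi> (S t (L (sqrt m) x))) l - laplace (H m) l"
        by (rule laplace_diff[OF Se He[OF m] \<open>b < l\<close>])
      also have "laplace (\<lambda>t. (1 / sqrt m) * \<psi> (S t (L (sqrt m) x))) l = laplace (\<lambda>t. laplace (\<lambda>s. \<psi> (S t (S s x))) m) l"
        by (rule laplace_cong) (simp only: LS)
      finally show "laplace ?F l = 0" unfolding laplace_laplace_S[OF ma l \<psi>] H1[OF m l] by simp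
    qed (rule t)
    then show ?thesis unfolding LS[OF t] by simp
  qed
  let ?E = "\<lambda>s. \<psi> (S t (S s x)) - G t s"
  note \<psi>' = test_functional_S[OF \<psi> t(1)]
  have Se: "exp_order (\<lambda>s. \<psi> (S t (S s x))) b"
    by (rule exp_order_mono[OF S_test_exp_order[OF \<psi>']]) (use b in simp)
  have "?E s = 0"
  proof (rule laplace_eq_0_imp_eq_0[of ?E b b])
    show "continuous_on {0..} ?E" by (intro continuous_intros S_test_continuous[OF \<psi>'] Gc t)
    show "exp_order ?E b" by (rule exp_order_diff[OF Se Ge[OF t(1)]])
    fix m assume m: "m > b"
    have "laplace ?E m = laplace (\<lambda>s. \<psi> (S t (S s x))) m - laplace (G t) m"
      by (rule laplace_diff[OF Se Ge[OF t(1)] m])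
    then show "laplace ?E m = 0" using eq[OF m t(1)] G1[OF t(1) m] by simp
  qed (rule t)
  then show ?thesis by simp
qed

lemma S_functional_equation_0:
  assumes n: "n = 0" and t: "t \<ge> 0" "s \<ge> 0"
  shows "S t (S s x) = S (t + s) (C x)"
proof (rule test_functional_eqI)
  fix \<psi> assume \<psi>: "test_functional \<psi>"
  let ?h = "\<lambda>r. \<psi> (S r (C x))"
  note hc = S_test_continuous[OF \<psi>, of "C x"] and he = S_test_exp_order[OF \<psi>, of "C x"]
  have he': "exp_order ?h (a\<^sup>2 + 1)" by (rule exp_order_mono[OF he]) simp
  show "\<psi> (S t (S s x)) = \<psi> (S (t + s) (C x))"
  proof (rule S_functional_equation_aux[OF t \<psi>, of "a\<^sup>2 + 1" "\<lambda>t s. ?h (t + s)" "lshift ?h"])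
    fix t m :: real assume "t \<ge> 0"
    then show "continuous_on {0..} (\<lambda>s. ?h (t + s))" "exp_order (\<lambda>s. ?h (t + s)) (a\<^sup>2 + 1)"
      by (rule continuous_on_shift[OF hc], intro exp_order_shift he')
    show "laplace (\<lambda>s. ?h (t + s)) m = lshift ?h m t" by (simp add: lshift_def)
  next
    fix m l assume m: "a\<^sup>2 + 1 < m"
    show "continuous_on {0..} (lshift ?h m)" by (rule continuous_on_lshift[OF hc he' m])
    show "exp_order (lshift ?h m) (a\<^sup>2 + 1)" by (rule exp_order_lshift[OF hc he' m])
    assume l: "m < l"
    show "laplace (lshift ?h m) l = (laplace ?h m / l ^ n - laplace ?h l / m ^ n) / (l - m)"
      using laplace_lshift[OF he' m l] n by simp
  qed simp
qed

lemma S_functional_equation_pos: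
  assumes n: "n > 0" and t: "t \<ge> 0" "s \<ge> 0" and \<psi>: "test_functional \<psi>"
  shows "\<psi> (S t (S s x)) = (1 / fact (n - 1)) * semigroup_kernel (n - 1) (\<lambda>r. \<psi> (S r (C x))) t s"
proof -
  define k where "k = n - 1"
  have k: "Suc k = n" using n unfolding k_def by simp
  define b where "b = a\<^sup>2 + 1"
  have b: "a\<^sup>2 < b" "0 < b" using a2_pos unfolding b_def by linarith+
  let ?h = "\<lambda>r. \<psi> (S r (C x))"
  note hc = S_test_continuous[OF \<psi>, of "C x"] and he = S_test_exp_order[OF \<psi>, of "C x"]
  let ?R = "\<lambda>m t. fact k / m ^ Suc k * lshift ?h m t - laplace ?h m * lshift (\<lambda>x. x ^ k) m t"
  have pc: "continuous_on {0..} (\<lambda>x::real. x ^ k)" by (intro continuous_intros)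
  have "\<psi> (S t (S s x)) = (1 / fact k) * semigroup_kernel k ?h t s"
  proof (rule S_functional_equation_aux[OF t \<psi> b(1), of "\<lambda>t s. (1 / fact k) * semigroup_kernel k ?h t s" "\<lambda>m t. (1 / fact k) * ?R m t"])
    fix t :: real assume t: "t \<ge> 0"
    show "continuous_on {0..} (\<lambda>s. (1 / fact k) * semigroup_kernel k ?h t s)"
      by (intro continuous_intros continuous_on_semigroup_kernel[OF hc t])
    show "exp_order (\<lambda>s. (1 / fact k) * semigroup_kernel k ?h t s) b"
      by (rule exp_order_cmult[OF exp_order_semigroup_kernel[OF he a2_pos b(1) t]])
    fix m assume m: "m > b"
    then show "laplace (\<lambda>s. (1 / fact k) * semigroup_kernel k ?h t s) m = (1 / fact k) * ?R m t"
      unfolding laplace_cmult using laplace_semigroup_kernel[OF he a2_pos _ t, of m k] b(1) by simp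
  next
    fix m l assume m: "b < m"
    then have am: "a\<^sup>2 < m" using b by simp
    show "continuous_on {0..} (\<lambda>t. (1 / fact k) * ?R m t)"
      by (intro continuous_intros continuous_on_lshift[OF hc he am] continuous_on_lshift[OF pc exp_order_power[OF b(2)] m])
    show "exp_order (\<lambda>t. (1 / fact k) * ?R m t) b"
      by (intro exp_order_cmult exp_order_diff exp_order_lshift[OF pc exp_order_power[OF b(2)] m]
          exp_order_mono[OF exp_order_lshift[OF hc he am] less_imp_le[OF b(1)]])
    assume l: "m < l"
    show "laplace (\<lambda>t. (1 / fact k) * ?R m t) l = (laplace ?h m / l ^ n - laplace ?h l / m ^ n) / (l - m)"
      unfolding laplace_cmult laplace_laplace_semigroup_kernel[OF hc he a2_pos am l] unfolding k by simp
  qed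
  then show ?thesis unfolding k_def .
qed

lemma test_riemann_integral_S:
  assumes "continuous_on UNIV w" "0 \<le> b" "test_functional \<psi>"
  shows "\<psi> (riemann_integral \<gamma> 0 b (\<lambda>r. w r *\<^sub>R S r y)) = integral {0..b} (\<lambda>r. w r * \<psi> (S r y))"
  using orbit_riemann_integral[OF assms(3) S_cont S_growth assms(1) order.refl assms(2)] assms(2)
  by (simp add: oriented_integral_def)

text \<open>Orbits are bounded near each time, so their \<open>\<tau>\<close>-limits are
  \<open>\<gamma>\<close>-limits.\<close>

lemma S_strongly_continuous: "strongly_continuous \<gamma> S"
  unfolding strongly_continuous_def continuous_map_iff_limitin
proof (intro allI ballI)
  fix x and t :: real assume t: "t \<in> {0..}"
  show "limitin \<gamma> (\<lambda>t. S t x) (S t x) (at t within {0..})"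
  proof (rule limitin_gammaI)
    show "limitin \<tau> (\<lambda>t. S t x) (S t x) (at t within {0..})"
      using S_cont t unfolding continuous_map_iff_limitin by blast
    have "norm (S s x) \<le> (2 * M * norm x) * exp (a\<^sup>2 * (t + 1))" if s: "s \<in> {0..}" "dist s t < 1" for s
    proof -
      have "norm (S s x) \<le> (2 * M * norm x) * exp (a\<^sup>2 * s)" using s(1) by (intro S_growth) simp
      also have "\<dots> \<le> (2 * M * norm x) * exp (a\<^sup>2 * (t + 1))"
        using s(2) M_nonneg by (intro mult_left_mono) (auto simp: dist_real_def intro!: mult_left_mono)
      finally show ?thesis .
    qed
    then show "\<forall>\<^sub>F s in at t within {0..}. norm (S s x) \<le> (2 * M * norm x) * exp (a\<^sup>2 * (t + 1))"
      unfolding eventually_at by (intro exI[of _ 1]) auto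
  qed
qed

lemma S_integrated_semigroup: "integrated_semigroup scl \<gamma> n C S"
proof (cases "n = 0")
  case True
  then show ?thesis unfolding integrated_semigroup_def
    using S_linear_scl S_0 C_cos0(1) S_functional_equation_0 by simp
next
  case False
  have Cos0: "Cos 0 x = 0" for x using cosine False unfolding integrated_cosine_def by simp
  have G: "Gamma (real n) = fact (n - 1)"
    using Gamma_fact[of "n - 1", where 'a=real] False by (simp add: of_nat_diff)
  have fe: "S t (S s x) = (1 / Gamma (real n)) *\<^sub>R
      (riemann_integral \<gamma> 0 (s + t) (\<lambda>r. (t + s - r) ^ (n - 1) *\<^sub>R S r (C x))
       - riemann_integral \<gamma> 0 t (\<lambda>r. (t + s - r) ^ (n - 1) *\<^sub>R S r (C x))
       - riemann_integral \<gamma> 0 s (\<lambda>r. (t + s - r) ^ (n - 1) *\<^sub>R S r (C x)))"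
    if t: "t \<ge> 0" "s \<ge> 0" for t s x
  proof (rule test_functional_eqI)
    fix \<psi> assume \<psi>: "test_functional \<psi>"
    note lin = test_functional_linear[OF \<psi>]
    have w: "continuous_on UNIV (\<lambda>r. (t + s - r) ^ (n - 1))" by (intro continuous_intros)
    have st: "0 \<le> s + t" using t by simp
    show "\<psi> (S t (S s x)) = \<psi> ((1 / Gamma (real n)) *\<^sub>R
      (riemann_integral \<gamma> 0 (s + t) (\<lambda>r. (t + s - r) ^ (n - 1) *\<^sub>R S r (C x))
       - riemann_integral \<gamma> 0 t (\<lambda>r. (t + s - r) ^ (n - 1) *\<^sub>R S r (C x))
       - riemann_integral \<gamma> 0 s (\<lambda>r. (t + s - r) ^ (n - 1) *\<^sub>R S r (C x))))"
      unfolding S_functional_equation_pos[OF _ t \<psi>, unfolded neq0_conv[symmetric], OF False]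
        semigroup_kernel_eq[OF S_test_continuous[OF \<psi>] t, symmetric] G
      by (simp only: linear_scale[OF lin] linear_diff[OF lin] real_scaleR_def
          test_riemann_integral_S[OF w st \<psi>] test_riemann_integral_S[OF w t(1) \<psi>] test_riemann_integral_S[OF w t(2) \<psi>])
  qed
  show ?thesis unfolding integrated_semigroup_def Let_def
    using False S_linear_scl S_strongly_continuous S_0 Cos0 C_S_commute fe by simp
qed

lemma S_equicontinuous:
  assumes eq: "equicontinuous_family \<gamma> {0..} (\<lambda>t x. exp (- \<omega> * t) *\<^sub>R Cos t x)" and w: "\<omega> \<le> w"
  shows "equicontinuous_family \<gamma> {0..} (\<lambda>t x. exp (- w\<^sup>2 * t) *\<^sub>R S t x)"
  unfolding equicontinuous_family_def
proof (intro allI impI)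
  fix U assume "openin \<gamma> U \<and> 0 \<in> U"
  then obtain q where q: "mixed_seminorm q" "{x. q x < 1} \<subseteq> U" using gamma_nbhd_mixed_seminorm by blast
  note Q = real_seminormD[OF mixed_seminorm_real[OF q(1)]]
  \<comment> \<open>\<open>S_seminorm_bound\<close> doubles the constant, so 1/4 leads to 1/2 and
    the images lie in the unit ball of \<open>q\<close>.\<close>
  have "openin \<gamma> {y. q (y - 0) < 1 / 4} \<and> 0 \<in> {y. q (y - 0) < 1 / 4}"
    using Q(3) by (intro conjI openin_gamma_ball q(1)) simp
  then obtain V where V: "openin \<gamma> V" "0 \<in> V" "\<And>t x. t \<ge> 0 \<Longrightarrow> x \<in> V \<Longrightarrow> exp (- \<omega> * t) *\<^sub>R Cos t x \<in> {y. q (y - 0) < 1 / 4}"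
    using eq unfolding equicontinuous_family_def by (metis atLeast_iff)
  have "exp (- w\<^sup>2 * t) *\<^sub>R S t x \<in> U" if t: "t \<ge> 0" and x: "x \<in> V" for t x
  proof -
    have "q (Cos r x) \<le> (1 / 4) * exp (w * r)" if r: "r \<ge> 0" for r
    proof -
      have "exp (- \<omega> * r) * q (Cos r x) < 1 / 4" using V(3)[OF r x] by (simp add: Q(2))
      then have "exp (\<omega> * r) * (exp (- \<omega> * r) * q (Cos r x)) \<le> exp (\<omega> * r) * (1 / 4)" by (intro mult_left_mono) auto
      moreover have "exp (\<omega> * r) * (exp (- \<omega> * r) * q (Cos r x)) = q (Cos r x)"
        by (simp add: mult.assoc[symmetric] exp_add[symmetric])
      moreover have "exp (\<omega> * r) \<le> exp (w * r)" using w r by (simp add: mult_right_mono)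
      ultimately show ?thesis by linarith
    qed
    then have "q (S t x) \<le> 2 * (1 / 4) * exp (w\<^sup>2 * t)" by (rule S_seminorm_bound[OF q(1) _ t])
    then have "exp (- w\<^sup>2 * t) * q (S t x) \<le> exp (- w\<^sup>2 * t) * (2 * (1 / 4) * exp (w\<^sup>2 * t))" by (intro mult_left_mono) auto
    also have "\<dots> = (1 / 2) * (exp (- w\<^sup>2 * t) * exp (w\<^sup>2 * t))" by simp
    also have "exp (- w\<^sup>2 * t) * exp (w\<^sup>2 * t) = 1" by (simp add: exp_add[symmetric])
    finally have "q (exp (- w\<^sup>2 * t) *\<^sub>R S t x) < 1" by (simp add: Q(2))
    then show ?thesis using q(2) by blast
  qed
  then show "\<exists>V. openin \<gamma> V \<and> 0 \<in> V \<and> (\<forall>j\<in>{0..}. \<forall>x\<in>V. exp (- w\<^sup>2 * j) *\<^sub>R S j x \<in> U)"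
    using V(1,2) by (intro exI[of _ V]) auto
qed

lemma S_generator: "semigroup_generator \<gamma> n C S D A"
proof -
  obtain \<omega> where \<omega>: "\<omega> \<ge> 0" "equicontinuous_family \<gamma> {0..} (\<lambda>t x. exp (- \<omega> * t) *\<^sub>R Cos t x)"
    "\<And>l. l > \<omega> \<Longrightarrow> D = {x. C x \<in> range (laplace_op \<gamma> (2 * n) Cos l)}"
    "\<And>l x. l > \<omega> \<Longrightarrow> x \<in> D \<Longrightarrow> A x = l *\<^sub>R (l *\<^sub>R x - inv (laplace_op \<gamma> (2 * n) Cos l) (C x))"
    using generator unfolding cosine_generator_def by blast
  \<comment> \<open>For \<open>l\<close> beyond the square of \<open>w\<close> the root of
    \<open>l\<close> exceeds both \<open>\<omega>\<close>, above which the generator is described,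
    and \<open>a\<close>, above which \<open>L\<close> is under control.\<close>
  define w where "w = max \<omega> a"
  have w: "w > 0" "\<omega> \<le> w" "a \<le> w" using a_pos unfolding w_def by auto
  have main: "D = {x. C x \<in> range (laplace_op \<gamma> n S l)} \<and> (\<forall>x\<in>D. A x = l *\<^sub>R x - inv (laplace_op \<gamma> n S l) (C x))"
    if l: "l > w\<^sup>2" for l
  proof -
    define \<kappa> where "\<kappa> = sqrt l"
    have "w\<^sup>2 \<ge> a\<^sup>2" using w a_pos by (intro power_mono) auto
    then have la: "l > a\<^sup>2" using l by simp
    have "\<kappa> > w" unfolding \<kappa>_def using l by (rule real_less_rsqrt)
    then have lam: "\<kappa> > \<omega>" "\<kappa> > a" "\<kappa> > 0" using w by auto
    have l\<kappa>: "l = \<kappa>\<^sup>2" using l w unfolding \<kappa>_def by (smt (verit) real_sqrt_pow2 zero_le_power2)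
    define R where "R = laplace_op \<gamma> (2 * n) Cos \<kappa>"
    define RS where "RS = laplace_op \<gamma> n S l"
    have R: "R x = \<kappa> ^ (2 * n) *\<^sub>R L \<kappa> x" for x unfolding R_def by (rule laplace_op_Cos[OF lam(2)])
    \<comment> \<open>The two transforms differ by the factor \<open>1 / \<kappa>\<close>, so they
      have the same range, and the inverse is multiplied by \<open>\<kappa>\<close>; this accounts
      for the outer factor in the formula for the cosine generator.\<close>
    have RS: "RS x = (1 / \<kappa>) *\<^sub>R R x" for x
    proof -
      have "\<kappa> ^ (2 * n) = l ^ n" unfolding l\<kappa> by (simp add: power_mult)
      then show ?thesis unfolding RS_def laplace_op_S[OF la] R \<kappa>_def[symmetric] by (simp add: mult.commute)
    qed
    have lin: "linear R" unfolding R by (intro linear_compose_scale_right L_linear lam)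
    have injR: "inj R"
      unfolding linear_injective_0[OF lin] using L_injective[OF lam(2)] lam(3) by (auto simp: R)
    have RS_scale: "RS (\<kappa> *\<^sub>R x) = R x" for x unfolding RS linear_scale[OF lin] using lam(3) by simp
    have injRS: "inj RS"
      using injR lam(3) unfolding inj_def by (simp add: RS)
    have ran: "range RS = range R"
    proof
      show "range RS \<subseteq> range R"
      proof clarify
        fix x
        have "RS x = R ((1 / \<kappa>) *\<^sub>R x)" by (simp add: RS linear_scale[OF lin])
        then show "RS x \<in> range R" by simp
      qed
      show "range R \<subseteq> range RS" using RS_scale by (metis image_subsetI rangeI)
    qed
    have D: "D = {x. C x \<in> range RS}" unfolding ran R_def by (rule \<omega>(3)[OF lam(1)])
    have "A x = l *\<^sub>R x - inv RS (C x)" if x: "x \<in> D" for x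
    proof -
      obtain z where z: "C x = R z" using x D ran by auto
      have "inv R (C x) = z" unfolding z by (rule inv_f_f[OF injR])
      moreover have "inv RS (C x) = \<kappa> *\<^sub>R z" unfolding z RS_scale[symmetric] by (rule inv_f_f[OF injRS])
      moreover have "A x = \<kappa> *\<^sub>R (\<kappa> *\<^sub>R x - inv R (C x))" unfolding R_def by (rule \<omega>(4)[OF lam(1) x])
      ultimately show ?thesis unfolding l\<kappa> by (simp add: scaleR_diff_right power2_eq_square)
    qed
    with D show ?thesis unfolding RS_def by blast
  qed
  show ?thesis unfolding semigroup_generator_def
    using main S_equicontinuous[OF \<omega>(2) w(2)] w(1) by (intro exI[of _ "w\<^sup>2"]) auto
qed

end

theorem proposition6p23:
  fixes scl :: "'k::real_normed_field \<Rightarrow> 'a::real_normed_vector \<Rightarrow> 'a"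
    and \<tau> \<gamma> :: "'a topology"
    and C :: "'a \<Rightarrow> 'a"
    and n :: nat
    and Cos S :: "real \<Rightarrow> 'a \<Rightarrow> 'a"
    and D :: "'a set" and A :: "'a \<Rightarrow> 'a"
  assumes "Saks_space scl \<tau>"
    and "mixed_topology scl \<tau> \<gamma>"
    and "seq_complete \<gamma>"
    and "C_sequential \<gamma>"
    and "Vector_Spaces.linear scl scl C" and "continuous_map \<gamma> \<gamma> C"
    and "integrated_cosine scl \<gamma> (2 * n) C Cos"
    and "non_degenerate Cos"
    and "locally_bi_continuous scl \<tau> Cos"
    and "exponentially_bounded Cos"
    and "cosine_generator \<gamma> (2 * n) C Cos D A"
    and S_def: "\<And>t x. t \<ge> 0 \<Longrightarrow>
      S t x = (fact (2 * n) / (2 powi (2 * int n - 1) * fact n * Gamma (real n + 1 / 2))) *\<^sub>R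
        improper_integral \<gamma> (\<lambda>s. exp (- s\<^sup>2) *\<^sub>R Cos (2 * sqrt t * s) x)"
  shows "(\<forall>t\<ge>0. \<forall>x. \<exists>I. has_improper_integral \<gamma> (\<lambda>s. exp (- s\<^sup>2) *\<^sub>R Cos (2 * sqrt t * s) x) I) \<and>
    integrated_semigroup scl \<gamma> n C S \<and>
    non_degenerate S \<and>
    locally_bi_continuous scl \<tau> S \<and>
    exponentially_bounded S \<and>
    semigroup_generator \<gamma> n C S D A"
proof -
  note saks = assms(1)[unfolded Saks_space_def]
  obtain P where P': "directed_seminorms scl P \<and> generates_topology P \<tau> \<and>
      (\<forall>x. bdd_above ((\<lambda>p. p x) ` P) \<and> norm x = (SUP p\<in>P. p x))"
    using saks[THEN conjunct2, THEN conjunct2, THEN conjunct2] by (elim exE)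
  note P = P'[THEN conjunct1] P'[THEN conjunct2, THEN conjunct1]
    P'[THEN conjunct2, THEN conjunct2, rule_format, THEN conjunct1]
    P'[THEN conjunct2, THEN conjunct2, rule_format, THEN conjunct2]
  obtain \<alpha> K where K: "\<And>t. t \<ge> 0 \<Longrightarrow> onorm (\<lambda>x. exp (\<alpha> * t) *\<^sub>R Cos t x) \<le> K"
    using assms(10) unfolding exponentially_bounded_def bdd_above_def by auto
  have bl: "bounded_linear (Cos t)" if "t \<ge> 0" for t
    using assms(9) that unfolding locally_bi_continuous_def by blast
  \<comment> \<open>The summand 1 makes the rate positive, also for \<open>\<alpha> = 0\<close>, and
    the modulus makes the constant nonnegative.\<close>
  have growth: "norm (Cos t x) \<le> \<bar>K\<bar> * exp ((\<bar>\<alpha>\<bar> + 1) * t) * norm x" if t: "t \<ge> 0" for t x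
  proof -
    have "norm (exp (\<alpha> * t) *\<^sub>R Cos t x) \<le> onorm (\<lambda>x. exp (\<alpha> * t) *\<^sub>R Cos t x) * norm x"
      by (rule onorm[OF bounded_linear_const_scaleR[OF bl[OF t]]])
    also have "\<dots> \<le> \<bar>K\<bar> * norm x" using K[OF t] by (intro mult_right_mono) auto
    finally have le: "exp (\<alpha> * t) * norm (Cos t x) \<le> \<bar>K\<bar> * norm x" by simp
    have "norm (Cos t x) = (exp (- \<alpha> * t) * exp (\<alpha> * t)) * norm (Cos t x)" by (simp add: exp_add[symmetric])
    also have "\<dots> = exp (- \<alpha> * t) * (exp (\<alpha> * t) * norm (Cos t x))" by (rule mult.assoc)
    also have "\<dots> \<le> exp (- \<alpha> * t) * (\<bar>K\<bar> * norm x)" by (rule mult_left_mono[OF le]) simp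
    also have "\<dots> \<le> exp ((\<bar>\<alpha>\<bar> + 1) * t) * (\<bar>K\<bar> * norm x)"
    proof (rule mult_right_mono)
      have "- \<alpha> * t \<le> (\<bar>\<alpha>\<bar> + 1) * t" using t by (intro mult_right_mono) auto
      then show "exp (- \<alpha> * t) \<le> exp ((\<bar>\<alpha>\<bar> + 1) * t)" by simp
    qed simp
    finally show ?thesis by (simp add: mult_ac)
  qed
  interpret subordinated_family scl \<tau> \<gamma> P C n Cos D A "\<bar>K\<bar>" "\<bar>\<alpha>\<bar> + 1" S
  proof (intro subordinated_family.intro cosine_family.intro saks.intro cosine_family_axioms.intro
      subordinated_family_axioms.intro)
    show "normed_space_over scl" by (rule saks[THEN conjunct1])
    show "Hausdorff_space \<tau>" by (rule saks[THEN conjunct2, THEN conjunct1])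
    show "open U" if "openin \<tau> U" for U
      using saks[THEN conjunct2, THEN conjunct2, THEN conjunct1] that by blast
    show "directed_seminorms scl P" "generates_topology P \<tau>"
      "bdd_above ((\<lambda>p. p x) ` P)" "norm x = (SUP p\<in>P. p x)" for x by (rule P)+
    show "S t x = (2 / sqrt pi) *\<^sub>R improper_integral \<gamma> (\<lambda>s. exp (- s\<^sup>2) *\<^sub>R Cos (2 * sqrt t * s) x)" if "t \<ge> 0" for t x
      unfolding S_def[OF that] normalising_constant ..
  qed (use assms growth in auto)
  show ?thesis
    using S_improper(1) S_integrated_semigroup S_non_degenerate S_locally_bi_continuous S_exponentially_bounded S_generator
    by blast
qed

end
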